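(* Let $f$ be an operator convex function on an interval $\mathcal J\subseteq\mathbb R$ and let $\Phi$ be a conditional expectation from a unital $C^*$-algebra $\mathscr A$ of operators to a $C^*$-subalgebra $\mathscr B$ of $\mathscr A$ containing its identity $I$. If $C\in\mathscr B$ is invertible and $B\in\mathscr A$ is self-adjoint and $$\mathrm{sp}(I-\Phi(B))\cup\mathrm{sp}\big((I+C^*C)^{-1}\big)\cup\mathrm{sp}\big({C^*}^{-1}BC^{-1}\big)\subseteq\mathcal J,$$ then $$f(I-\Phi(B))+C^*\,\Phi\big(f({C^*}^{-1}BC^{-1})\big)\,C\ \ge\ f\big((I+C^*C)^{-1}\big)(I+C^*C).$$
   Context: $\mathrm{sp}$ denotes the spectrum; for self-adjoint operators, $A\le B$ means $B-A$ is positive; $f(A)$ is defined by the continuous functional calculus. A continuous real function $f$ on an interval $\mathcal J$ is operator convex if $f\left(\frac{A+B}{2}\right)\le\frac{f(A)+f(B)}{2}$ for all self-adjoint bounded Hilbert space operators $A,B$ with spectra contained in $\mathcal J$. A conditional expectation $\Phi$ from a unital $C^*$-algebra $\mathscr A$ of operators to a $C^*$-subalgebra $\mathscr B$ of $\mathscr A$ containing its identity is a linear norm reducing ($\|\Phi(X)\|\le\|X\|$) idempotent map of $\mathscr A$ onto $\mathscr B$ (so $\Phi(X)=X$ for $X\in\mathscr B$). Such a map is completely positive and satisfies the bimodule property $\Phi(AXB)=A\Phi(X)B$ for all $A,B\in\mathscr B$, $X\in\mathscr A$. *)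

theory Defs
  imports "HOL-Analysis.Analysis" "HOL-Library.Infinite_Typeclass"
begin

section \<open>Complex Hilbert spaces\<close>

text \<open>The real structure (\<^const>\<open>inner\<close>, \<^const>\<open>norm\<close>, topology, bounded operators \<open>'a \<Rightarrow>\<^sub>L 'a\<close>) is
  the one of the library; its inner product is the real part of the complex one, so both induce the
  same norm. The complex inner product is linear in its first argument.\<close>

class chilbert_space = real_inner + complete_space +
  fixes scaleC :: "complex \<Rightarrow> 'a \<Rightarrow> 'a"  (infixr \<open>*\<^sub>C\<close> 75)
    and cinner :: "'a \<Rightarrow> 'a \<Rightarrow> complex"
  assumes scaleC_add_right: "c *\<^sub>C (x + y) = c *\<^sub>C x + c *\<^sub>C y"
    and scaleC_add_left: "(c + d) *\<^sub>C x = c *\<^sub>C x + d *\<^sub>C x"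
    and scaleC_scaleC: "c *\<^sub>C d *\<^sub>C x = (c * d) *\<^sub>C x"
    and scaleC_of_real: "complex_of_real r *\<^sub>C x = r *\<^sub>R x"
    and cinner_commute: "cinner y x = cnj (cinner x y)"
    and cinner_add_left: "cinner (x + y) z = cinner x z + cinner y z"
    and cinner_scaleC_left: "cinner (c *\<^sub>C x) y = c * cinner x y"
    and Re_cinner: "Re (cinner x y) = inner x y"
begin

subclass banach ..

end

lemma cinner_self: "cinner x x = complex_of_real ((norm x)\<^sup>2)"
  for x :: "'a::chilbert_space"
proof -
  have "Im (cinner x x) = 0"
    using cinner_commute[of x x] by (simp add: complex_eq_iff)
  then show ?thesis
    by (simp add: complex_eq_iff Re_cinner power2_norm_eq_inner)
qed

lemma cinner_scaleC_right: "cinner x (c *\<^sub>C y) = cnj c * cinner x y"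
  for x y :: "'a::chilbert_space"
  by (metis cinner_commute cinner_scaleC_left complex_cnj_mult complex_cnj_cnj)

lemma norm_scaleC: "norm (c *\<^sub>C x) = cmod c * norm x" for x :: "'a::chilbert_space"
proof -
  have "complex_of_real ((norm (c *\<^sub>C x))\<^sup>2) = cnj c * (c * cinner x x)"
    unfolding cinner_self[symmetric] cinner_scaleC_left cinner_scaleC_right ..
  also have "\<dots> = complex_of_real ((cmod c * norm x)\<^sup>2)"
    by (simp add: cinner_self power_mult_distrib mult.assoc[symmetric] mult.commute[of "cnj c"]
        complex_norm_square[symmetric])
  finally have "(norm (c *\<^sub>C x))\<^sup>2 = (cmod c * norm x)\<^sup>2"
    using of_real_eq_iff by blast
  then show ?thesis
    by (simp add: power2_eq_iff_nonneg)
qed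

lemma scaleC_scaleR: "c *\<^sub>C r *\<^sub>R x = r *\<^sub>R c *\<^sub>C x" for x :: "'a::chilbert_space"
  by (simp add: scaleC_of_real[symmetric] scaleC_scaleC mult.commute)


section \<open>The Hilbert spaces of square-summable families\<close>

lemma square_summable_add:
  fixes f g :: "'i \<Rightarrow> complex"
  assumes "(\<lambda>i. (cmod (f i))\<^sup>2) summable_on A" "(\<lambda>i. (cmod (g i))\<^sup>2) summable_on A"
  shows "(\<lambda>i. (cmod (f i + g i))\<^sup>2) summable_on A"
proof (rule summable_on_comparison_test)
  show "(\<lambda>i. 2 * (cmod (f i))\<^sup>2 + 2 * (cmod (g i))\<^sup>2) summable_on A"
    using assms by (intro summable_on_add summable_on_cmult_right)
  show "(cmod (f i + g i))\<^sup>2 \<le> 2 * (cmod (f i))\<^sup>2 + 2 * (cmod (g i))\<^sup>2" for i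
  proof -
    have "(cmod (f i + g i))\<^sup>2 \<le> (cmod (f i) + cmod (g i))\<^sup>2"
      by (intro power_mono norm_triangle_ineq) auto
    also have "\<dots> \<le> 2 * (cmod (f i))\<^sup>2 + 2 * (cmod (g i))\<^sup>2"
      using sum_squares_bound[of "cmod (f i)" "cmod (g i)"] by (simp add: power2_sum)
    finally show ?thesis .
  qed
qed auto

lemma square_summable_scale:
  fixes f :: "'i \<Rightarrow> complex"
  assumes "(\<lambda>i. (cmod (f i))\<^sup>2) summable_on A"
  shows "(\<lambda>i. (cmod (c * f i))\<^sup>2) summable_on A"
  using summable_on_cmult_right[OF assms, of "(cmod c)\<^sup>2"]
  by (simp add: norm_mult power_mult_distrib)

lemma square_summable_mult_cnj:
  fixes f g :: "'i \<Rightarrow> complex"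
  assumes "(\<lambda>i. (cmod (f i))\<^sup>2) summable_on A" "(\<lambda>i. (cmod (g i))\<^sup>2) summable_on A"
  shows "(\<lambda>i. f i * cnj (g i)) summable_on A"
proof (rule abs_summable_summable, rule summable_on_comparison_test)
  show "(\<lambda>i. (cmod (f i))\<^sup>2 + (cmod (g i))\<^sup>2) summable_on A"
    using assms by (rule summable_on_add)
  show "cmod (f i * cnj (g i)) \<le> (cmod (f i))\<^sup>2 + (cmod (g i))\<^sup>2" for i
  proof -
    have "0 \<le> cmod (f i) * cmod (g i)"
      by simp
    then show ?thesis
      using sum_squares_bound[of "cmod (f i)" "cmod (g i)"] unfolding norm_mult complex_mod_cnj
      by linarith
  qed
qed auto

typedef 'i ell2 = "{f :: 'i \<Rightarrow> complex. (\<lambda>i. (cmod (f i))\<^sup>2) summable_on UNIV}"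
  morphisms ell2_nth Abs_ell2
  by (rule exI[of _ "\<lambda>_. 0"]) simp

setup_lifting type_definition_ell2

lemma ell2_square_summable: "(\<lambda>i. (cmod (ell2_nth f i))\<^sup>2) summable_on UNIV"
  using ell2_nth[of f] by simp

lemma ell2_cnj_summable: "(\<lambda>i. ell2_nth f i * cnj (ell2_nth g i)) summable_on UNIV"
  by (intro square_summable_mult_cnj ell2_square_summable)

instantiation ell2 :: (type) real_vector
begin

lift_definition zero_ell2 :: "'a ell2" is "\<lambda>_. 0" by simp
lift_definition plus_ell2 :: "'a ell2 \<Rightarrow> 'a ell2 \<Rightarrow> 'a ell2" is "\<lambda>f g i. f i + g i"
  by (rule square_summable_add)
lift_definition uminus_ell2 :: "'a ell2 \<Rightarrow> 'a ell2" is "\<lambda>f i. - f i" by simp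
lift_definition minus_ell2 :: "'a ell2 \<Rightarrow> 'a ell2 \<Rightarrow> 'a ell2" is "\<lambda>f g i. f i - g i"
proof -
  fix f g :: "'a \<Rightarrow> complex"
  assume "(\<lambda>i. (cmod (f i))\<^sup>2) summable_on UNIV" "(\<lambda>i. (cmod (g i))\<^sup>2) summable_on UNIV"
  then show "(\<lambda>i. (cmod (f i - g i))\<^sup>2) summable_on UNIV"
    using square_summable_add[of f UNIV "\<lambda>i. - g i"] by simp
qed
lift_definition scaleR_ell2 :: "real \<Rightarrow> 'a ell2 \<Rightarrow> 'a ell2" is "\<lambda>r f i. complex_of_real r * f i"
  by (rule square_summable_scale)

instance
  by standard (transfer; auto simp: algebra_simps)+

end

instantiation ell2 :: (type) real_inner
begin

definition inner_ell2 :: "'a ell2 \<Rightarrow> 'a ell2 \<Rightarrow> real" where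
  "inner_ell2 f g = Re (\<Sum>\<^sub>\<infinity>i. ell2_nth f i * cnj (ell2_nth g i))"
definition norm_ell2 :: "'a ell2 \<Rightarrow> real" where
  "norm_ell2 f = sqrt (inner f f)"
definition sgn_ell2 :: "'a ell2 \<Rightarrow> 'a ell2" where
  "sgn_ell2 f = f /\<^sub>R norm f"
definition dist_ell2 :: "'a ell2 \<Rightarrow> 'a ell2 \<Rightarrow> real" where
  "dist_ell2 f g = norm (f - g)"
definition uniformity_ell2 :: "('a ell2 \<times> 'a ell2) filter" where
  "uniformity_ell2 = (INF e\<in>{0<..}. principal {(x, y). dist x y < e})"
definition open_ell2 :: "'a ell2 set \<Rightarrow> bool" where
  "open_ell2 U = (\<forall>x\<in>U. \<forall>\<^sub>F (x', y) in uniformity. x' = x \<longrightarrow> y \<in> U)"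

lemma inner_ell2_self: "inner f f = (\<Sum>\<^sub>\<infinity>i. (cmod (ell2_nth f i))\<^sup>2)" for f :: "'a ell2"
proof -
  have "(\<Sum>\<^sub>\<infinity>i. ell2_nth f i * cnj (ell2_nth f i))
      = (\<Sum>\<^sub>\<infinity>i. complex_of_real ((cmod (ell2_nth f i))\<^sup>2))"
    by (rule infsum_cong) (rule complex_norm_square[symmetric])
  also have "\<dots> = complex_of_real (\<Sum>\<^sub>\<infinity>i. (cmod (ell2_nth f i))\<^sup>2)"
    by (rule infsumI, rule has_sum_of_real) (simp add: ell2_square_summable)
  finally show ?thesis
    by (simp add: inner_ell2_def)
qed

instance
proof
  fix f g h :: "'a ell2" and r :: real
  show "inner f g = inner g f"
  proof -
    have "(\<Sum>\<^sub>\<infinity>i. ell2_nth g i * cnj (ell2_nth f i))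
        = (\<Sum>\<^sub>\<infinity>i. cnj (ell2_nth f i * cnj (ell2_nth g i)))"
      by (simp add: mult.commute)
    also have "\<dots> = cnj (\<Sum>\<^sub>\<infinity>i. ell2_nth f i * cnj (ell2_nth g i))"
      by (rule infsum_cnj)
    finally show ?thesis
      by (simp add: inner_ell2_def)
  qed
  show "inner (f + g) h = inner f h + inner g h"
    unfolding inner_ell2_def plus_ell2.rep_eq
    by (simp add: distrib_right infsum_add ell2_cnj_summable)
  show "inner (r *\<^sub>R f) g = r * inner f g"
    unfolding inner_ell2_def scaleR_ell2.rep_eq
    by (simp add: mult.assoc infsum_cmult_right ell2_cnj_summable)
  show "0 \<le> inner f f"
    by (simp add: inner_ell2_self infsum_nonneg)
  show "inner f f = 0 \<longleftrightarrow> f = 0"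
  proof
    assume "inner f f = 0"
    then have "(cmod (ell2_nth f i))\<^sup>2 = 0" for i
      using nonneg_infsum_le_0D[of "\<lambda>i. (cmod (ell2_nth f i))\<^sup>2" UNIV i]
      by (simp add: inner_ell2_self ell2_square_summable)
    then show "f = 0"
      by (intro ell2_nth_inject[THEN iffD1] ext) (simp add: zero_ell2.rep_eq)
  qed (simp add: inner_ell2_self zero_ell2.rep_eq)
qed (fact norm_ell2_def sgn_ell2_def dist_ell2_def uniformity_ell2_def open_ell2_def)+

end

lemma ell2_finite_sum_le_norm:
  "finite F \<Longrightarrow> (\<Sum>i\<in>F. (cmod (ell2_nth f i))\<^sup>2) \<le> (norm f)\<^sup>2"
  unfolding power2_norm_eq_inner[of f] inner_ell2_self
  by (rule finite_sum_le_infsum) (auto simp: ell2_square_summable)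

lemma ell2_nth_le_norm: "cmod (ell2_nth f i) \<le> norm f"
proof -
  have "(cmod (ell2_nth f i))\<^sup>2 \<le> (norm f)\<^sup>2"
    using ell2_finite_sum_le_norm[of "{i}" f] by simp
  then show ?thesis
    by (rule power2_le_imp_le) simp
qed

instance ell2 :: (type) complete_space
proof
  fix X :: "nat \<Rightarrow> 'a ell2"
  assume X: "Cauchy X"
  have "Cauchy (\<lambda>n. ell2_nth (X n) i)" for i
  proof (rule metric_CauchyI)
    fix e :: real assume "e > 0"
    then obtain N where N: "\<And>m n. m \<ge> N \<Longrightarrow> n \<ge> N \<Longrightarrow> dist (X m) (X n) < e"
      using metric_CauchyD[OF X] by blast
    have "dist (ell2_nth (X m) i) (ell2_nth (X n) i) < e" if "m \<ge> N" "n \<ge> N" for m n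
      using N[OF that] ell2_nth_le_norm[of "X m - X n" i]
      by (simp add: dist_norm minus_ell2.rep_eq)
    then show "\<exists>N. \<forall>m\<ge>N. \<forall>n\<ge>N. dist (ell2_nth (X m) i) (ell2_nth (X n) i) < e"
      by blast
  qed
  then have "\<exists>y. (\<lambda>n. ell2_nth (X n) i) \<longlonglongrightarrow> y" for i
    using Cauchy_convergent convergent_def by blast
  then obtain y where y: "\<And>i. (\<lambda>n. ell2_nth (X n) i) \<longlonglongrightarrow> y i"
    by metis
  have fin: "\<exists>N. \<forall>n\<ge>N. \<forall>F. finite F \<longrightarrow> (\<Sum>i\<in>F. (cmod (ell2_nth (X n) i - y i))\<^sup>2) \<le> e\<^sup>2"
    if e: "e > 0" for e :: real
  proof -
    obtain N where N: "\<And>m n. m \<ge> N \<Longrightarrow> n \<ge> N \<Longrightarrow> dist (X m) (X n) < e"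
      using metric_CauchyD[OF X e] by blast
    have "(\<Sum>i\<in>F. (cmod (ell2_nth (X n) i - y i))\<^sup>2) \<le> e\<^sup>2" if n: "n \<ge> N" and F: "finite F" for n F
    proof (rule LIMSEQ_le_const2)
      show "(\<lambda>m. \<Sum>i\<in>F. (cmod (ell2_nth (X n) i - ell2_nth (X m) i))\<^sup>2)
          \<longlonglongrightarrow> (\<Sum>i\<in>F. (cmod (ell2_nth (X n) i - y i))\<^sup>2)"
        by (intro tendsto_intros y)
      have "(\<Sum>i\<in>F. (cmod (ell2_nth (X n) i - ell2_nth (X m) i))\<^sup>2) \<le> e\<^sup>2" if "m \<ge> N" for m
      proof -
        have "(\<Sum>i\<in>F. (cmod (ell2_nth (X n) i - ell2_nth (X m) i))\<^sup>2) \<le> (norm (X n - X m))\<^sup>2"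
          using ell2_finite_sum_le_norm[OF F, of "X n - X m"] by (simp add: minus_ell2.rep_eq)
        also have "\<dots> \<le> e\<^sup>2"
          using N[OF n that] by (intro power_mono) (auto simp: dist_norm)
        finally show ?thesis .
      qed
      then show "\<exists>N. \<forall>m\<ge>N. (\<Sum>i\<in>F. (cmod (ell2_nth (X n) i - ell2_nth (X m) i))\<^sup>2) \<le> e\<^sup>2"
        by blast
    qed
    then show ?thesis
      by blast
  qed
  have sub: "(\<lambda>i. (cmod (ell2_nth (X n) i - y i))\<^sup>2) summable_on UNIV"
    if "\<And>F. finite F \<Longrightarrow> (\<Sum>i\<in>F. (cmod (ell2_nth (X n) i - y i))\<^sup>2) \<le> e\<^sup>2" for n and e :: real
    using that by (intro nonneg_bdd_above_summable_on bdd_aboveI[of _ "e\<^sup>2"]) auto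
  obtain N where "\<And>F. finite F \<Longrightarrow> (\<Sum>i\<in>F. (cmod (ell2_nth (X N) i - y i))\<^sup>2) \<le> 1\<^sup>2"
    using fin[of 1] by auto
  then have "(\<lambda>i. (cmod (- (ell2_nth (X N) i - y i)))\<^sup>2) summable_on UNIV"
    using sub[of N 1] by (simp add: norm_minus_commute)
  from square_summable_add[OF this ell2_square_summable[of "X N"]]
  have "(\<lambda>i. (cmod (y i))\<^sup>2) summable_on UNIV"
    by simp
  then have Y: "ell2_nth (Abs_ell2 y) = y"
    by (simp add: Abs_ell2_inverse)
  have "X \<longlonglongrightarrow> Abs_ell2 y"
  proof (rule metric_LIMSEQ_I)
    fix e :: real assume e: "e > 0"
    then obtain N where
      N: "\<And>n F. n \<ge> N \<Longrightarrow> finite F \<Longrightarrow> (\<Sum>i\<in>F. (cmod (ell2_nth (X n) i - y i))\<^sup>2) \<le> (e / 2)\<^sup>2"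
      using fin[of "e / 2"] by auto
    have "dist (X n) (Abs_ell2 y) < e" if n: "n \<ge> N" for n
    proof -
      have "(norm (X n - Abs_ell2 y))\<^sup>2 \<le> (e / 2)\<^sup>2"
        unfolding power2_norm_eq_inner[of "X n - Abs_ell2 y"] inner_ell2_self minus_ell2.rep_eq Y
        using sub[of n "e / 2"] N[OF n] by (intro infsum_le_finite_sums) auto
      then have "norm (X n - Abs_ell2 y) \<le> e / 2"
        by (rule power2_le_imp_le) (use e in simp)
      then show ?thesis
        using e by (simp add: dist_norm)
    qed
    then show "\<exists>N. \<forall>n\<ge>N. dist (X n) (Abs_ell2 y) < e"
      by blast
  qed
  then show "convergent X"
    by (auto simp: convergent_def)
qed

instantiation ell2 :: (type) chilbert_space
begin

lift_definition scaleC_ell2 :: "complex \<Rightarrow> 'a ell2 \<Rightarrow> 'a ell2" is "\<lambda>c f i. c * f i"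
  by (rule square_summable_scale)

definition cinner_ell2 :: "'a ell2 \<Rightarrow> 'a ell2 \<Rightarrow> complex" where
  "cinner_ell2 f g = (\<Sum>\<^sub>\<infinity>i. ell2_nth f i * cnj (ell2_nth g i))"

instance
proof
  fix f g h :: "'a ell2" and c d :: complex and r :: real
  show "c *\<^sub>C (f + g) = c *\<^sub>C f + c *\<^sub>C g"
    by transfer (simp add: distrib_left)
  show "(c + d) *\<^sub>C f = c *\<^sub>C f + d *\<^sub>C f"
    by transfer (simp add: distrib_right)
  show "c *\<^sub>C d *\<^sub>C f = (c * d) *\<^sub>C f"
    by transfer (simp add: mult.assoc)
  show "complex_of_real r *\<^sub>C f = r *\<^sub>R f"
    by transfer simp
  show "cinner g f = cnj (cinner f g)"
    unfolding cinner_ell2_def infsum_cnj[symmetric] by (simp add: mult.commute)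
  show "cinner (f + g) h = cinner f h + cinner g h"
    unfolding cinner_ell2_def plus_ell2.rep_eq
    by (simp add: distrib_right infsum_add ell2_cnj_summable)
  show "cinner (c *\<^sub>C f) g = c * cinner f g"
    unfolding cinner_ell2_def scaleC_ell2.rep_eq
    by (simp add: mult.assoc infsum_cmult_right ell2_cnj_summable)
  show "Re (cinner f g) = inner f g"
    by (simp add: cinner_ell2_def inner_ell2_def)
qed

end


section \<open>Operators\<close>

lift_definition op_scaleC :: "complex \<Rightarrow> ('a::chilbert_space \<Rightarrow>\<^sub>L 'a) \<Rightarrow> ('a \<Rightarrow>\<^sub>L 'a)"
  is "\<lambda>c T x. c *\<^sub>C T x"
proof -
  fix c :: complex and T :: "'a \<Rightarrow> 'a"
  assume "bounded_linear T"
  then interpret T: bounded_linear T .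
  show "bounded_linear (\<lambda>x. c *\<^sub>C T x)"
  proof (rule bounded_linear_intro)
    show "norm (c *\<^sub>C T x) \<le> norm x * (cmod c * onorm T)" for x
      using mult_left_mono[OF onorm[OF T.bounded_linear, of x], of "cmod c"]
      by (simp add: norm_scaleC mult_ac)
  qed (simp_all add: T.add T.scaleR scaleC_add_right scaleC_scaleR)
qed

definition clinear_op :: "('a::chilbert_space \<Rightarrow>\<^sub>L 'a) \<Rightarrow> bool" where
  "clinear_op T \<longleftrightarrow> (\<forall>c x. T (c *\<^sub>C x) = c *\<^sub>C T x)"

definition adj :: "('a::chilbert_space \<Rightarrow>\<^sub>L 'a) \<Rightarrow> ('a \<Rightarrow>\<^sub>L 'a)" where
  "adj T = (THE S :: 'a \<Rightarrow>\<^sub>L 'a. \<forall>x y. cinner (T x) y = cinner x (S y))"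

definition selfadjoint :: "('a::chilbert_space \<Rightarrow>\<^sub>L 'a) \<Rightarrow> bool" where
  "selfadjoint T \<longleftrightarrow> clinear_op T \<and> adj T = T"

definition positive_op :: "('a::chilbert_space \<Rightarrow>\<^sub>L 'a) \<Rightarrow> bool" where
  "positive_op T \<longleftrightarrow> selfadjoint T \<and> (\<forall>x. Re (cinner (T x) x) \<ge> 0)"

definition op_le :: "('a::chilbert_space \<Rightarrow>\<^sub>L 'a) \<Rightarrow> ('a \<Rightarrow>\<^sub>L 'a) \<Rightarrow> bool"  (infix \<open>\<sqsubseteq>\<close> 50) where
  "S \<sqsubseteq> T \<longleftrightarrow> positive_op (T - S)"

text \<open>Closed subspaces \<open>M\<close> of a Hilbert space are Hilbert spaces; they correspond to the orthogonal
  projections \<open>P\<close> (with range \<open>M\<close>), and the bounded operators on \<open>M\<close> are identified with the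
  bounded operators \<open>T\<close> on the whole space such that \<open>T = P T P\<close>. The identity operator of \<open>M\<close> is
  then \<open>P\<close>, and invertibility, spectrum and functional calculus on \<open>M\<close> are taken with respect to the
  unit \<open>P\<close>. The case of the whole space is \<open>P = id_blinfun\<close>. Sums, products, adjoints, norms and the
  order do not depend on \<open>M\<close>.\<close>

definition projection :: "('a::chilbert_space \<Rightarrow>\<^sub>L 'a) \<Rightarrow> bool" where
  "projection P \<longleftrightarrow> selfadjoint P \<and> P o\<^sub>L P = P"

definition ops_on :: "('a::chilbert_space \<Rightarrow>\<^sub>L 'a) \<Rightarrow> ('a \<Rightarrow>\<^sub>L 'a) set" where
  "ops_on P = {T. clinear_op T \<and> P o\<^sub>L T o\<^sub>L P = T}"

definition is_inverse_on ::
    "('a::chilbert_space \<Rightarrow>\<^sub>L 'a) \<Rightarrow> ('a \<Rightarrow>\<^sub>L 'a) \<Rightarrow> ('a \<Rightarrow>\<^sub>L 'a) \<Rightarrow> bool" where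
  "is_inverse_on P T S \<longleftrightarrow> S \<in> ops_on P \<and> S o\<^sub>L T = P \<and> T o\<^sub>L S = P"

definition spectrum_on :: "('a::chilbert_space \<Rightarrow>\<^sub>L 'a) \<Rightarrow> ('a \<Rightarrow>\<^sub>L 'a) \<Rightarrow> complex set" where
  "spectrum_on P T = {z. \<not> (\<exists>S. is_inverse_on P (op_scaleC z P - T) S)}"

definition poly_on ::
    "('a::chilbert_space \<Rightarrow>\<^sub>L 'a) \<Rightarrow> real poly \<Rightarrow> ('a \<Rightarrow>\<^sub>L 'a) \<Rightarrow> ('a \<Rightarrow>\<^sub>L 'a)" where
  "poly_on P p T = (\<Sum>k\<le>degree p. coeff p k *\<^sub>R ((\<lambda>S. T o\<^sub>L S) ^^ k) P)"

text \<open>The continuous functional calculus \<open>f(T)\<close> of a self-adjoint \<open>T\<close>, for \<open>f\<close> continuous on the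
  (real, compact) spectrum: the norm limit of \<open>p\<^sub>n(T)\<close> for real polynomials \<open>p\<^sub>n\<close> converging to \<open>f\<close>
  uniformly on the spectrum.\<close>

definition cfc_on ::
    "('a::chilbert_space \<Rightarrow>\<^sub>L 'a) \<Rightarrow> (real \<Rightarrow> real) \<Rightarrow> ('a \<Rightarrow>\<^sub>L 'a) \<Rightarrow> ('a \<Rightarrow>\<^sub>L 'a)" where
  "cfc_on P f T = (THE S. \<exists>p :: nat \<Rightarrow> real poly.
     uniform_limit {t. complex_of_real t \<in> spectrum_on P T} (\<lambda>n. poly (p n)) f sequentially \<and>
     (\<lambda>n. poly_on P (p n) T) \<longlonglongrightarrow> S)"

abbreviation spectrum :: "('a::chilbert_space \<Rightarrow>\<^sub>L 'a) \<Rightarrow> complex set" where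
  "spectrum T \<equiv> spectrum_on id_blinfun T"

abbreviation cfc :: "(real \<Rightarrow> real) \<Rightarrow> ('a::chilbert_space \<Rightarrow>\<^sub>L 'a) \<Rightarrow> ('a \<Rightarrow>\<^sub>L 'a)" where
  "cfc f T \<equiv> cfc_on id_blinfun f T"

definition op_invertible :: "('a::chilbert_space \<Rightarrow>\<^sub>L 'a) \<Rightarrow> bool" where
  "op_invertible T \<longleftrightarrow> (\<exists>S. is_inverse_on id_blinfun T S)"

definition op_inv :: "('a::chilbert_space \<Rightarrow>\<^sub>L 'a) \<Rightarrow> ('a \<Rightarrow>\<^sub>L 'a)" where
  "op_inv T = (THE S. is_inverse_on id_blinfun T S)"


section \<open>Operator convex functions\<close>

text \<open>HOL cannot quantify over all Hilbert spaces (of all types) inside a formula. As every Hilbert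
  space is unitarily equivalent to a closed subspace of some \<open>\<ell>\<^sup>2(I)\<close>, the quantification is over the
  closed subspaces of \<open>\<ell>\<^sup>2('i)\<close>, that is, over all Hilbert spaces of dimension at most the cardinality
  of the index type \<open>'i\<close>, which plays the role of a universe.\<close>

definition operator_convex :: "'i itself \<Rightarrow> real set \<Rightarrow> (real \<Rightarrow> real) \<Rightarrow> bool" where
  "operator_convex _ J f \<longleftrightarrow> continuous_on J f \<and>
     (\<forall>P :: 'i ell2 \<Rightarrow>\<^sub>L 'i ell2. projection P \<longrightarrow>
       (\<forall>A\<in>ops_on P. \<forall>B\<in>ops_on P.
          selfadjoint A \<and> selfadjoint B \<and>
          spectrum_on P A \<subseteq> complex_of_real ` J \<and> spectrum_on P B \<subseteq> complex_of_real ` J \<longrightarrow>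
          cfc_on P f ((1 / 2) *\<^sub>R (A + B)) \<sqsubseteq> (1 / 2) *\<^sub>R (cfc_on P f A + cfc_on P f B)))"


section \<open>Operator algebras and conditional expectations\<close>

definition cstar_algebra :: "('a::chilbert_space \<Rightarrow>\<^sub>L 'a) set \<Rightarrow> bool" where
  "cstar_algebra \<A> \<longleftrightarrow>
     (\<forall>T\<in>\<A>. clinear_op T) \<and> \<A> \<noteq> {} \<and>
     (\<forall>S\<in>\<A>. \<forall>T\<in>\<A>. S + T \<in> \<A>) \<and>
     (\<forall>c. \<forall>T\<in>\<A>. op_scaleC c T \<in> \<A>) \<and>
     (\<forall>S\<in>\<A>. \<forall>T\<in>\<A>. S o\<^sub>L T \<in> \<A>) \<and>
     (\<forall>T\<in>\<A>. adj T \<in> \<A>) \<and>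
     closed \<A>"

text \<open>The unit of a unital \<open>C\<^sup>*\<close>-algebra of operators is the identity operator.\<close>

definition unital_cstar_algebra :: "('a::chilbert_space \<Rightarrow>\<^sub>L 'a) set \<Rightarrow> bool" where
  "unital_cstar_algebra \<A> \<longleftrightarrow> cstar_algebra \<A> \<and> id_blinfun \<in> \<A>"

text \<open>Only the values of \<open>\<Phi>\<close> on \<open>\<A>\<close> matter.\<close>

definition conditional_expectation ::
    "(('a::chilbert_space \<Rightarrow>\<^sub>L 'a) \<Rightarrow> ('a \<Rightarrow>\<^sub>L 'a)) \<Rightarrow> ('a \<Rightarrow>\<^sub>L 'a) set \<Rightarrow> ('a \<Rightarrow>\<^sub>L 'a) set \<Rightarrow> bool" where
  "conditional_expectation \<Phi> \<A> \<B> \<longleftrightarrow>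
     (\<forall>X\<in>\<A>. \<forall>Y\<in>\<A>. \<Phi> (X + Y) = \<Phi> X + \<Phi> Y) \<and>
     (\<forall>c. \<forall>X\<in>\<A>. \<Phi> (op_scaleC c X) = op_scaleC c (\<Phi> X)) \<and>
     (\<forall>X\<in>\<A>. norm (\<Phi> X) \<le> norm X) \<and>
     \<Phi> ` \<A> = \<B> \<and>
     (\<forall>X\<in>\<A>. \<Phi> (\<Phi> X) = \<Phi> X)"

end

theory Submission
  imports Defs "HOL-Computational_Algebra.Fundamental_Theorem_Algebra"
begin

text \<open>Put \<open>D = 1 + C\<^sup>* C\<close>, \<open>S = D\<^sup>-\<^sup>1\<close>, \<open>A = 1 - \<Phi>(B)\<close> and \<open>Y = C\<^sup>*\<^sup>-\<^sup>1 B C\<^sup>-\<^sup>1\<close>. The module property of \<open>\<Phi>\<close> gives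
  \<open>C\<^sup>* \<Phi>(Y) C = \<Phi>(B)\<close>, hence \<open>A + C\<^sup>* \<Phi>(Y) C = 1 = D S\<close>, while \<open>1 + C\<^sup>* C = D\<close>. In this sense \<open>S\<close> is an
  average of \<open>A\<close> and \<open>Y\<close> with operator weights of total mass \<open>D\<close>, and the claim
  \<open>D f(S) \<le> f(A) + C\<^sup>* \<Phi>(f(Y)) C\<close> is Jensen's inequality for this average.

  The average is made discrete with a partition of unity into hat functions \<open>g\<^sub>0, \<dots>, g\<^sub>n\<close> on a grid
  \<open>t\<^sub>0, \<dots>, t\<^sub>n\<close> (\<open>partition_of_unity\<close>). Hat functions satisfy \<open>\<Sum> g\<^sub>i = 1\<close> and \<open>\<Sum> t\<^sub>i g\<^sub>i(t) = t\<close> exactly and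
  \<open>\<Sum> f(t\<^sub>i) g\<^sub>i \<approx> f\<close> uniformly. So the positive operators \<open>g\<^sub>i(A)\<close> and \<open>C\<^sup>* \<Phi>(g\<^sub>i(Y)) C\<close> add up to \<open>D\<close>, add up
  to \<open>D S\<close> when weighted with \<open>t\<^sub>i\<close>, and to the right-hand side up to a small error when weighted with
  \<open>f(t\<^sub>i)\<close>. This step uses that \<open>\<Phi>\<close> is positive.

  The discrete inequality is \<open>weighted_jensen\<close>. The weights are dilated to a diagonal operator \<open>T\<close> with
  entries \<open>t\<^sub>i\<close>, of which \<open>S\<close> is a compression, and the compression is compared with \<open>T\<close> by applying
  midpoint convexity to \<open>T\<close> and its image under a reflection (\<open>jensen_compression\<close>). Convexity is
  available over the spaces \<open>\<ell>\<^sup>2\<close> of one infinite index type, whereas the given Hilbert space may be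
  larger. But \<open>f\<close> may be replaced by a polynomial \<open>p\<close> at the cost of a small error, and \<open>p(S) y\<close> involves
  finitely many vectors; so finite-dimensional dilations suffice.

  Two further parts supply the tools. The functional calculus of a self-adjoint \<open>X\<close> rests on
  \<open>\<parallel>p(X)\<parallel> \<le> sup \<bar>p\<bar>\<close> over the spectrum (\<open>norm_poly_op_le\<close>). This follows from the facts that \<open>\<parallel>X\<parallel>\<close> or \<open>-\<parallel>X\<parallel>\<close>
  is in the spectrum and that \<open>p(X)\<close> can be factored. A conditional expectation, given as a contractive
  idempotent, is shown to preserve adjoints and positivity and to be a module map over its range,
  which is Tomiyama's theorem. For the latter, a norm estimate shows \<open>G \<Phi>(K X) = 0\<close> whenever \<open>K G = 0\<close>,
  with \<open>K\<close> self-adjoint and \<open>0 \<le> G \<le> 1\<close> in the range (\<open>\<Phi>_zero_product\<close>). Applied to pairs of hat functions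
  of a self-adjoint \<open>b\<close> in the range, it shows that \<open>\<Phi>(b X)\<close> and \<open>b \<Phi>(X)\<close> differ only by contributions
  from neighbouring hats, which vanish as the grid is refined.\<close>

section \<open>Adjoints\<close>

lemma quadratic_nonneg_imp_linear_zero:
  fixes a b :: real
  assumes "\<And>t. 0 \<le> a * t\<^sup>2 + b * t"
  shows "b = 0"
proof (rule ccontr)
  assume b: "b \<noteq> 0"
  define s where "s = \<bar>a\<bar> + 1"
  have s: "s > 0" "a < s" by (auto simp: s_def)
  have "a * (- b / s)\<^sup>2 + b * (- b / s) = b\<^sup>2 / s\<^sup>2 * (a - s)"
    using s by (simp add: field_simps power2_eq_square)
  also have "\<dots> < 0" using s b by (intro mult_pos_neg) auto
  finally show False using assms[of "- b / s"] by simp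
qed

text \<open>The functional is represented by the minimizer of \<open>\<parallel>z\<parallel>\<^sup>2 - 2 \<phi>(z)\<close>; the parallelogram law makes
  every minimizing sequence a Cauchy sequence.\<close>

lemma riesz_representation:
  fixes \<phi> :: "'a::{real_inner,complete_space} \<Rightarrow> real"
  assumes "bounded_linear \<phi>"
  shows "\<exists>z. \<forall>x. \<phi> x = inner x z"
proof -
  interpret bounded_linear \<phi> by fact
  obtain K where K: "\<And>x. \<bar>\<phi> x\<bar> \<le> norm x * K"
    using bounded by auto
  define J where "J z = (norm z)\<^sup>2 - 2 * \<phi> z" for z
  have "J z \<ge> - K\<^sup>2" for z
  proof -
    have "0 \<le> (norm z - K)\<^sup>2" by simp
    then show ?thesis using K[of z] by (simp add: J_def power2_diff)
  qed
  then have bdd: "bdd_below (range J)" by (rule bdd_belowI2)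
  define m where "m = Inf (range J)"
  have mle: "m \<le> J z" for z unfolding m_def using bdd by (intro cInf_lower) auto
  have "\<exists>z. J z < m + inverse (real (Suc n))" for n
    using cInf_lessD[of "range J" "m + inverse (real (Suc n))"] unfolding m_def by auto
  then obtain Z where Z: "\<And>n. J (Z n) < m + inverse (real (Suc n))" by metis
  have mid: "(norm (x - y))\<^sup>2 \<le> 2 * (J x - m) + 2 * (J y - m)" for x y
  proof -
    have "(norm (x - y))\<^sup>2 = 2 * J x + 2 * J y - 4 * J ((1/2) *\<^sub>R (x + y))"
      unfolding J_def scaleR add power2_norm_eq_inner
      by (simp add: inner_simps inner_commute[of y x] field_simps)
    then show ?thesis using mle[of "(1/2) *\<^sub>R (x + y)"] by simp
  qed
  have "Cauchy Z"
  proof (rule metric_CauchyI)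
    fix e :: real assume e: "e > 0"
    then have "e\<^sup>2 / 4 > 0" by simp
    then obtain N where N: "inverse (real (Suc N)) < e\<^sup>2 / 4"
      using reals_Archimedean by blast
    have "dist (Z i) (Z j) < e" if "N \<le> i" "N \<le> j" for i j
    proof -
      have "inverse (real (Suc i)) \<le> inverse (real (Suc N))" "inverse (real (Suc j)) \<le> inverse (real (Suc N))"
        using that by (auto intro!: le_imp_inverse_le)
      then have "(norm (Z i - Z j))\<^sup>2 < e\<^sup>2"
        using mid[of "Z i" "Z j"] Z[of i] Z[of j] N
        unfolding distrib_left by argo
      then show ?thesis using e by (simp add: dist_norm power_less_imp_less_base)
    qed
    then show "\<exists>N. \<forall>i\<ge>N. \<forall>j\<ge>N. dist (Z i) (Z j) < e" by blast
  qed
  then obtain z where z: "Z \<longlonglongrightarrow> z" using Cauchy_convergent convergent_def by blast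
  have "(\<lambda>n. J (Z n)) \<longlonglongrightarrow> J z" unfolding J_def by (intro tendsto_intros tendsto z)
  moreover have "(\<lambda>n. m + inverse (real (Suc n))) \<longlonglongrightarrow> m + 0"
    by (intro tendsto_intros LIMSEQ_inverse_real_of_nat)
  ultimately have "J z \<le> m"
    using LIMSEQ_le[of "\<lambda>n. J (Z n)" "J z" "\<lambda>n. m + inverse (real (Suc n))" "m+0"] Z
    by (auto intro: less_imp_le)
  have "\<phi> x = inner x z" for x
  proof -
    have "0 \<le> (norm x)\<^sup>2 * t\<^sup>2 + (2 * (inner x z - \<phi> x)) * t" for t
    proof -
      have "J z \<le> J (z + t *\<^sub>R x)" using mle \<open>J z \<le> m\<close> order_trans by blast
      then show ?thesis unfolding J_def scaleR add power2_norm_eq_inner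
        by (simp add: inner_simps inner_commute[of z x] algebra_simps power2_eq_square)
    qed
    from quadratic_nonneg_imp_linear_zero[OF this] show ?thesis by simp
  qed
  then show ?thesis by blast
qed

lemma inner_right_eqI:
  fixes u v :: "'a::real_inner"
  assumes "\<And>x. inner x u = inner x v"
  shows "u = v"
proof -
  have "inner (u - v) (u - v) = 0" using assms[of "u - v"] by (simp add: inner_diff_right)
  then show ?thesis by simp
qed

lemma Im_cinner: "Im (cinner x y) = - inner (\<i> *\<^sub>C x) y" for x y :: "'a::chilbert_space"
  by (simp add: Re_cinner[symmetric] cinner_scaleC_left)

text \<open>For complex-linear operators, adjoints for the complex inner product are the same as adjoints for
  its real part. All later estimates therefore use the real inner product.\<close>

lemma cinner_eqI:
  fixes T S :: "'a::chilbert_space \<Rightarrow>\<^sub>L 'a"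
  assumes "clinear_op T" "\<And>x. inner (T x) y = inner x z"
  shows "cinner (T x) y = cinner x z"
proof (rule complex_eqI)
  show "Re (cinner (T x) y) = Re (cinner x z)" by (simp add: Re_cinner assms)
  show "Im (cinner (T x) y) = Im (cinner x z)"
    using assms(2)[of "\<i> *\<^sub>C x"] assms(1) by (simp add: Im_cinner clinear_op_def)
qed

lemma adj_exists:
  fixes T :: "'a::chilbert_space \<Rightarrow>\<^sub>L 'a"
  assumes "clinear_op T"
  shows "\<exists>S :: 'a \<Rightarrow>\<^sub>L 'a. \<forall>x y. inner (T x) y = inner x (S y)"
proof -
  have "\<exists>z. \<forall>x. inner (T x) y = inner x z" for y
    by (rule riesz_representation) (intro bounded_linear_intros)
  then obtain g where g: "\<And>x y. inner (T x) y = inner x (g y)" by metis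
  have "bounded_linear g"
  proof (rule bounded_linear_intro)
    show "g (x + y) = g x + g y" for x y by (rule inner_right_eqI) (simp add: inner_add_right g[symmetric])
    show "g (r *\<^sub>R x) = r *\<^sub>R g x" for r x by (rule inner_right_eqI) (simp add: g[symmetric])
    show "norm (g x) \<le> norm x * norm T" for x
    proof (cases "g x = 0")
      case False
      have "norm (g x) * norm (g x) = inner (T (g x)) x" unfolding g by (metis power2_norm_eq_inner power2_eq_square)
      also have "\<dots> \<le> norm (T (g x)) * norm x" by (rule norm_cauchy_schwarz)
      also have "\<dots> \<le> norm T * norm (g x) * norm x" by (intro mult_right_mono norm_blinfun) auto
      finally show ?thesis using False by (simp add: mult.commute mult.left_commute)
    qed simp
  qed
  then show ?thesis by (intro exI[of _ "Blinfun g"]) (simp add: g bounded_linear_Blinfun_apply)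
qed

lemma adj_eqI:
  fixes T S :: "'a::chilbert_space \<Rightarrow>\<^sub>L 'a"
  assumes "clinear_op T" "\<And>x y. inner (T x) y = inner x (S y)"
  shows "adj T = S"
  unfolding adj_def
proof (rule the_equality)
  show "\<forall>x y. cinner (T x) y = cinner x (S y)" using cinner_eqI assms by blast
  fix S' :: "'a \<Rightarrow>\<^sub>L 'a" assume *: "\<forall>x y. cinner (T x) y = cinner x (S' y)"
  show "S' = S"
  proof (rule blinfun_eqI)
    fix y
    have "inner x (S' y) = inner x (S y)" for x using * assms(2) by (metis Re_cinner)
    then show "S' y = S y" by (rule inner_right_eqI)
  qed
qed

lemma inner_adj:
  fixes T :: "'a::chilbert_space \<Rightarrow>\<^sub>L 'a"
  assumes "clinear_op T"
  shows "inner (T x) y = inner x (adj T y)"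
  using adj_exists[OF assms] adj_eqI[OF assms] by metis

lemma cinner_adj:
  fixes T :: "'a::chilbert_space \<Rightarrow>\<^sub>L 'a"
  assumes "clinear_op T"
  shows "cinner (T x) y = cinner x (adj T y)"
  using inner_adj[OF assms] cinner_eqI[OF assms] by blast

lemma inner_adj_left:
  fixes T :: "'a::chilbert_space \<Rightarrow>\<^sub>L 'a"
  assumes "clinear_op T"
  shows "inner (adj T x) y = inner x (T y)"
proof -
  have "inner (adj T x) y = inner y (adj T x)" by (rule inner_commute)
  also have "\<dots> = inner (T y) x" by (rule inner_adj[OF assms, symmetric])
  also have "\<dots> = inner x (T y)" by (rule inner_commute)
  finally show ?thesis .
qed

lemma clinear_adj:
  fixes T :: "'a::chilbert_space \<Rightarrow>\<^sub>L 'a"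
  assumes "clinear_op T"
  shows "clinear_op (adj T)"
  unfolding clinear_op_def
proof (intro allI)
  fix c x
  have "cinner y (adj T (c *\<^sub>C x)) = cinner y (c *\<^sub>C adj T x)" for y
    by (simp add: cinner_adj[OF assms, symmetric] cinner_scaleC_right)
  then have "inner y (adj T (c *\<^sub>C x)) = inner y (c *\<^sub>C adj T x)" for y by (metis Re_cinner)
  then show "adj T (c *\<^sub>C x) = c *\<^sub>C adj T x" by (rule inner_right_eqI)
qed

lemma clinear_id [simp]: "clinear_op id_blinfun" by (simp add: clinear_op_def)
lemma clinear_zero [simp]: "clinear_op 0"
  by (simp add: clinear_op_def) (metis norm_scaleC norm_zero mult_zero_right norm_eq_zero)
lemma clinear_add: "clinear_op S \<Longrightarrow> clinear_op T \<Longrightarrow> clinear_op (S + T)"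
  by (simp add: clinear_op_def blinfun.add_left scaleC_add_right)
lemma clinear_scaleR: "clinear_op T \<Longrightarrow> clinear_op (r *\<^sub>R T)"
  by (simp add: clinear_op_def blinfun.scaleR_left scaleC_scaleR)
lemma clinear_minus: "clinear_op T \<Longrightarrow> clinear_op (- T)"
  using clinear_scaleR[of T "-1"] by simp
lemma clinear_diff: "clinear_op S \<Longrightarrow> clinear_op T \<Longrightarrow> clinear_op (S - T)"
  using clinear_add[of S "- T"] clinear_minus[of T] by simp
lemma clinear_scaleC: "clinear_op T \<Longrightarrow> clinear_op (op_scaleC c T)"
  by (simp add: clinear_op_def op_scaleC.rep_eq scaleC_scaleC mult.commute)
lemma clinear_compose: "clinear_op S \<Longrightarrow> clinear_op T \<Longrightarrow> clinear_op (S o\<^sub>L T)"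
  by (simp add: clinear_op_def)
lemma clinear_sum: "(\<And>i. i \<in> I \<Longrightarrow> clinear_op (T i)) \<Longrightarrow> clinear_op (\<Sum>i\<in>I. T i)"
  by (induction I rule: infinite_finite_induct) (auto intro: clinear_add)

lemmas clinear_intros = clinear_add clinear_scaleR clinear_minus clinear_diff clinear_scaleC
  clinear_compose clinear_sum clinear_adj clinear_id clinear_zero

lemma adj_adj: "clinear_op T \<Longrightarrow> adj (adj T) = T"
  by (rule adj_eqI[OF clinear_adj inner_adj_left])
lemma adj_compose: "clinear_op S \<Longrightarrow> clinear_op T \<Longrightarrow> adj (S o\<^sub>L T) = adj T o\<^sub>L adj S"
  by (intro adj_eqI clinear_compose) (simp_all add: inner_adj)

lemma selfadjoint_iff:
  "selfadjoint T \<longleftrightarrow> clinear_op T \<and> (\<forall>x y. inner (T x) y = inner x (T y))"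
  unfolding selfadjoint_def using inner_adj adj_eqI by metis

lemma selfadjointD: "selfadjoint T \<Longrightarrow> inner (T x) y = inner x (T y)"
  by (simp add: selfadjoint_iff)
lemma selfadjoint_clinear: "selfadjoint T \<Longrightarrow> clinear_op T"
  by (simp add: selfadjoint_iff)
lemma selfadjoint_cinner: "selfadjoint T \<Longrightarrow> cinner (T x) y = cinner x (T y)"
  using cinner_adj[of T] by (simp add: selfadjoint_def)

lemma selfadjoint_id [simp]: "selfadjoint id_blinfun" by (simp add: selfadjoint_iff)
lemma selfadjoint_zero [simp]: "selfadjoint 0" by (simp add: selfadjoint_iff)
lemma selfadjoint_add: "selfadjoint S \<Longrightarrow> selfadjoint T \<Longrightarrow> selfadjoint (S + T)"
  by (simp add: selfadjoint_iff clinear_add blinfun.add_left inner_add_left inner_add_right)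
lemma selfadjoint_scaleR: "selfadjoint T \<Longrightarrow> selfadjoint (r *\<^sub>R T)"
  by (simp add: selfadjoint_iff clinear_scaleR blinfun.scaleR_left)
lemma selfadjoint_diff: "selfadjoint S \<Longrightarrow> selfadjoint T \<Longrightarrow> selfadjoint (S - T)"
  by (simp add: selfadjoint_iff clinear_diff blinfun.diff_left inner_diff_left inner_diff_right)
lemma selfadjoint_sum: "(\<And>i. i \<in> I \<Longrightarrow> selfadjoint (T i)) \<Longrightarrow> selfadjoint (\<Sum>i\<in>I. T i)"
  by (induction I rule: infinite_finite_induct) (auto intro: selfadjoint_add)
lemma selfadjoint_congruence:
  "selfadjoint T \<Longrightarrow> clinear_op C \<Longrightarrow> selfadjoint (adj C o\<^sub>L T o\<^sub>L C)"
  by (auto simp: selfadjoint_iff inner_adj_left inner_adj[symmetric] intro!: clinear_intros)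
lemma selfadjoint_compose_commute:
  "selfadjoint S \<Longrightarrow> selfadjoint T \<Longrightarrow> S o\<^sub>L T = T o\<^sub>L S \<Longrightarrow> selfadjoint (S o\<^sub>L T)"
  by (simp add: selfadjoint_iff clinear_compose) (metis blinfun_apply_blinfun_compose)

lemma selfadjoint_limit:
  fixes X :: "nat \<Rightarrow> 'a::chilbert_space \<Rightarrow>\<^sub>L 'a"
  assumes "\<And>n. selfadjoint (X n)" "X \<longlonglongrightarrow> T"
  shows "selfadjoint T"
proof -
  have lim: "(\<lambda>n. X n x) \<longlonglongrightarrow> T x" for x by (intro tendsto_intros assms)
  have scaleC_lim: "(\<lambda>n. c *\<^sub>C X n x) \<longlonglongrightarrow> c *\<^sub>C T x" for c x
  proof -
    have "(\<lambda>n. op_scaleC c id_blinfun (X n x)) \<longlonglongrightarrow> op_scaleC c id_blinfun (T x)"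
      by (intro tendsto_intros lim)
    then show ?thesis by (simp add: op_scaleC.rep_eq)
  qed
  have "T (c *\<^sub>C x) = c *\<^sub>C T x" for c x
    using LIMSEQ_unique[OF lim[of "c *\<^sub>C x"]] scaleC_lim[of c x] assms(1)
    by (simp add: selfadjoint_iff clinear_op_def)
  moreover have "inner (T x) y = inner x (T y)" for x y
  proof (rule LIMSEQ_unique)
    show "(\<lambda>n. inner (X n x) y) \<longlonglongrightarrow> inner (T x) y" by (intro tendsto_intros lim)
    show "(\<lambda>n. inner (X n x) y) \<longlonglongrightarrow> inner x (T y)"
      unfolding selfadjointD[OF assms(1)] by (intro tendsto_intros lim)
  qed
  ultimately show ?thesis by (simp add: selfadjoint_iff clinear_op_def)
qed

lemma positive_op_iff: "positive_op T \<longleftrightarrow> selfadjoint T \<and> (\<forall>x. 0 \<le> inner (T x) x)"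
  by (simp add: positive_op_def Re_cinner)

text \<open>By polarization, the quadratic form of a self-adjoint operator controls its norm.\<close>

lemma norm_le_of_form_le:
  fixes X :: "'a::chilbert_space \<Rightarrow>\<^sub>L 'a"
  assumes X: "selfadjoint X" and c: "0 \<le> c" "\<And>x. \<bar>inner (X x) x\<bar> \<le> c * (norm x)\<^sup>2"
  shows "norm X \<le> c"
proof (rule norm_blinfun_bound[OF c(1)])
  fix x
  have pol: "4 * inner (X x) y \<le> 2 * c * ((norm x)\<^sup>2 + (norm y)\<^sup>2)" for x y
  proof -
    have "4 * inner (X x) y = inner (X (x + y)) (x + y) - inner (X (x - y)) (x - y)"
      using selfadjointD[OF X, of y x]
      by (simp add: blinfun.bilinear_simps inner_simps inner_commute[of y])
    also have "\<dots> \<le> c * (norm (x + y))\<^sup>2 + c * (norm (x - y))\<^sup>2"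
      using c(2)[of "x + y"] c(2)[of "x - y"] by linarith
    also have "\<dots> = 2 * c * ((norm x)\<^sup>2 + (norm y)\<^sup>2)"
      unfolding power2_norm_eq_inner by (simp add: inner_simps inner_commute[of y x] algebra_simps)
    finally show ?thesis .
  qed
  show "norm (X x) \<le> c * norm x"
  proof (cases "x = 0 \<or> X x = 0")
    case True then show ?thesis using c(1) by auto
  next
    case False
    define r where "r = norm x / norm (X x)"
    have r: "r > 0" "r * norm (X x) = norm x" using False by (auto simp: r_def)
    have "4 * (r * (norm (X x))\<^sup>2) \<le> 2 * c * ((norm x)\<^sup>2 + (r * norm (X x))\<^sup>2)"
      using pol[of x "r *\<^sub>R X x"] r(1) by (simp add: power2_norm_eq_inner power_mult_distrib)
    also have "\<dots> = 4 * (c * (norm x)\<^sup>2)" using r(2) by simp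
    finally have "(r * norm (X x)) * norm (X x) \<le> c * norm x * norm x"
      by (simp add: power2_eq_square mult.assoc)
    then have "norm x * norm (X x) \<le> norm x * (c * norm x)" using r(2) by (simp add: mult_ac)
    then show ?thesis using False by simp
  qed
qed

lemma form_le_norm: "\<bar>inner (X x) x\<bar> \<le> norm X * (norm x)\<^sup>2" for X :: "'a::real_inner \<Rightarrow>\<^sub>L 'a"
proof -
  have "\<bar>inner (X x) x\<bar> \<le> norm (X x) * norm x" by (rule Cauchy_Schwarz_ineq2)
  also have "\<dots> \<le> norm X * norm x * norm x" by (intro mult_right_mono norm_blinfun) auto
  finally show ?thesis by (simp add: power2_eq_square mult.assoc)
qed


section \<open>Invertibility and spectrum\<close>

lemma op_scaleC_of_real: "op_scaleC (complex_of_real r) T = r *\<^sub>R T"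
  by (rule blinfun_eqI) (simp add: op_scaleC.rep_eq scaleC_of_real blinfun.scaleR_left)
lemma op_scaleC_add: "op_scaleC (c + d) T = op_scaleC c T + op_scaleC d T"
  by (rule blinfun_eqI) (simp add: op_scaleC.rep_eq scaleC_add_left blinfun.add_left)
lemma op_scaleC_add_right: "op_scaleC c (S + T) = op_scaleC c S + op_scaleC c T"
  by (rule blinfun_eqI) (simp add: op_scaleC.rep_eq scaleC_add_right blinfun.add_left)
lemma op_scaleC_op_scaleC: "op_scaleC c (op_scaleC d T) = op_scaleC (c * d) T"
  by (rule blinfun_eqI) (simp add: op_scaleC.rep_eq scaleC_scaleC)
lemma op_scaleC_zero [simp]: "op_scaleC c (0 :: 'a::chilbert_space \<Rightarrow>\<^sub>L 'a) = 0"
    "op_scaleC 0 (T :: 'a \<Rightarrow>\<^sub>L 'a) = 0"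
proof -
  have "c *\<^sub>C (0 :: 'a) = 0" by (metis norm_scaleC norm_zero mult_zero_right norm_eq_zero)
  then show "op_scaleC c (0 :: 'a \<Rightarrow>\<^sub>L 'a) = 0" by (intro blinfun_eqI) (simp add: op_scaleC.rep_eq)
  show "op_scaleC 0 T = 0" using op_scaleC_of_real[of 0 T] by simp
qed
lemma op_scaleC_one [simp]: "op_scaleC 1 T = T"
  using op_scaleC_of_real[of 1 T] by simp
lemma op_scaleC_compose_right: "clinear_op T \<Longrightarrow> T o\<^sub>L op_scaleC c S = op_scaleC c (T o\<^sub>L S)"
  by (rule blinfun_eqI) (simp add: op_scaleC.rep_eq clinear_op_def)
lemma op_scaleC_compose_left: "op_scaleC c T o\<^sub>L S = op_scaleC c (T o\<^sub>L S)"
  by (rule blinfun_eqI) (simp add: op_scaleC.rep_eq)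

lemma compose_id [simp]: "T o\<^sub>L id_blinfun = T" "id_blinfun o\<^sub>L T = T"
  by (auto intro: blinfun_eqI)

lemma compose_assoc: "(R o\<^sub>L S) o\<^sub>L T = R o\<^sub>L (S o\<^sub>L T)"
  by (rule blinfun_eqI) simp

lemmas compose_bilinear = bounded_bilinear.add_left[OF bounded_bilinear_blinfun_compose]
  bounded_bilinear.add_right[OF bounded_bilinear_blinfun_compose]
  bounded_bilinear.diff_left[OF bounded_bilinear_blinfun_compose]
  bounded_bilinear.diff_right[OF bounded_bilinear_blinfun_compose]
  bounded_bilinear.scaleR_left[OF bounded_bilinear_blinfun_compose]
  bounded_bilinear.scaleR_right[OF bounded_bilinear_blinfun_compose]
  bounded_bilinear.minus_left[OF bounded_bilinear_blinfun_compose]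
  bounded_bilinear.minus_right[OF bounded_bilinear_blinfun_compose]

lemma is_inverse_on_id:
  "is_inverse_on id_blinfun T S \<longleftrightarrow> clinear_op S \<and> S o\<^sub>L T = id_blinfun \<and> T o\<^sub>L S = id_blinfun"
  by (simp add: is_inverse_on_def ops_on_def)

lemma op_invertible_iff:
  "op_invertible T \<longleftrightarrow> (\<exists>S. clinear_op S \<and> S o\<^sub>L T = id_blinfun \<and> T o\<^sub>L S = id_blinfun)"
  by (simp add: op_invertible_def is_inverse_on_id)

lemma op_inv_eqI:
  assumes "clinear_op S" "S o\<^sub>L T = id_blinfun" "T o\<^sub>L S = id_blinfun"
  shows "op_inv T = S"
  unfolding op_inv_def
proof (rule the_equality)
  show "is_inverse_on id_blinfun T S" using assms by (simp add: is_inverse_on_id)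
  show "S' = S" if "is_inverse_on id_blinfun T S'" for S'
    using that assms(3) compose_assoc[of S' T S] by (simp add: is_inverse_on_id)
qed

lemma op_inv:
  assumes "op_invertible T"
  shows "clinear_op (op_inv T)" "op_inv T o\<^sub>L T = id_blinfun" "T o\<^sub>L op_inv T = id_blinfun"
  using assms op_inv_eqI unfolding op_invertible_iff by metis+

lemma op_invertible_compose:
  assumes "op_invertible S" "op_invertible T"
  shows "op_invertible (S o\<^sub>L T)"
  unfolding op_invertible_iff
proof (intro exI conjI)
  show "clinear_op (op_inv T o\<^sub>L op_inv S)" using assms by (intro clinear_compose op_inv)
  have "(op_inv T o\<^sub>L op_inv S) o\<^sub>L (S o\<^sub>L T) = op_inv T o\<^sub>L ((op_inv S o\<^sub>L S) o\<^sub>L T)"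
    by (simp add: compose_assoc)
  then show "(op_inv T o\<^sub>L op_inv S) o\<^sub>L (S o\<^sub>L T) = id_blinfun" using assms by (simp add: op_inv)
  have "(S o\<^sub>L T) o\<^sub>L (op_inv T o\<^sub>L op_inv S) = S o\<^sub>L ((T o\<^sub>L op_inv T) o\<^sub>L op_inv S)"
    by (simp add: compose_assoc)
  then show "(S o\<^sub>L T) o\<^sub>L (op_inv T o\<^sub>L op_inv S) = id_blinfun" using assms by (simp add: op_inv)
qed

lemma op_invertible_of_commuting_product:
  assumes "op_invertible (S o\<^sub>L T)" "S o\<^sub>L T = T o\<^sub>L S" "clinear_op T"
  shows "op_invertible S"
proof -
  define K where "K = op_inv (S o\<^sub>L T)"
  have K: "clinear_op K" "K o\<^sub>L (S o\<^sub>L T) = id_blinfun" "(S o\<^sub>L T) o\<^sub>L K = id_blinfun"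
    using op_inv[OF assms(1)] by (auto simp: K_def)
  have r: "S o\<^sub>L (T o\<^sub>L K) = id_blinfun" using K by (simp add: compose_assoc)
  have l: "(K o\<^sub>L T) o\<^sub>L S = id_blinfun" using K(2) assms(2) by (simp add: compose_assoc)
  have "K o\<^sub>L T = T o\<^sub>L K"
    using l r compose_assoc[of "K o\<^sub>L T" S "T o\<^sub>L K"] by simp
  then show ?thesis unfolding op_invertible_iff using l r K assms(3)
    by (intro exI[of _ "T o\<^sub>L K"]) (auto intro: clinear_intros)
qed

text \<open>An inverse is complex-linear by definition, and this forces the operator itself to be so.\<close>

lemma op_invertible_clinear:
  assumes "op_invertible T"
  shows "clinear_op T"
  unfolding clinear_op_def
proof (intro allI)
  fix c x
  obtain S where S: "clinear_op S" "S o\<^sub>L T = id_blinfun" "T o\<^sub>L S = id_blinfun"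
    using assms unfolding op_invertible_iff by blast
  have ST: "S (T y) = y" "T (S y) = y" for y
    using S(2,3) by (metis blinfun_apply_blinfun_compose blinfun_apply_id_blinfun id_apply)+
  have "c *\<^sub>C x = S (c *\<^sub>C T x)" using S(1) by (simp add: clinear_op_def ST)
  then show "T (c *\<^sub>C x) = c *\<^sub>C T x" by (simp add: ST)
qed

lemma op_invertible_scaleC_iff:
  fixes T :: "'a::chilbert_space \<Rightarrow>\<^sub>L 'a"
  assumes "c \<noteq> 0"
  shows "op_invertible (op_scaleC c T) \<longleftrightarrow> op_invertible T"
proof -
  have *: "op_invertible (op_scaleC c T)" if T: "op_invertible T" and c: "c \<noteq> 0"
    for c and T :: "'a \<Rightarrow>\<^sub>L 'a"
  proof -
    note inv = op_inv[OF T] and cl = op_invertible_clinear[OF T]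
    have "op_scaleC (inverse c) (op_inv T) o\<^sub>L op_scaleC c T = id_blinfun"
      using inv c by (simp add: op_scaleC_compose_left op_scaleC_compose_right op_scaleC_op_scaleC)
    moreover have "op_scaleC c T o\<^sub>L op_scaleC (inverse c) (op_inv T) = id_blinfun"
      using inv cl c by (simp add: op_scaleC_compose_left op_scaleC_compose_right op_scaleC_op_scaleC)
    ultimately show ?thesis unfolding op_invertible_iff using clinear_scaleC[OF inv(1)] by blast
  qed
  show ?thesis using *[of T c] *[of "op_scaleC c T" "inverse c"] assms
    by (auto simp: op_scaleC_op_scaleC)
qed

lemma spectrum_iff: "z \<in> spectrum T \<longleftrightarrow> \<not> op_invertible (op_scaleC z id_blinfun - T)"
  by (simp add: spectrum_on_def op_invertible_def)

lemma spectrum_of_real_iff: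
  "complex_of_real r \<in> spectrum T \<longleftrightarrow> \<not> op_invertible (r *\<^sub>R id_blinfun - T)"
  by (simp add: spectrum_iff op_scaleC_of_real)

text \<open>A self-adjoint operator bounded below by a positive constant is invertible: after scaling it
  differs from the identity by a strict contraction, so Banach's fixed point theorem solves
  \<open>X x = y\<close>.\<close>

lemma op_invertible_of_bounded_below:
  fixes X :: "'a::chilbert_space \<Rightarrow>\<^sub>L 'a"
  assumes X: "selfadjoint X" and c: "0 < c" "\<And>x. c * (norm x)\<^sup>2 \<le> inner (X x) x"
  shows "op_invertible X"
proof -
  define M where "M = norm X + c"
  have M: "M > 0" "c \<le> M" "norm X \<le> M" using c(1) by (auto simp: M_def intro: add_nonneg_pos)
  define L where "L = id_blinfun - (1 / M) *\<^sub>R X"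
  have L: "selfadjoint L" unfolding L_def by (intro selfadjoint_diff selfadjoint_scaleR X selfadjoint_id)
  have "norm L \<le> 1 - c / M"
  proof (rule norm_le_of_form_le[OF L])
    show "0 \<le> 1 - c / M" using M by simp
    fix x
    have eq: "inner (L x) x = (norm x)\<^sup>2 - inner (X x) x / M"
      by (simp add: L_def blinfun.bilinear_simps inner_simps power2_norm_eq_inner)
    have "inner (X x) x \<le> M * (norm x)\<^sup>2"
      using form_le_norm[of X x] mult_right_mono[OF M(3), of "(norm x)\<^sup>2"] by simp
    then have "inner (X x) x / M \<le> (norm x)\<^sup>2" using M(1) by (simp add: divide_simps mult.commute)
    moreover have "c * (norm x)\<^sup>2 / M \<le> inner (X x) x / M"
      using c(2)[of x] M(1) by (simp add: divide_right_mono)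
    ultimately show "\<bar>inner (L x) x\<bar> \<le> (1 - c / M) * (norm x)\<^sup>2"
      unfolding eq by (simp add: left_diff_distrib)
  qed
  have ex: "\<exists>x. X x = y" for y
  proof -
    have "\<exists>!x. L x + (1 / M) *\<^sub>R y = x"
    proof (rule banach_fix_type[of "1 - c / M"])
      show "0 \<le> 1 - c / M" "1 - c / M < 1" using M c(1) by auto
      have "dist (L x + (1 / M) *\<^sub>R y) (L x' + (1 / M) *\<^sub>R y) \<le> (1 - c / M) * dist x x'" for x x'
      proof -
        have "norm (L (x - x')) \<le> norm L * norm (x - x')" by (rule norm_blinfun)
        also have "\<dots> \<le> (1 - c / M) * norm (x - x')"
          using \<open>norm L \<le> 1 - c / M\<close> by (intro mult_right_mono) auto
        finally show ?thesis by (simp add: dist_norm blinfun.diff_right)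
      qed
      then show "\<forall>x x'. dist (L x + (1 / M) *\<^sub>R y) (L x' + (1 / M) *\<^sub>R y) \<le> (1 - c / M) * dist x x'"
        by blast
    qed
    then obtain x where "L x + (1 / M) *\<^sub>R y = x" by blast
    then have "(1 / M) *\<^sub>R y = (1 / M) *\<^sub>R X x"
      by (simp add: L_def blinfun.bilinear_simps algebra_simps)
    then show ?thesis using M(1) by auto
  qed
  then obtain g where g: "\<And>y. X (g y) = y" by metis
  have below: "c * norm x \<le> norm (X x)" for x
  proof (cases "x = 0")
    case False
    have "c * norm x * norm x \<le> norm (X x) * norm x"
      using c(2)[of x] norm_cauchy_schwarz[of "X x" x] by (simp add: power2_eq_square mult.assoc)
    then show ?thesis using False by simp
  qed simp
  have inj: "x = x'" if "X x = X x'" for x x'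
    using below[of "x - x'"] that c(1) by (simp add: blinfun.diff_right mult_le_0_iff)
  have "bounded_linear g"
  proof (rule bounded_linear_intro)
    show "g (x + y) = g x + g y" for x y by (rule inj) (simp add: g blinfun.bilinear_simps)
    show "g (r *\<^sub>R x) = r *\<^sub>R g x" for r x by (rule inj) (simp add: g blinfun.bilinear_simps)
    show "norm (g x) \<le> norm x * (1 / c)" for x
      using below[of "g x"] c(1) by (simp add: g divide_simps mult.commute)
  qed
  then have G: "blinfun_apply (Blinfun g) = g" by (rule bounded_linear_Blinfun_apply)
  show ?thesis unfolding op_invertible_iff
  proof (intro exI conjI)
    have "X (c *\<^sub>C x) = c *\<^sub>C X x" for c x
      using selfadjoint_clinear[OF X] by (simp add: clinear_op_def)
    then show "clinear_op (Blinfun g)" unfolding clinear_op_def G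
      by (intro allI) (rule inj, simp add: g)
    show "Blinfun g o\<^sub>L X = id_blinfun" by (rule blinfun_eqI, rule inj) (simp add: G g)
    show "X o\<^sub>L Blinfun g = id_blinfun" by (rule blinfun_eqI) (simp add: G g)
  qed
qed

lemma spectrum_subset_of_form_bounds:
  fixes X :: "'a::chilbert_space \<Rightarrow>\<^sub>L 'a"
  assumes X: "selfadjoint X"
    and lo: "\<And>x. a * (norm x)\<^sup>2 \<le> inner (X x) x"
    and hi: "\<And>x. inner (X x) x \<le> b * (norm x)\<^sup>2"
  shows "spectrum X \<subseteq> complex_of_real ` {a..b}"
proof
  fix z assume z: "z \<in> spectrum X"
  have cl: "clinear_op X" using X by (rule selfadjoint_clinear)
  have "Im z = 0"
  proof (rule ccontr)
    assume im: "Im z \<noteq> 0"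
    \<comment> \<open>\<open>(z - X)(cnj z - X) = (Re z - X)\<^sup>2 + (Im z)\<^sup>2\<close> is bounded below.\<close>
    define R where "R = Re z *\<^sub>R id_blinfun - X"
    have R: "selfadjoint R" unfolding R_def by (intro selfadjoint_diff selfadjoint_scaleR X selfadjoint_id)
    have split: "op_scaleC w id_blinfun - X = R + op_scaleC (\<i> * complex_of_real (Im w)) id_blinfun"
      if "Re w = Re z" for w
    proof -
      have "op_scaleC w id_blinfun
          = op_scaleC (complex_of_real (Re w) + \<i> * complex_of_real (Im w)) (id_blinfun :: 'a \<Rightarrow>\<^sub>L 'a)"
        by (simp add: complex_eq[symmetric])
      then show ?thesis unfolding op_scaleC_add op_scaleC_of_real R_def that by simp
    qed
    define I where "I = op_scaleC (\<i> * complex_of_real (Im z)) (id_blinfun :: 'a \<Rightarrow>\<^sub>L 'a)"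
    have I2: "I o\<^sub>L I = - ((Im z)\<^sup>2 *\<^sub>R id_blinfun)"
    proof -
      have "I o\<^sub>L I = op_scaleC (complex_of_real (- ((Im z)\<^sup>2))) id_blinfun"
        unfolding I_def op_scaleC_compose_left
        by (simp add: op_scaleC_op_scaleC power2_eq_square mult.commute mult.left_commute)
      then show ?thesis unfolding op_scaleC_of_real by simp
    qed
    have comm: "I o\<^sub>L R = R o\<^sub>L I"
      unfolding I_def using selfadjoint_clinear[OF R]
      by (simp add: op_scaleC_compose_left op_scaleC_compose_right)
    have zI: "op_scaleC z id_blinfun - X = R + I" using split[of z] by (simp add: I_def)
    have "(R + I) o\<^sub>L (R - I) = (R o\<^sub>L R) + (Im z)\<^sup>2 *\<^sub>R id_blinfun"
      by (simp add: compose_bilinear comm I2)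
    moreover have "(R - I) o\<^sub>L (R + I) = (R o\<^sub>L R) + (Im z)\<^sup>2 *\<^sub>R id_blinfun"
      by (simp add: compose_bilinear comm I2)
    moreover have "op_invertible ((R o\<^sub>L R) + (Im z)\<^sup>2 *\<^sub>R id_blinfun)"
    proof (rule op_invertible_of_bounded_below)
      show "selfadjoint ((R o\<^sub>L R) + (Im z)\<^sup>2 *\<^sub>R id_blinfun)"
        by (intro selfadjoint_add selfadjoint_scaleR selfadjoint_id selfadjoint_compose_commute R refl)
      show "0 < (Im z)\<^sup>2" using im by simp
      show "(Im z)\<^sup>2 * (norm x)\<^sup>2 \<le> inner (((R o\<^sub>L R) + (Im z)\<^sup>2 *\<^sub>R id_blinfun) x) x" for x
        using selfadjointD[OF R, of "R x" x]
        by (simp add: blinfun.bilinear_simps inner_simps power2_norm_eq_inner)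
    qed
    moreover have "clinear_op (R - I)"
      unfolding I_def by (intro clinear_intros selfadjoint_clinear R)
    ultimately have "op_invertible (R + I)"
      using op_invertible_of_commuting_product[of "R + I" "R - I"] by simp
    then show False using z zI by (simp add: spectrum_iff)
  qed
  then have zr: "z = complex_of_real (Re z)" by (simp add: complex_eq_iff)
  define r where "r = Re z"
  have nr: "\<not> op_invertible (r *\<^sub>R id_blinfun - X)"
    using z zr spectrum_of_real_iff[of r X] unfolding r_def by metis
  have sa: "selfadjoint (r *\<^sub>R id_blinfun - X)" "selfadjoint (X - r *\<^sub>R id_blinfun)"
    by (intro selfadjoint_diff selfadjoint_scaleR X selfadjoint_id)+
  have "a \<le> r"
  proof (rule ccontr)
    assume ar: "\<not> a \<le> r"
    have "op_invertible (X - r *\<^sub>R id_blinfun)"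
      using ar lo by (intro op_invertible_of_bounded_below[of _ "a - r"] sa)
        (auto simp: blinfun.bilinear_simps inner_simps power2_norm_eq_inner left_diff_distrib)
    moreover have "X - r *\<^sub>R id_blinfun = op_scaleC (-1) (r *\<^sub>R id_blinfun - X)"
      using op_scaleC_of_real[of "-1" "r *\<^sub>R id_blinfun - X"] by simp
    ultimately show False using nr op_invertible_scaleC_iff[of "-1" "r *\<^sub>R id_blinfun - X"] by simp
  qed
  moreover have "r \<le> b"
  proof (rule ccontr)
    assume br: "\<not> r \<le> b"
    have "op_invertible (r *\<^sub>R id_blinfun - X)"
      using br hi by (intro op_invertible_of_bounded_below[of _ "r - b"] sa)
        (auto simp: blinfun.bilinear_simps inner_simps power2_norm_eq_inner left_diff_distrib)
    then show False using nr by simp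
  qed
  ultimately show "z \<in> complex_of_real ` {a..b}" using zr r_def by (intro image_eqI[of _ _ r]) auto
qed

lemma spectrum_subset_norm:
  fixes X :: "'a::chilbert_space \<Rightarrow>\<^sub>L 'a"
  assumes "selfadjoint X"
  shows "spectrum X \<subseteq> complex_of_real ` {- norm X..norm X}"
  using form_le_norm[of X] by (intro spectrum_subset_of_form_bounds assms) (auto simp: abs_le_iff minus_le_iff)

text \<open>The norm \<open>\<lambda>\<close> of a self-adjoint operator is, up to sign, a point of its spectrum, because
  \<open>\<lambda>\<^sup>2 - S\<^sup>2\<close> is not bounded below: it is small on unit vectors on which \<open>S\<close> almost attains its
  norm.\<close>

lemma norm_in_spectrum:
  fixes S :: "'a::chilbert_space \<Rightarrow>\<^sub>L 'a"
  assumes S: "selfadjoint S" and nontriv: "\<exists>x::'a. x \<noteq> 0"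
  shows "complex_of_real (norm S) \<in> spectrum S \<or> complex_of_real (- norm S) \<in> spectrum S"
proof (rule ccontr)
  define l where "l = norm S"
  assume "\<not> ?thesis"
  then have i1: "op_invertible (l *\<^sub>R id_blinfun - S)" and i2: "op_invertible ((- l) *\<^sub>R id_blinfun - S)"
    unfolding spectrum_of_real_iff l_def by auto
  define T where "T = (l *\<^sub>R id_blinfun - S) o\<^sub>L ((- l) *\<^sub>R id_blinfun - S)"
  have "op_invertible T" unfolding T_def by (intro op_invertible_compose i1 i2)
  then obtain K where K: "K o\<^sub>L T = id_blinfun" unfolding op_invertible_iff by blast
  have T: "T x = S (S x) - (l * l) *\<^sub>R x" for x
    by (simp add: T_def blinfun.bilinear_simps algebra_simps)
  obtain x0 :: 'a where "x0 \<noteq> 0" using nontriv by blast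
  have l0: "l \<ge> 0" by (simp add: l_def)
  have Kx: "norm x \<le> norm K * norm (T x)" for x
    using norm_blinfun[of K "T x"] arg_cong[OF K, of "\<lambda>f. blinfun_apply f x"] by simp
  have K0: "norm K > 0" using Kx[of x0] \<open>x0 \<noteq> 0\<close> by (cases "norm K = 0") auto
  have Tx: "(norm (T x))\<^sup>2 \<le> 2 * l\<^sup>2 * (l\<^sup>2 * (norm x)\<^sup>2 - (norm (S x))\<^sup>2)" for x
  proof -
    have "(norm (T x))\<^sup>2 = (norm (S (S x)))\<^sup>2 - 2 * l\<^sup>2 * (norm (S x))\<^sup>2 + l^4 * (norm x)\<^sup>2"
      unfolding T power2_norm_eq_inner inner_diff_left inner_diff_right inner_scaleR_left
        inner_scaleR_right selfadjointD[OF S, of "S x" x] inner_commute[of x "S (S x)"]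
      by (simp add: power2_eq_square power4_eq_xxxx algebra_simps)
    moreover have "(norm (S (S x)))\<^sup>2 \<le> (l * (l * norm x))\<^sup>2"
    proof (rule power_mono)
      have "norm (S (S x)) \<le> l * norm (S x)" unfolding l_def by (rule norm_blinfun)
      also have "\<dots> \<le> l * (l * norm x)" using norm_blinfun[of S x] l0 by (intro mult_left_mono) (auto simp: l_def)
      finally show "norm (S (S x)) \<le> l * (l * norm x)" .
    qed simp
    ultimately show ?thesis by (simp add: power_mult_distrib algebra_simps power4_eq_xxxx power2_eq_square)
  qed
  have lpos: "l > 0"
  proof (rule ccontr)
    assume "\<not> l > 0"
    then have "l = 0" using l0 by simp
    then have "norm (T x0) = 0" using Tx[of x0] by simp
    then show False using Kx[of x0] \<open>x0 \<noteq> 0\<close> by simp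
  qed
  define d where "d = 1 / (2 * l\<^sup>2 * (norm K)\<^sup>2)"
  have d: "d > 0" using lpos K0 by (simp add: d_def)
  have Sx: "(norm (S x))\<^sup>2 \<le> (l\<^sup>2 - d) * (norm x)\<^sup>2" for x
  proof -
    have "(norm x)\<^sup>2 \<le> (norm K * norm (T x))\<^sup>2" by (intro power_mono Kx) simp
    also have "\<dots> \<le> (norm K)\<^sup>2 * (2 * l\<^sup>2 * (l\<^sup>2 * (norm x)\<^sup>2 - (norm (S x))\<^sup>2))"
      unfolding power_mult_distrib by (intro mult_left_mono Tx) simp
    finally have "d * (norm x)\<^sup>2 \<le> l\<^sup>2 * (norm x)\<^sup>2 - (norm (S x))\<^sup>2"
      using lpos K0 by (simp add: d_def divide_simps mult_ac)
    then show ?thesis by (simp add: left_diff_distrib)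
  qed
  have dl: "l\<^sup>2 - d \<ge> 0"
  proof -
    have "0 \<le> (l\<^sup>2 - d) * (norm x0)\<^sup>2" using Sx[of x0] order_trans zero_le_power2 by blast
    then show ?thesis using \<open>x0 \<noteq> 0\<close> by (simp add: zero_le_mult_iff)
  qed
  have "norm S \<le> sqrt (l\<^sup>2 - d)"
  proof (rule norm_blinfun_bound)
    fix x
    have "norm (S x) = sqrt ((norm (S x))\<^sup>2)" by simp
    also have "\<dots> \<le> sqrt ((l\<^sup>2 - d) * (norm x)\<^sup>2)" using Sx[of x] by (rule real_sqrt_le_mono)
    also have "\<dots> = sqrt (l\<^sup>2 - d) * norm x" by (simp add: real_sqrt_mult)
    finally show "norm (S x) \<le> sqrt (l\<^sup>2 - d) * norm x" .
  qed (use dl in simp)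
  then have "l\<^sup>2 \<le> (sqrt (l\<^sup>2 - d))\<^sup>2" unfolding l_def[symmetric] using l0 by (intro power_mono) auto
  then show False using dl d by simp
qed

section \<open>Polynomials of operators\<close>

abbreviation poly_op :: "real poly \<Rightarrow> ('a::chilbert_space \<Rightarrow>\<^sub>L 'a) \<Rightarrow> ('a \<Rightarrow>\<^sub>L 'a)" where
  "poly_op p T \<equiv> poly_on id_blinfun p T"

text \<open>Complex coefficients serve only to split a polynomial into linear factors.\<close>

definition cpoly_op :: "complex poly \<Rightarrow> ('a::chilbert_space \<Rightarrow>\<^sub>L 'a) \<Rightarrow> ('a \<Rightarrow>\<^sub>L 'a)" where
  "cpoly_op p T = (\<Sum>k\<le>degree p. op_scaleC (coeff p k) (((\<lambda>S. T o\<^sub>L S) ^^ k) id_blinfun))"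

lemma poly_op_0 [simp]: "poly_op 0 T = 0" by (simp add: poly_on_def)
lemma cpoly_op_0 [simp]: "cpoly_op 0 T = 0" by (simp add: cpoly_op_def)

lemma compose_sum_right: "T o\<^sub>L (\<Sum>i\<in>I. S i) = (\<Sum>i\<in>I. T o\<^sub>L S i)"
  by (rule bounded_bilinear.sum_right[OF bounded_bilinear_blinfun_compose])
lemma compose_sum_left: "(\<Sum>i\<in>I. S i) o\<^sub>L T = (\<Sum>i\<in>I. S i o\<^sub>L T)"
  by (rule bounded_bilinear.sum_left[OF bounded_bilinear_blinfun_compose])

lemma poly_op_pCons: "poly_op (pCons a p) T = a *\<^sub>R id_blinfun + (T o\<^sub>L poly_op p T)"
proof (cases "p = 0")
  case False
  then show ?thesis unfolding poly_on_def degree_pCons_eq[OF False] sum.atMost_Suc_shift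
    by (simp add: compose_sum_right compose_bilinear)
qed (simp add: poly_on_def)

lemma cpoly_op_pCons:
  assumes "clinear_op T"
  shows "cpoly_op (pCons a p) T = op_scaleC a id_blinfun + (T o\<^sub>L cpoly_op p T)"
proof (cases "p = 0")
  case False
  then show ?thesis unfolding cpoly_op_def degree_pCons_eq[OF False] sum.atMost_Suc_shift
    by (simp add: compose_sum_right op_scaleC_compose_right assms)
qed (simp add: cpoly_op_def)

lemma poly_op_add: "poly_op (p + q) T = poly_op p T + poly_op q T"
  by (induction p q rule: poly_induct2) (simp_all add: poly_op_pCons compose_bilinear scaleR_add_left)
lemma poly_op_smult: "poly_op (smult c p) T = c *\<^sub>R poly_op p T"
  by (induction p) (simp_all add: poly_op_pCons compose_bilinear scaleR_add_right)
lemma poly_op_diff: "poly_op (p - q) T = poly_op p T - poly_op q T"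
  using poly_op_add[of p "smult (-1) q" T] poly_op_smult[of "-1" q T] by simp
lemma poly_op_mult: "poly_op (p * q) T = poly_op p T o\<^sub>L poly_op q T"
  by (induction p) (simp_all add: poly_op_pCons compose_bilinear poly_op_add poly_op_smult compose_assoc)
lemma poly_op_const: "poly_op [:c:] T = c *\<^sub>R id_blinfun" by (simp add: poly_op_pCons)
lemma poly_op_X: "poly_op [:0, 1:] T = T" by (simp add: poly_op_pCons)

lemma cpoly_op_add:
  "clinear_op T \<Longrightarrow> cpoly_op (p + q) T = cpoly_op p T + cpoly_op q T"
  by (induction p q rule: poly_induct2) (simp_all add: cpoly_op_pCons compose_bilinear op_scaleC_add)
lemma cpoly_op_smult: "clinear_op T \<Longrightarrow> cpoly_op (smult c p) T = op_scaleC c (cpoly_op p T)"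
  by (induction p)
    (simp_all add: cpoly_op_pCons op_scaleC_compose_right op_scaleC_add_right op_scaleC_op_scaleC)
lemma cpoly_op_of_real:
  "clinear_op T \<Longrightarrow> cpoly_op (map_poly complex_of_real p) T = poly_op p T"
  by (induction p) (simp_all add: cpoly_op_pCons poly_op_pCons map_poly_pCons op_scaleC_of_real)

lemma selfadjoint_poly_op:
  assumes T: "selfadjoint T" shows "selfadjoint (poly_op p T)"
proof (induction p)
  case (pCons a p)
  have "T o\<^sub>L poly_op p T = poly_op p T o\<^sub>L T" using poly_op_mult[of p "[:0, 1:]" T]
      poly_op_mult[of "[:0, 1:]" p T] by (simp add: poly_op_X mult.commute)
  then show ?case unfolding poly_op_pCons
    by (intro selfadjoint_add selfadjoint_scaleR selfadjoint_id selfadjoint_compose_commute T pCons)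
qed simp

text \<open>Factoring off a root at a time, \<open>p(T)\<close> is invertible unless \<open>p\<close> has a root in the spectrum.\<close>

lemma root_in_spectrum:
  fixes T :: "'a::chilbert_space \<Rightarrow>\<^sub>L 'a"
  assumes T: "clinear_op T"
  shows "p \<noteq> 0 \<Longrightarrow> \<not> op_invertible (cpoly_op p T) \<Longrightarrow> \<exists>z\<in>spectrum T. poly p z = 0"
proof (induction "degree p" arbitrary: p)
  case 0
  then obtain a where a: "p = [:a:]" "a \<noteq> 0" by (metis degree_eq_zeroE pCons_0_0)
  have "op_invertible (id_blinfun :: 'a \<Rightarrow>\<^sub>L 'a)" unfolding op_invertible_iff
    by (intro exI[of _ id_blinfun]) simp
  then show ?case using 0 a T op_invertible_scaleC_iff[of a "id_blinfun :: 'a \<Rightarrow>\<^sub>L 'a"] by (simp add: cpoly_op_pCons)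
next
  case (Suc n)
  have "\<not> constant (poly p)" unfolding constant_degree using Suc(2) by simp
  then obtain z where z: "poly p z = 0" using fundamental_theorem_of_algebra by blast
  show ?case
  proof (cases "z \<in> spectrum T")
    case False
    obtain q where q: "p = [:-z, 1:] * q" using z poly_eq_0_iff_dvd by (metis dvdE)
    have q0: "q \<noteq> 0" using q Suc(3) by auto
    have deg: "degree p = Suc (degree q)"
      unfolding q by (subst degree_mult_eq) (use q0 in auto)
    have "cpoly_op p T = op_scaleC (-z) (cpoly_op q T) + (T o\<^sub>L cpoly_op q T)"
    proof -
      have "p = smult (- z) q + pCons 0 q" unfolding q by simp
      then show ?thesis
        by (simp only: cpoly_op_add[OF T] cpoly_op_smult[OF T] cpoly_op_pCons[OF T] op_scaleC_zero add_0)
    qed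
    also have "\<dots> = op_scaleC (-1) (op_scaleC z id_blinfun - T) o\<^sub>L cpoly_op q T"
      using op_scaleC_of_real[of "-1" "op_scaleC z id_blinfun - T"]
        op_scaleC_of_real[of "-1" "op_scaleC z (cpoly_op q T)"] op_scaleC_op_scaleC[of "-1" z "cpoly_op q T"]
      by (simp add: compose_bilinear op_scaleC_compose_left)
    finally have *: "cpoly_op p T = op_scaleC (-1) (op_scaleC z id_blinfun - T) o\<^sub>L cpoly_op q T" .
    have "op_invertible (op_scaleC (-1) (op_scaleC z id_blinfun - T))"
      using False by (simp add: op_invertible_scaleC_iff spectrum_iff)
    then have "\<not> op_invertible (cpoly_op q T)"
      using Suc(4) * op_invertible_compose by metis
    then show ?thesis using Suc(1)[of q] Suc(2) deg q0 q by auto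
  qed (use z in auto)
qed

text \<open>The spectral bound on which the functional calculus rests: up to sign, the norm of \<open>p(X)\<close> is a
  point \<open>m\<close> of the spectrum of \<open>p(X)\<close>, and then \<open>p - m\<close> must have a root in the spectrum of \<open>X\<close>.\<close>

lemma norm_poly_op_le:
  fixes X :: "'a::chilbert_space \<Rightarrow>\<^sub>L 'a"
  assumes X: "selfadjoint X" and e: "0 \<le> e"
    and p: "\<And>t. complex_of_real t \<in> spectrum X \<Longrightarrow> \<bar>poly p t\<bar> \<le> e"
  shows "norm (poly_op p X) \<le> e"
proof (cases "\<exists>x::'a. x \<noteq> 0")
  case False
  then have "poly_op p X = 0" by (intro blinfun_eqI) simp
  then show ?thesis using e by simp
next
  case True
  have cl: "clinear_op X" using X by (rule selfadjoint_clinear)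
  obtain m where m: "\<bar>m\<bar> = norm (poly_op p X)" "complex_of_real m \<in> spectrum (poly_op p X)"
    using norm_in_spectrum[OF selfadjoint_poly_op[OF X, of p] True] by (metis abs_minus_cancel abs_norm_cancel)
  have "\<exists>t. complex_of_real t \<in> spectrum X \<and> poly p t = m"
  proof (cases "p - [:m:] = 0")
    \<comment> \<open>A constant polynomial leaves nothing to factor; any point of the nonempty spectrum will do.\<close>
    case True
    then show ?thesis using norm_in_spectrum[OF X \<open>\<exists>x::'a. x \<noteq> 0\<close>] by (auto simp del: of_real_minus)
  next
    case False
    have "\<not> op_invertible (poly_op (p - [:m:]) X)"
    proof -
      have "poly_op (p - [:m:]) X = op_scaleC (-1) (m *\<^sub>R id_blinfun - poly_op p X)"
        using op_scaleC_of_real[of "-1" "m *\<^sub>R id_blinfun - poly_op p X"]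
        by (simp add: poly_op_diff poly_op_const)
      then show ?thesis using m(2) by (simp add: spectrum_of_real_iff op_invertible_scaleC_iff)
    qed
    then obtain z where z: "z \<in> spectrum X" "poly (map_poly complex_of_real (p - [:m:])) z = 0"
      using root_in_spectrum[OF cl, of "map_poly complex_of_real (p - [:m:])"] False
      by (auto simp: cpoly_op_of_real[OF cl] map_poly_eq_0_iff)
    obtain t where t: "z = complex_of_real t" using spectrum_subset_norm[OF X] z(1) by blast
    have "poly (map_poly complex_of_real q) (complex_of_real t) = complex_of_real (poly q t)" for q
      by (induction q) (simp_all add: map_poly_pCons)
    then have "poly (p - [:m:]) t = 0" using z(2) t by simp
    then show ?thesis using z(1) t by auto
  qed
  then show ?thesis using p m(1) by metis
qed


section \<open>The continuous functional calculus\<close>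

text \<open>The operator inequality \<open>a \<le> X \<le> b\<close>. Unlike an inclusion of spectra it passes at once to sums,
  compressions and unitary conjugates.\<close>

definition form_between :: "real \<Rightarrow> real \<Rightarrow> ('a::chilbert_space \<Rightarrow>\<^sub>L 'a) \<Rightarrow> bool" where
  "form_between a b X \<longleftrightarrow> selfadjoint X \<and>
     (\<forall>x. a * (norm x)\<^sup>2 \<le> inner (X x) x \<and> inner (X x) x \<le> b * (norm x)\<^sup>2)"

lemma form_between_selfadjoint: "form_between a b X \<Longrightarrow> selfadjoint X"
  by (simp add: form_between_def)

lemma form_between_spectrum: "form_between a b X \<Longrightarrow> spectrum X \<subseteq> complex_of_real ` {a..b}"
  by (intro spectrum_subset_of_form_bounds) (auto simp: form_between_def)

lemma form_between_mono: "form_between a b X \<Longrightarrow> a' \<le> a \<Longrightarrow> b \<le> b' \<Longrightarrow> form_between a' b' X"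
  unfolding form_between_def by (meson mult_right_mono order_trans zero_le_power2)

lemma form_between_norm: "selfadjoint X \<Longrightarrow> form_between (- norm X) (norm X) X"
  using form_le_norm[of X] by (auto simp: form_between_def abs_le_iff minus_le_iff)

text \<open>The optimal bounds of the quadratic form belong to the spectrum: apply \<open>norm_in_spectrum\<close>
  to the positive operators \<open>c - X\<close> and \<open>c + X\<close>, where \<open>c = \<parallel>X\<parallel>\<close>.\<close>

lemma form_bounds_in_spectrum:
  fixes X :: "'a::chilbert_space \<Rightarrow>\<^sub>L 'a"
  assumes X: "selfadjoint X" and nontriv: "\<exists>x::'a. x \<noteq> 0"
    and J: "spectrum X \<subseteq> complex_of_real ` J"
  shows "\<exists>a\<in>J. \<exists>b\<in>J. form_between a b X"
proof -
  define c where "c = norm X"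
  have inJ: "t \<in> J" "- c \<le> t" "t \<le> c" if "complex_of_real t \<in> spectrum X" for t
    using J spectrum_subset_norm[OF X] that by (auto simp: c_def)
  define A where "A = c *\<^sub>R id_blinfun - X"
  define B where "B = c *\<^sub>R id_blinfun + X"
  have A: "selfadjoint A" and B: "selfadjoint B"
    unfolding A_def B_def by (intro selfadjoint_diff selfadjoint_add selfadjoint_scaleR selfadjoint_id X)+
  have sA: "complex_of_real (c - t) \<in> spectrum X" if "complex_of_real t \<in> spectrum A" for t
  proof -
    have "(c - t) *\<^sub>R id_blinfun - X = op_scaleC (-1) (t *\<^sub>R id_blinfun - A)"
      using op_scaleC_of_real[of "-1" "t *\<^sub>R id_blinfun - A"] by (simp add: A_def algebra_simps)
    then show ?thesis using that unfolding spectrum_of_real_iff by (simp add: op_invertible_scaleC_iff)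
  qed
  have sB: "complex_of_real (t - c) \<in> spectrum X" if "complex_of_real t \<in> spectrum B" for t
    using that unfolding spectrum_of_real_iff by (simp add: B_def algebra_simps)
  have "complex_of_real (c - norm A) \<in> spectrum X"
    using norm_in_spectrum[OF A nontriv] sA[of "norm A"] sA[of "- norm A"] inJ(3)[of "c + norm A"]
    by (cases "norm A = 0") auto
  then have a: "c - norm A \<in> J" by (rule inJ)
  have "complex_of_real (norm B - c) \<in> spectrum X"
    using norm_in_spectrum[OF B nontriv] sB[of "norm B"] sB[of "- norm B"] inJ(2)[of "- norm B - c"]
    by (cases "norm B = 0") auto
  then have b: "norm B - c \<in> J" by (rule inJ)
  have "form_between (c - norm A) (norm B - c) X"
    unfolding form_between_def
  proof (intro conjI allI X)
    fix x
    show "(c - norm A) * (norm x)\<^sup>2 \<le> inner (X x) x"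
      using form_le_norm[of A x]
      by (simp add: A_def blinfun.bilinear_simps inner_simps power2_norm_eq_inner left_diff_distrib)
    show "inner (X x) x \<le> (norm B - c) * (norm x)\<^sup>2"
      using form_le_norm[of B x]
      by (simp add: B_def blinfun.bilinear_simps inner_simps power2_norm_eq_inner left_diff_distrib)
  qed
  then show ?thesis using a b by blast
qed

lemma polynomials_dense:
  fixes f :: "real \<Rightarrow> real"
  assumes "continuous_on {a..b} f" "0 < e"
  shows "\<exists>p. \<forall>t\<in>{a..b}. \<bar>f t - poly p t\<bar> < e"
proof -
  have "\<exists>g. (\<exists>p. g = poly p) \<and> (\<forall>t\<in>{a..b}. \<bar>f t - g t\<bar> < e)"
  proof (rule Stone_Weierstrass_HOL)
    show "\<exists>p. (\<lambda>x. c) = poly p" for c :: real by (rule exI[of _ "[:c:]"]) auto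
    show "continuous_on {a..b} g" if "\<exists>p. g = poly p" for g using that by (auto intro: continuous_intros)
    show "\<exists>p. (\<lambda>x. g x + h x) = poly p" if "(\<exists>p. g = poly p) \<and> (\<exists>p. h = poly p)" for g h :: "real \<Rightarrow> real"
    proof -
      obtain p q where "g = poly p" "h = poly q" using \<open>(\<exists>p. g = poly p) \<and> (\<exists>p. h = poly p)\<close> by blast
      then show ?thesis by (intro exI[of _ "p + q"]) auto
    qed
    show "\<exists>p. (\<lambda>x. g x * h x) = poly p" if "(\<exists>p. g = poly p) \<and> (\<exists>p. h = poly p)" for g h :: "real \<Rightarrow> real"
    proof -
      obtain p q where "g = poly p" "h = poly q" using \<open>(\<exists>p. g = poly p) \<and> (\<exists>p. h = poly p)\<close> by blast
      then show ?thesis by (intro exI[of _ "p * q"]) auto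
    qed
    show "\<exists>g. (\<exists>p. g = poly p) \<and> g x \<noteq> g y" if "x \<in> {a..b} \<and> y \<in> {a..b} \<and> x \<noteq> y" for x y :: real
      using that by (intro exI[of _ "poly [:0, 1:]"]) auto
  qed (use assms in auto)
  then show ?thesis by blast
qed

lemma polynomial_sequence:
  fixes f :: "real \<Rightarrow> real"
  assumes "continuous_on {a..b} f"
  shows "\<exists>p. uniform_limit {a..b} (\<lambda>n. poly (p n)) f sequentially"
proof -
  have "\<forall>n. \<exists>p. \<forall>t\<in>{a..b}. \<bar>f t - poly p t\<bar> < inverse (real (Suc n))"
    using polynomials_dense[OF assms] by simp
  then obtain p where p: "\<And>n t. t \<in> {a..b} \<Longrightarrow> \<bar>f t - poly (p n) t\<bar> < inverse (real (Suc n))" by metis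
  have "uniform_limit {a..b} (\<lambda>n. poly (p n)) f sequentially"
  proof (rule uniform_limitI)
    fix e :: real assume "0 < e"
    then obtain N where N: "inverse (real (Suc N)) < e" using reals_Archimedean by blast
    show "\<forall>\<^sub>F n in sequentially. \<forall>x\<in>{a..b}. dist (poly (p n) x) (f x) < e"
      using eventually_ge_at_top[of N]
    proof eventually_elim
      case (elim n)
      then have "inverse (real (Suc n)) \<le> inverse (real (Suc N))" by (intro le_imp_inverse_le) auto
      then have "inverse (real (Suc n)) < e" using N by (rule le_less_trans)
      then show ?case using p[of _ n] by (force simp: dist_real_def abs_minus_commute)
    qed
  qed
  then show ?thesis by blast
qed

text \<open>Uniform convergence on the spectrum determines the limit of \<open>p\<^sub>n(X)\<close>, by \<open>norm_poly_op_le\<close>, so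
  that the description in the definition of \<open>f(X)\<close> is definite.\<close>

lemma cfc_eqI:
  fixes X :: "'a::chilbert_space \<Rightarrow>\<^sub>L 'a"
  assumes X: "selfadjoint X"
    and lim: "uniform_limit {t. complex_of_real t \<in> spectrum X} (\<lambda>n. poly (p n)) f sequentially"
      "(\<lambda>n. poly_op (p n) X) \<longlonglongrightarrow> S"
  shows "cfc f X = S"
  unfolding cfc_on_def
proof (rule the_equality)
  fix S'
  assume "\<exists>q. uniform_limit {t. complex_of_real t \<in> spectrum X} (\<lambda>n. poly (q n)) f sequentially \<and>
    (\<lambda>n. poly_op (q n) X) \<longlonglongrightarrow> S'"
  then obtain q where q: "uniform_limit {t. complex_of_real t \<in> spectrum X} (\<lambda>n. poly (q n)) f sequentially"
    "(\<lambda>n. poly_op (q n) X) \<longlonglongrightarrow> S'" by blast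
  have "(\<lambda>n. poly_op (q n) X - poly_op (p n) X) \<longlonglongrightarrow> 0"
  proof (rule tendstoI)
    fix e :: real assume e: "0 < e"
    have "\<forall>\<^sub>F n in sequentially. \<forall>t\<in>{t. complex_of_real t \<in> spectrum X}. dist (poly (p n) t) (f t) < e / 4"
      "\<forall>\<^sub>F n in sequentially. \<forall>t\<in>{t. complex_of_real t \<in> spectrum X}. dist (poly (q n) t) (f t) < e / 4"
      using e uniform_limitD[OF lim(1), of "e / 4"] uniform_limitD[OF q(1), of "e / 4"] by auto
    then show "\<forall>\<^sub>F n in sequentially. dist (poly_op (q n) X - poly_op (p n) X) 0 < e"
    proof eventually_elim
      case (elim n)
      have "norm (poly_op (q n - p n) X) \<le> e / 2"
      proof (rule norm_poly_op_le[OF X])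
        fix t assume "complex_of_real t \<in> spectrum X"
        then have "dist (poly (p n) t) (f t) < e / 4" "dist (poly (q n) t) (f t) < e / 4"
          using elim by auto
        then show "\<bar>poly (q n - p n) t\<bar> \<le> e / 2" unfolding dist_real_def poly_diff by argo
      qed (use e in simp)
      then show ?case using e by (simp add: poly_op_diff)
    qed
  qed
  moreover have "(\<lambda>n. poly_op (q n) X - poly_op (p n) X) \<longlonglongrightarrow> S' - S"
    by (intro tendsto_diff q lim)
  ultimately show "S' = S" using LIMSEQ_unique by fastforce
qed (use lim in blast)

lemma cfc_eqI_interval:
  assumes X: "form_between a b X"
    and lim: "uniform_limit {a..b} (\<lambda>n. poly (p n)) f sequentially" "(\<lambda>n. poly_op (p n) X) \<longlonglongrightarrow> S"
  shows "cfc f X = S"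
proof (rule cfc_eqI[OF form_between_selfadjoint[OF X] _ lim(2)])
  have "{t. complex_of_real t \<in> spectrum X} \<subseteq> {a..b}" using form_between_spectrum[OF X] by auto
  then show "uniform_limit {t. complex_of_real t \<in> spectrum X} (\<lambda>n. poly (p n)) f sequentially"
    using lim(1) uniform_limit_on_subset by blast
qed

lemma norm_poly_op_interval_le:
  assumes "form_between a b X" "0 \<le> e" "\<And>t. t \<in> {a..b} \<Longrightarrow> \<bar>poly p t\<bar> \<le> e"
  shows "norm (poly_op p X) \<le> e"
  using form_between_spectrum[OF assms(1)] assms(2,3)
  by (intro norm_poly_op_le form_between_selfadjoint[OF assms(1)]) auto

lemma cfc_tendsto:
  assumes X: "form_between a b X" and lim: "uniform_limit {a..b} (\<lambda>n. poly (p n)) f sequentially"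
  shows "(\<lambda>n. poly_op (p n) X) \<longlonglongrightarrow> cfc f X"
proof -
  have "Cauchy (\<lambda>n. poly_op (p n) X)"
  proof (rule metric_CauchyI)
    fix e :: real assume e: "0 < e"
    then obtain N where N: "\<And>n t. n \<ge> N \<Longrightarrow> t \<in> {a..b} \<Longrightarrow> dist (poly (p n) t) (f t) < e / 4"
      using uniform_limitD[OF lim, of "e / 4"] unfolding eventually_sequentially by fastforce
    have "dist (poly_op (p i) X) (poly_op (p j) X) < e" if "i \<ge> N" "j \<ge> N" for i j
    proof -
      have "norm (poly_op (p i - p j) X) \<le> e / 2"
      proof (rule norm_poly_op_interval_le[OF X])
        fix t assume "t \<in> {a..b}"
        then show "\<bar>poly (p i - p j) t\<bar> \<le> e / 2"
          using N[OF that(1), of t] N[OF that(2), of t] unfolding dist_real_def poly_diff by argo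
      qed (use e in simp)
      then show ?thesis using e by (simp add: poly_op_diff dist_norm)
    qed
    then show "\<exists>N. \<forall>i\<ge>N. \<forall>j\<ge>N. dist (poly_op (p i) X) (poly_op (p j) X) < e" by blast
  qed
  then obtain S where S: "(\<lambda>n. poly_op (p n) X) \<longlonglongrightarrow> S" using Cauchy_convergent convergent_def by blast
  then show ?thesis using cfc_eqI_interval[OF X lim] by simp
qed

lemma cfc_sequence:
  assumes "form_between a b X" "continuous_on {a..b} f"
  obtains p where "uniform_limit {a..b} (\<lambda>n. poly (p n)) f sequentially" "(\<lambda>n. poly_op (p n) X) \<longlonglongrightarrow> cfc f X"
  using polynomial_sequence[OF assms(2)] cfc_tendsto[OF assms(1)] by blast

lemma cfc_poly:
  assumes "form_between a b X" "\<And>t. f t = poly p t"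
  shows "cfc f X = poly_op p X"
  using assms(2) by (intro cfc_eqI_interval[OF assms(1), of "\<lambda>_. p"]) (auto simp: uniform_limit_iff)

lemma cfc_const: "form_between a b X \<Longrightarrow> cfc (\<lambda>_. c) X = c *\<^sub>R id_blinfun"
  using cfc_poly[of a b X "\<lambda>_. c" "[:c:]"] by (simp add: poly_op_const)
lemma cfc_ident: "form_between a b X \<Longrightarrow> cfc (\<lambda>t. t) X = X"
  using cfc_poly[of a b X "\<lambda>t. t" "[:0, 1:]"] by (simp add: poly_op_X)

lemma cfc_cong:
  assumes X: "form_between a b X" and f: "continuous_on {a..b} f" and eq: "\<And>t. t \<in> {a..b} \<Longrightarrow> f t = g t"
  shows "cfc g X = cfc f X"
proof -
  obtain p where p: "uniform_limit {a..b} (\<lambda>n. poly (p n)) f sequentially" "(\<lambda>n. poly_op (p n) X) \<longlonglongrightarrow> cfc f X"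
    using cfc_sequence[OF X f] .
  have "uniform_limit {a..b} (\<lambda>n. poly (p n)) g sequentially"
    using p(1) eq uniform_limit_cong'[of "{a..b}" "\<lambda>n. poly (p n)" "\<lambda>n. poly (p n)" f g] by simp
  then show ?thesis using cfc_eqI_interval[OF X _ p(2)] by blast
qed

lemma cfc_add:
  assumes X: "form_between a b X" and f: "continuous_on {a..b} f" and g: "continuous_on {a..b} g"
  shows "cfc (\<lambda>t. f t + g t) X = cfc f X + cfc g X"
proof -
  obtain p where p: "uniform_limit {a..b} (\<lambda>n. poly (p n)) f sequentially" "(\<lambda>n. poly_op (p n) X) \<longlonglongrightarrow> cfc f X"
    using cfc_sequence[OF X f] .
  obtain q where q: "uniform_limit {a..b} (\<lambda>n. poly (q n)) g sequentially" "(\<lambda>n. poly_op (q n) X) \<longlonglongrightarrow> cfc g X"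
    using cfc_sequence[OF X g] .
  show ?thesis
  proof (rule cfc_eqI_interval[OF X, of "\<lambda>n. p n + q n"])
    show "uniform_limit {a..b} (\<lambda>n. poly (p n + q n)) (\<lambda>t. f t + g t) sequentially"
      using uniform_limit_add[OF p(1) q(1)] unfolding poly_add by simp
    show "(\<lambda>n. poly_op (p n + q n) X) \<longlonglongrightarrow> cfc f X + cfc g X"
      unfolding poly_op_add by (intro tendsto_add p q)
  qed
qed

lemma cfc_mult:
  assumes X: "form_between a b X" and f: "continuous_on {a..b} f" and g: "continuous_on {a..b} g"
  shows "cfc (\<lambda>t. f t * g t) X = cfc f X o\<^sub>L cfc g X"
proof -
  obtain p where p: "uniform_limit {a..b} (\<lambda>n. poly (p n)) f sequentially" "(\<lambda>n. poly_op (p n) X) \<longlonglongrightarrow> cfc f X"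
    using cfc_sequence[OF X f] .
  obtain q where q: "uniform_limit {a..b} (\<lambda>n. poly (q n)) g sequentially" "(\<lambda>n. poly_op (q n) X) \<longlonglongrightarrow> cfc g X"
    using cfc_sequence[OF X g] .
  have bd: "bounded (h ` {a..b})" if "continuous_on {a..b} h" for h :: "real \<Rightarrow> real"
    using compact_continuous_image[OF that] compact_imp_bounded by blast
  show ?thesis
  proof (rule cfc_eqI_interval[OF X, of "\<lambda>n. p n * q n"])
    show "uniform_limit {a..b} (\<lambda>n. poly (p n * q n)) (\<lambda>t. f t * g t) sequentially"
      using uniform_lim_mult[OF p(1) q(1) bd[OF f] bd[OF g]] by (simp flip: poly_mult)
    show "(\<lambda>n. poly_op (p n * q n) X) \<longlonglongrightarrow> (cfc f X o\<^sub>L cfc g X)"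
      unfolding poly_op_mult by (intro bounded_bilinear.tendsto[OF bounded_bilinear_blinfun_compose] p q)
  qed
qed

lemma cfc_scale:
  assumes X: "form_between a b X" and f: "continuous_on {a..b} f"
  shows "cfc (\<lambda>t. c * f t) X = c *\<^sub>R cfc f X"
  using cfc_mult[OF X continuous_on_const[of _ c] f] cfc_const[OF X, of c] by (simp add: compose_bilinear)

lemma cfc_sum:
  assumes X: "form_between a b X"
  shows "(\<And>i. i \<in> I \<Longrightarrow> continuous_on {a..b} (f i)) \<Longrightarrow> cfc (\<lambda>t. \<Sum>i\<in>I. f i t) X = (\<Sum>i\<in>I. cfc (f i) X)"
proof (induction I rule: infinite_finite_induct)
  case (insert i I)
  then show ?case
    using cfc_add[OF X, of "f i" "\<lambda>t. \<Sum>i\<in>I. f i t"] by (auto intro: continuous_intros)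
qed (use cfc_const[OF X, of 0] in auto)

lemma selfadjoint_cfc:
  assumes X: "form_between a b X" and f: "continuous_on {a..b} f"
  shows "selfadjoint (cfc f X)"
proof -
  obtain p where "(\<lambda>n. poly_op (p n) X) \<longlonglongrightarrow> cfc f X"
    using cfc_sequence[OF X f] by metis
  then show ?thesis by (rule selfadjoint_limit[OF selfadjoint_poly_op[OF form_between_selfadjoint[OF X]]])
qed

lemma cfc_nonneg:
  assumes X: "form_between a b X" and f: "continuous_on {a..b} f" "\<And>t. t \<in> {a..b} \<Longrightarrow> 0 \<le> f t"
  shows "0 \<le> inner (cfc f X x) x"
proof -
  have c: "continuous_on {a..b} (\<lambda>t. sqrt (f t))" by (intro continuous_intros f)
  have "cfc f X = cfc (\<lambda>t. sqrt (f t) * sqrt (f t)) X"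
    using f by (intro cfc_cong[OF X] continuous_intros) auto
  then have "inner (cfc f X x) x = inner (cfc (\<lambda>t. sqrt (f t)) X x) (cfc (\<lambda>t. sqrt (f t)) X x)"
    using cfc_mult[OF X c c] selfadjointD[OF selfadjoint_cfc[OF X c], of "cfc (\<lambda>t. sqrt (f t)) X x" x]
    by simp
  then show ?thesis by simp
qed

lemma norm_cfc_diff_poly_le:
  assumes X: "form_between a b X" and f: "continuous_on {a..b} f"
    and e: "0 \<le> e" "\<And>t. t \<in> {a..b} \<Longrightarrow> \<bar>f t - poly q t\<bar> \<le> e"
  shows "norm (cfc f X - poly_op q X) \<le> e"
proof -
  obtain p where p: "uniform_limit {a..b} (\<lambda>n. poly (p n)) f sequentially" "(\<lambda>n. poly_op (p n) X) \<longlonglongrightarrow> cfc f X"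
    using cfc_sequence[OF X f] .
  show ?thesis
  proof (rule field_le_epsilon)
    fix d :: real assume d: "0 < d"
    have "(\<lambda>n. norm (poly_op (p n) X - poly_op q X)) \<longlonglongrightarrow> norm (cfc f X - poly_op q X)"
      by (intro tendsto_intros p)
    moreover have "\<forall>\<^sub>F n in sequentially. norm (poly_op (p n) X - poly_op q X) \<le> e + d"
      using uniform_limitD[OF p(1) d]
    proof eventually_elim
      case (elim n)
      have "norm (poly_op (p n - q) X) \<le> e + d"
      proof (rule norm_poly_op_interval_le[OF X])
        fix t assume t: "t \<in> {a..b}"
        then have "dist (poly (p n) t) (f t) < d" using elim by blast
        then show "\<bar>poly (p n - q) t\<bar> \<le> e + d"
          using e(2)[OF t] unfolding dist_real_def poly_diff by argo
      qed (use e d in simp)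
      then show ?case by (simp add: poly_op_diff)
    qed
    ultimately show "norm (cfc f X - poly_op q X) \<le> e + d"
      by (rule tendsto_upperbound) simp
  qed
qed

lemma norm_cfc_le:
  assumes X: "form_between a b X" and f: "continuous_on {a..b} f"
    and e: "0 \<le> e" "\<And>t. t \<in> {a..b} \<Longrightarrow> \<bar>f t\<bar> \<le> e"
  shows "norm (cfc f X) \<le> e"
  using norm_cfc_diff_poly_le[OF X f e(1), of 0] e(2) by simp

lemma cfc_commute:
  assumes X: "form_between a b X" and f: "continuous_on {a..b} f" and Z: "Z o\<^sub>L X = X o\<^sub>L Z"
  shows "Z o\<^sub>L cfc f X = cfc f X o\<^sub>L Z"
proof -
  have comm: "Z o\<^sub>L poly_op p X = poly_op p X o\<^sub>L Z" for p
    by (induction p) (simp_all add: poly_op_pCons compose_bilinear, metis Z compose_assoc)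
  obtain p where p: "(\<lambda>n. poly_op (p n) X) \<longlonglongrightarrow> cfc f X"
    using cfc_sequence[OF X f] by metis
  have "(\<lambda>n. Z o\<^sub>L poly_op (p n) X) \<longlonglongrightarrow> (Z o\<^sub>L cfc f X)"
    "(\<lambda>n. poly_op (p n) X o\<^sub>L Z) \<longlonglongrightarrow> (cfc f X o\<^sub>L Z)"
    by (intro bounded_bilinear.tendsto[OF bounded_bilinear_blinfun_compose] p tendsto_const)+
  then show ?thesis unfolding comm using LIMSEQ_unique by blast
qed

lemma positive_factorization:
  fixes M :: "'a::chilbert_space \<Rightarrow>\<^sub>L 'a"
  assumes M: "selfadjoint M" "\<And>x. 0 \<le> inner (M x) x"
  shows "\<exists>R. selfadjoint R \<and> R o\<^sub>L R = M"
proof -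
  have X: "form_between 0 (norm M) M"
    using form_between_norm[OF M(1)] M by (auto simp: form_between_def)
  have c: "continuous_on {0..norm M} sqrt" by (intro continuous_intros)
  have "cfc (\<lambda>t. sqrt t * sqrt t) M = cfc (\<lambda>t. t) M"
    by (rule cfc_cong[OF X]) (auto intro: continuous_intros)
  then have "cfc sqrt M o\<^sub>L cfc sqrt M = M" using cfc_mult[OF X c c] cfc_ident[OF X] by simp
  then show ?thesis using selfadjoint_cfc[OF X c] by blast
qed


section \<open>Hat functions\<close>

text \<open>At most two consecutive hats are nonzero at a point, and there they interpolate linearly. The
  induction adds one grid point on the right.\<close>

lemma unit_hats_sum:
  fixes s :: real
  shows "0 \<le> s \<Longrightarrow> s \<le> real n \<Longrightarrow>
    (\<Sum>i\<le>n. max 0 (1 - \<bar>s - real i\<bar>)) = 1 \<and> (\<Sum>i\<le>n. real i * max 0 (1 - \<bar>s - real i\<bar>)) = s"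
proof (induction n)
  case (Suc n)
  show ?case
  proof (cases "s \<le> real n")
    case True
    then show ?thesis using Suc by simp
  next
    case False
    have z: "(\<Sum>i<n. c i * max 0 (1 - \<bar>s - real i\<bar>)) = 0" for c
    proof (rule sum.neutral, safe)
      fix i assume "i < n"
      then have "real i + 1 \<le> real n" by simp
      then show "c i * max 0 (1 - \<bar>s - real i\<bar>) = 0" using False by simp
    qed
    have *: "sum F {..Suc n} = sum F {..<n} + F n + F (Suc n)" for F :: "nat \<Rightarrow> real"
      by (simp add: lessThan_Suc_atMost[symmetric])
    show ?thesis unfolding * using z[of "\<lambda>_. 1"] z[of real] False Suc(3)
      by (simp add: algebra_simps)
  qed
qed simp

definition grid :: "real \<Rightarrow> real \<Rightarrow> nat \<Rightarrow> nat \<Rightarrow> real" where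
  "grid a b n i = a + real i * ((b - a) / real n)"

text \<open>The piecewise linear function that is 1 at the \<open>i\<close>-th grid point and 0 at all others.\<close>

definition hat :: "real \<Rightarrow> real \<Rightarrow> nat \<Rightarrow> nat \<Rightarrow> real \<Rightarrow> real" where
  "hat a b n i t = max 0 (1 - \<bar>(t - a) * (real n / (b - a)) - real i\<bar>)"

lemma hat_bounds: "0 \<le> hat a b n i t" "hat a b n i t \<le> 1"
  by (auto simp: hat_def)

lemma continuous_on_hat: "continuous_on S (hat a b n i)"
  unfolding hat_def by (intro continuous_intros)

lemma grid_in_interval: "a \<le> b \<Longrightarrow> 0 < n \<Longrightarrow> i \<le> n \<Longrightarrow> grid a b n i \<in> {a..b}"
  using mult_right_mono[of "real i" "real n" "(b - a) / real n"] by (auto simp: grid_def)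

lemma hat_sums:
  assumes "a < b" "0 < n" "t \<in> {a..b}"
  shows "(\<Sum>i\<le>n. hat a b n i t) = 1" "(\<Sum>i\<le>n. grid a b n i * hat a b n i t) = t"
proof -
  define s where "s = (t - a) * (real n / (b - a))"
  have "(t - a) * real n \<le> (b - a) * real n" using assms by (intro mult_right_mono) auto
  then have s: "0 \<le> s" "s \<le> real n" using assms by (auto simp: s_def divide_simps mult.commute)
  show 1: "(\<Sum>i\<le>n. hat a b n i t) = 1" unfolding hat_def s_def[symmetric] using unit_hats_sum[OF s] by simp
  have "(\<Sum>i\<le>n. grid a b n i * hat a b n i t)
      = a * (\<Sum>i\<le>n. hat a b n i t) + (b - a) / real n * (\<Sum>i\<le>n. real i * hat a b n i t)"
    unfolding grid_def sum_distrib_left sum.distrib[symmetric]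
    by (intro sum.cong refl) (simp add: algebra_simps)
  also have "(\<Sum>i\<le>n. real i * hat a b n i t) = s"
    unfolding hat_def s_def[symmetric] using unit_hats_sum[OF s] by simp
  also have "(b - a) / real n * s = t - a" using assms by (simp add: s_def)
  finally show "(\<Sum>i\<le>n. grid a b n i * hat a b n i t) = t" using 1 by simp
qed

lemma hat_support:
  assumes "a < b" "0 < n" "hat a b n i t \<noteq> 0"
  shows "\<bar>t - grid a b n i\<bar> \<le> (b - a) / real n"
proof -
  have "\<bar>(t - a) * (real n / (b - a)) - real i\<bar> \<le> 1" using assms(3) by (auto simp: hat_def max_def split: if_splits)
  then have "\<bar>(t - a) * (real n / (b - a)) - real i\<bar> * ((b - a) / real n) \<le> (b - a) / real n"
    using assms mult_right_mono[of _ 1 "(b - a) / real n"] by fastforce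
  moreover have "\<bar>(t - a) * (real n / (b - a)) - real i\<bar> * ((b - a) / real n)
      = \<bar>((t - a) * (real n / (b - a)) - real i) * ((b - a) / real n)\<bar>"
    using assms by (simp add: abs_mult)
  moreover have "((t - a) * (real n / (b - a)) - real i) * ((b - a) / real n) = t - grid a b n i"
  proof -
    have "(t - a) * (real n / (b - a)) * ((b - a) / real n) = t - a" using assms by simp
    then show ?thesis unfolding grid_def left_diff_distrib[of "(t - a) * (real n / (b - a))"] by simp
  qed
  ultimately show ?thesis by metis
qed

lemma hat_mult_zero:
  assumes "2 \<le> \<bar>real i - real j\<bar>"
  shows "hat a b n i t * hat a b n j t = 0"
  using assms unfolding hat_def by (auto simp: max_def)

text \<open>Because hat functions reproduce affine functions exactly, the sum of the grid points weighted
  by the partition of unity is the identity, not just an approximation of it.\<close>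

lemma partition_of_unity:
  fixes f :: "real \<Rightarrow> real"
  assumes "a \<le> b" and f: "continuous_on {a..b} f" and e: "0 < e"
  obtains n :: nat and \<tau> :: "nat \<Rightarrow> real" and g :: "nat \<Rightarrow> real \<Rightarrow> real" where
    "\<forall>i\<le>n. \<tau> i \<in> {a..b}"
    "\<forall>i. continuous_on {a..b} (g i)" "\<forall>i t. 0 \<le> g i t"
    "\<forall>t\<in>{a..b}. (\<Sum>i\<le>n. g i t) = 1"
    "\<forall>t\<in>{a..b}. (\<Sum>i\<le>n. \<tau> i * g i t) = t"
    "\<forall>t\<in>{a..b}. \<bar>f t - (\<Sum>i\<le>n. f (\<tau> i) * g i t)\<bar> \<le> e"
proof (cases "a = b")
  \<comment> \<open>The grid degenerates: its mesh is 0 and the rescaling by \<open>n / (b - a)\<close> divides by zero.\<close>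
  case True
  then show ?thesis using e by (intro that[of 0 "\<lambda>_. a" "\<lambda>_ _. 1"]) auto
next
  case False
  then have ab: "a < b" using assms by simp
  have "uniformly_continuous_on {a..b} f" using f by (intro compact_uniformly_continuous) auto
  then obtain d where d: "d > 0" "\<And>s t. s \<in> {a..b} \<Longrightarrow> t \<in> {a..b} \<Longrightarrow> dist s t < d \<Longrightarrow> dist (f s) (f t) < e"
    using e unfolding uniformly_continuous_on_def by metis
  obtain n where n: "(b - a) / d < real n" using reals_Archimedean2 by blast
  have "0 < (b - a) / d" using ab d(1) by simp
  then have n0: "0 < n" using n by linarith
  have nd: "(b - a) / real n < d" using n n0 d(1) by (simp add: divide_simps mult.commute)
  show ?thesis
  proof (rule that[of n "grid a b n" "hat a b n"]; intro allI ballI impI)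
    fix t assume t: "t \<in> {a..b}"
    have "\<bar>f t - (\<Sum>i\<le>n. f (grid a b n i) * hat a b n i t)\<bar>
        = \<bar>\<Sum>i\<le>n. (f t - f (grid a b n i)) * hat a b n i t\<bar>"
      using hat_sums(1)[OF ab n0 t] by (simp add: left_diff_distrib sum_subtractf sum_distrib_left[symmetric])
    also have "\<dots> \<le> (\<Sum>i\<le>n. \<bar>(f t - f (grid a b n i)) * hat a b n i t\<bar>)" by (rule sum_abs)
    also have "\<dots> \<le> (\<Sum>i\<le>n. e * hat a b n i t)"
    proof (rule sum_mono)
      fix i assume i: "i \<in> {..n}"
      show "\<bar>(f t - f (grid a b n i)) * hat a b n i t\<bar> \<le> e * hat a b n i t"
      proof (cases "hat a b n i t = 0")
        case False
        then have "\<bar>t - grid a b n i\<bar> < d" using hat_support[OF ab n0] nd by fastforce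
        moreover have "grid a b n i \<in> {a..b}" using i by (intro grid_in_interval assms n0) simp
        ultimately have "\<bar>f t - f (grid a b n i)\<bar> \<le> e"
          using d(2)[OF t, of "grid a b n i"] by (simp add: dist_real_def)
        then show ?thesis using hat_bounds(1)[of a b n i t] by (simp add: abs_mult mult_right_mono)
      qed simp
    qed
    also have "\<dots> = e" using hat_sums(1)[OF ab n0 t] by (simp add: sum_distrib_left[symmetric])
    finally show "\<bar>f t - (\<Sum>i\<le>n. f (grid a b n i) * hat a b n i t)\<bar> \<le> e" .
  next
    show "grid a b n i \<in> {a..b}" if "i \<le> n" for i by (rule grid_in_interval[OF assms(1) n0 that])
    show "continuous_on {a..b} (hat a b n i)" for i by (rule continuous_on_hat)
    show "0 \<le> hat a b n i t" for i t by (rule hat_bounds)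
    show "(\<Sum>i\<le>n. hat a b n i t) = 1" "(\<Sum>i\<le>n. grid a b n i * hat a b n i t) = t"
      if "t \<in> {a..b}" for t by (rule hat_sums[OF ab n0 that])+
  qed
qed

section \<open>C*-algebras of operators\<close>

lemma cstar_algebraD:
  assumes "cstar_algebra \<A>"
  shows "T \<in> \<A> \<Longrightarrow> clinear_op T" "S \<in> \<A> \<Longrightarrow> T \<in> \<A> \<Longrightarrow> S + T \<in> \<A>" "T \<in> \<A> \<Longrightarrow> op_scaleC c T \<in> \<A>"
    "S \<in> \<A> \<Longrightarrow> T \<in> \<A> \<Longrightarrow> S o\<^sub>L T \<in> \<A>" "T \<in> \<A> \<Longrightarrow> adj T \<in> \<A>" "closed \<A>"
  using assms unfolding cstar_algebra_def by blast+

lemma cstar_scaleR: "cstar_algebra \<A> \<Longrightarrow> T \<in> \<A> \<Longrightarrow> r *\<^sub>R T \<in> \<A>"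
  using cstar_algebraD(3)[of \<A> T "complex_of_real r"] by (simp add: op_scaleC_of_real)
lemma cstar_diff: "cstar_algebra \<A> \<Longrightarrow> S \<in> \<A> \<Longrightarrow> T \<in> \<A> \<Longrightarrow> S - T \<in> \<A>"
  using cstar_algebraD(2)[of \<A> S "(-1) *\<^sub>R T"] cstar_scaleR[of \<A> T "-1"] by simp
lemma cstar_zero: "cstar_algebra \<A> \<Longrightarrow> 0 \<in> \<A>"
proof -
  assume A: "cstar_algebra \<A>"
  then obtain T where "T \<in> \<A>" unfolding cstar_algebra_def by blast
  then show ?thesis using cstar_scaleR[OF A, of T 0] by simp
qed
lemma cstar_sum: "cstar_algebra \<A> \<Longrightarrow> (\<And>i. i \<in> I \<Longrightarrow> T i \<in> \<A>) \<Longrightarrow> (\<Sum>i\<in>I. T i) \<in> \<A>"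
  by (induction I rule: infinite_finite_induct) (auto intro: cstar_zero cstar_algebraD(2))

lemma cstar_poly_op:
  assumes "cstar_algebra \<A>" "id_blinfun \<in> \<A>" "X \<in> \<A>"
  shows "poly_op p X \<in> \<A>"
  by (induction p) (auto simp: poly_op_pCons intro!: cstar_zero cstar_algebraD(2,4) cstar_scaleR assms)

lemma cstar_cfc:
  assumes A: "cstar_algebra \<A>" "id_blinfun \<in> \<A>" "X \<in> \<A>"
    and X: "form_between a b X" and f: "continuous_on {a..b} f"
  shows "cfc f X \<in> \<A>"
proof -
  obtain p where "(\<lambda>n. poly_op (p n) X) \<longlonglongrightarrow> cfc f X"
    using cfc_sequence[OF X f] by metis
  then show ?thesis
    by (rule closed_sequentially[OF cstar_algebraD(6)[OF A(1)] cstar_poly_op[OF A]])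
qed

lemma op_inv_adj:
  assumes "op_invertible C"
  shows "op_invertible (adj C)" "op_inv (adj C) = adj (op_inv C)"
proof -
  note C = op_inv[OF assms] op_invertible_clinear[OF assms]
  have id: "adj id_blinfun = (id_blinfun :: 'a \<Rightarrow>\<^sub>L 'a)" by (rule adj_eqI) auto
  have *: "clinear_op (adj (op_inv C))" "adj (op_inv C) o\<^sub>L adj C = id_blinfun"
    "adj C o\<^sub>L adj (op_inv C) = id_blinfun"
    using C by (auto simp: adj_compose[symmetric] id clinear_adj)
  then show "op_invertible (adj C)" "op_inv (adj C) = adj (op_inv C)"
    unfolding op_invertible_iff by (auto intro: op_inv_eqI)
qed

text \<open>A \<open>C\<^sup>*\<close>-algebra contains the inverses of its elements: the inverse of \<open>C\<^sup>* C\<close> is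
  a continuous function of \<open>C\<^sup>* C\<close>.\<close>

lemma cstar_op_inv_selfadjoint:
  assumes A: "cstar_algebra \<A>" "id_blinfun \<in> \<A>" "X \<in> \<A>"
    and X: "form_between c d X" "0 < c"
  shows "op_inv X \<in> \<A>" "op_inv X o\<^sub>L X = id_blinfun" "X o\<^sub>L op_inv X = id_blinfun" "selfadjoint (op_inv X)"
proof -
  have f: "continuous_on {c..d} inverse" using X(2) by (intro continuous_intros) auto
  have g: "continuous_on {c..d} (\<lambda>t. t :: real)" by (intro continuous_intros)
  have "cfc (\<lambda>t. t * inverse t) X = cfc (\<lambda>t. 1) X" "cfc (\<lambda>t. inverse t * t) X = cfc (\<lambda>t. 1) X"
    using X(2) by (auto intro!: cfc_cong[OF X(1)])
  then have *: "X o\<^sub>L cfc inverse X = id_blinfun" "cfc inverse X o\<^sub>L X = id_blinfun"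
    using cfc_mult[OF X(1) f g] cfc_mult[OF X(1) g f] cfc_ident[OF X(1)] cfc_const[OF X(1), of 1] by simp_all
  then have inv: "op_inv X = cfc inverse X"
    using selfadjoint_clinear[OF selfadjoint_cfc[OF X(1) f]] by (intro op_inv_eqI)
  show "op_inv X \<in> \<A>" unfolding inv by (rule cstar_cfc[OF A X(1) f])
  show "op_inv X o\<^sub>L X = id_blinfun" "X o\<^sub>L op_inv X = id_blinfun" unfolding inv by (fact *)+
  show "selfadjoint (op_inv X)" unfolding inv by (rule selfadjoint_cfc[OF X(1) f])
qed

lemma selfadjoint_adj_compose: "clinear_op C \<Longrightarrow> selfadjoint (adj C o\<^sub>L C)"
  using selfadjoint_congruence[of id_blinfun C] by simp

lemma cstar_op_inv:
  assumes A: "cstar_algebra \<A>" "id_blinfun \<in> \<A>" "C \<in> \<A>" and C: "op_invertible C"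
  shows "op_inv C \<in> \<A>"
proof -
  have cl: "clinear_op C" using C by (rule op_invertible_clinear)
  define K where "K = norm (op_inv C) + 1"
  have K: "K > 0" "norm (op_inv C) \<le> K" by (auto simp: K_def intro: add_nonneg_pos)
  have sa: "selfadjoint (adj C o\<^sub>L C)" by (rule selfadjoint_adj_compose[OF cl])
  have "form_between (1 / K\<^sup>2) (norm (adj C o\<^sub>L C)) (adj C o\<^sub>L C)"
    unfolding form_between_def
  proof (intro conjI allI sa)
    fix x
    show "inner ((adj C o\<^sub>L C) x) x \<le> norm (adj C o\<^sub>L C) * (norm x)\<^sup>2"
      using form_le_norm[of "adj C o\<^sub>L C" x] by simp
    have "norm x = norm ((op_inv C o\<^sub>L C) x)" using op_inv[OF C] by simp
    also have "\<dots> \<le> norm (op_inv C) * norm (C x)" using norm_blinfun by simp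
    also have "\<dots> \<le> K * norm (C x)" by (intro mult_right_mono K) simp
    finally have "(norm x)\<^sup>2 \<le> (K * norm (C x))\<^sup>2" by (intro power_mono) auto
    then show "1 / K\<^sup>2 * (norm x)\<^sup>2 \<le> inner ((adj C o\<^sub>L C) x) x"
      using K(1) by (simp add: inner_adj_left[OF cl] power_mult_distrib divide_simps power2_norm_eq_inner mult.commute)
  qed
  note inv = cstar_op_inv_selfadjoint[OF A(1,2) _ this]
  have mem: "adj C o\<^sub>L C \<in> \<A>" by (intro cstar_algebraD[OF A(1)] A)
  have pos: "0 < 1 / K\<^sup>2" using K by simp
  have "(op_inv (adj C o\<^sub>L C) o\<^sub>L adj C) o\<^sub>L C = id_blinfun"
    using inv(2)[OF mem pos] by (simp add: compose_assoc)
  then have "op_inv (adj C o\<^sub>L C) o\<^sub>L adj C = op_inv C"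
    using op_inv(3)[OF C] compose_assoc[of "op_inv (adj C o\<^sub>L C) o\<^sub>L adj C" C "op_inv C"] by simp
  then show ?thesis using cstar_algebraD(4)[OF A(1) inv(1)[OF mem pos] cstar_algebraD(5)[OF A(1,3)]] by simp
qed


section \<open>Conditional expectations\<close>

lemma inner_i_scale:
  fixes u v :: "'a::chilbert_space"
  shows "inner (\<i> *\<^sub>C u) (\<i> *\<^sub>C v) = inner u v"
  by (simp add: Re_cinner[symmetric] cinner_scaleC_left cinner_scaleC_right)

text \<open>Over the complex numbers, a real quadratic form already forces self-adjointness.\<close>

lemma selfadjointI_real_form:
  fixes T :: "'a::chilbert_space \<Rightarrow>\<^sub>L 'a"
  assumes T: "clinear_op T" and re: "\<And>x. Im (cinner (T x) x) = 0"
  shows "selfadjoint T"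
  unfolding selfadjoint_iff
proof (intro conjI T allI)
  fix x y :: 'a
  have iT: "\<i> *\<^sub>C T u = T (\<i> *\<^sub>C u)" for u :: 'a using T by (simp add: clinear_op_def)
  have form: "inner (T (\<i> *\<^sub>C u)) u = 0" for u :: 'a using re[of u] by (simp add: Im_cinner iT)
  define z where "z = - (\<i> *\<^sub>C x)"
  have iz: "\<i> *\<^sub>C z = x"
    using scaleC_scaleC[of \<i> \<i> x] scaleC_of_real[of "-1" x] scaleC_of_real[of "-1" "\<i> *\<^sub>C x"]
      scaleC_scaleC[of \<i> "-1" "\<i> *\<^sub>C x"] scaleC_scaleC[of "- \<i>" \<i> x] scaleC_of_real[of 1 x]
    by (simp add: z_def)
  have "inner (T (\<i> *\<^sub>C (z + y))) (z + y) = 0" by (rule form)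
  then have "inner (T x) y + inner (T (\<i> *\<^sub>C y)) z = 0"
    using form[of z] form[of y] by (simp add: scaleC_add_right blinfun.add_right inner_simps iz)
  moreover have "inner (T (\<i> *\<^sub>C y)) z = - inner (T y) x"
    unfolding iT[symmetric] z_def by (simp add: inner_i_scale)
  ultimately show "inner (T x) y = inner x (T y)" by (simp add: inner_commute)
qed

text \<open>The decomposition into real and imaginary part stays inside a \<open>C\<^sup>*\<close>-algebra.\<close>

lemma cstar_real_imaginary:
  assumes A: "cstar_algebra \<A>" and Z: "Z \<in> \<A>"
  obtains R S where "R \<in> \<A>" "selfadjoint R" "S \<in> \<A>" "selfadjoint S" "Z = R + op_scaleC \<i> S"
proof -
  have cl: "clinear_op Z" using cstar_algebraD(1)[OF A Z] .
  define R where "R = (1/2) *\<^sub>R (Z + adj Z)"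
  define S where "S = op_scaleC (- \<i> / 2) (Z - adj Z)"
  show ?thesis
  proof (rule that)
    show "R \<in> \<A>" "S \<in> \<A>" unfolding R_def S_def
      by (intro cstar_scaleR[OF A] cstar_algebraD(2,3,5)[OF A] cstar_diff[OF A] Z)+
    show "selfadjoint R"
      using cl by (auto simp: R_def selfadjoint_iff blinfun.bilinear_simps inner_simps inner_adj inner_adj_left
          intro!: clinear_intros)
    show "selfadjoint S"
    proof (rule selfadjointI_real_form)
      show "clinear_op S" unfolding S_def by (intro clinear_intros cl)
      fix x
      have "cinner (adj Z x) x = cnj (cinner (Z x) x)"
        using cinner_adj[OF cl, of x x] cinner_commute[of "adj Z x" x] by simp
      moreover have "cinner (Z x) x = cinner (Z x - adj Z x) x + cinner (adj Z x) x"
        using cinner_add_left[of "Z x - adj Z x" "adj Z x" x] by simp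
      ultimately have "Re (cinner (Z x - adj Z x) x) = 0" by (simp add: complex_eq_iff)
      then show "Im (cinner (S x) x) = 0"
        by (simp add: S_def op_scaleC.rep_eq cinner_scaleC_left blinfun.diff_left)
    qed
    have "op_scaleC \<i> S = (1/2) *\<^sub>R (Z - adj Z)"
      using op_scaleC_of_real[of "1/2" "Z - adj Z"] unfolding S_def op_scaleC_op_scaleC by simp
    then show "Z = R + op_scaleC \<i> S"
      by (simp add: R_def scaleR_add_right scaleR_diff_right flip: scaleR_left_distrib)
  qed
qed

locale expectation =
  fixes \<Phi> :: "('h::chilbert_space \<Rightarrow>\<^sub>L 'h) \<Rightarrow> ('h \<Rightarrow>\<^sub>L 'h)" and \<A> \<B> :: "('h \<Rightarrow>\<^sub>L 'h) set"
  assumes unitalA: "unital_cstar_algebra \<A>" and B: "cstar_algebra \<B>" and BA: "\<B> \<subseteq> \<A>"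
    and unitB: "id_blinfun \<in> \<B>" and E: "conditional_expectation \<Phi> \<A> \<B>"
begin

lemma A: "cstar_algebra \<A>" and unitA: "id_blinfun \<in> \<A>"
  using unitalA by (auto simp: unital_cstar_algebra_def)

lemma \<Phi>_add: "X \<in> \<A> \<Longrightarrow> Y \<in> \<A> \<Longrightarrow> \<Phi> (X + Y) = \<Phi> X + \<Phi> Y"
  and \<Phi>_scaleC: "X \<in> \<A> \<Longrightarrow> \<Phi> (op_scaleC c X) = op_scaleC c (\<Phi> X)"
  and norm_\<Phi>: "X \<in> \<A> \<Longrightarrow> norm (\<Phi> X) \<le> norm X"
  and \<Phi>_in: "X \<in> \<A> \<Longrightarrow> \<Phi> X \<in> \<B>"
  using E by (auto simp: conditional_expectation_def)

lemma \<Phi>_fix: "X \<in> \<B> \<Longrightarrow> \<Phi> X = X"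
  using E unfolding conditional_expectation_def by (metis imageE)

lemma \<Phi>_scaleR: "X \<in> \<A> \<Longrightarrow> \<Phi> (r *\<^sub>R X) = r *\<^sub>R \<Phi> X"
  using \<Phi>_scaleC[of X "complex_of_real r"] by (simp add: op_scaleC_of_real)
lemma \<Phi>_diff: "X \<in> \<A> \<Longrightarrow> Y \<in> \<A> \<Longrightarrow> \<Phi> (X - Y) = \<Phi> X - \<Phi> Y"
  using \<Phi>_add[of X "(-1) *\<^sub>R Y"] \<Phi>_scaleR[of Y "-1"] cstar_scaleR[OF A, of Y "-1"] by simp
lemma \<Phi>_sum: "(\<And>i. i \<in> I \<Longrightarrow> X i \<in> \<A>) \<Longrightarrow> \<Phi> (\<Sum>i\<in>I. X i) = (\<Sum>i\<in>I. \<Phi> (X i))"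
proof (induction I rule: infinite_finite_induct)
  case (insert i I)
  then show ?case using \<Phi>_add[of "X i" "sum X I"] cstar_sum[OF A, of I X] by simp
qed (use \<Phi>_fix cstar_zero[OF B] in auto)

text \<open>If \<open>\<Phi> X\<close> had a quadratic form with imaginary part \<open>\<beta> \<noteq> 0\<close>, adding \<open>i t\<close> to \<open>X\<close> would shift
  \<open>\<beta>\<close> by a multiple of \<open>t\<close>, while \<open>\<parallel>X + i t\<parallel>\<^sup>2 = \<parallel>X\<parallel>\<^sup>2 + t\<^sup>2\<close> grows too slowly for a contraction.\<close>

lemma selfadjoint_\<Phi>:
  assumes XA: "X \<in> \<A>" and X: "selfadjoint X"
  shows "selfadjoint (\<Phi> X)"
proof (rule selfadjointI_real_form)
  show cl: "clinear_op (\<Phi> X)" using cstar_algebraD(1)[OF B] \<Phi>_in[OF XA] by blast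
  fix x
  define \<beta> where "\<beta> = Im (cinner (\<Phi> X x) x)"
  define N where "N = (norm x)\<^sup>2"
  define m where "m = (norm X)\<^sup>2"
  have key: "(\<beta> + t * N)\<^sup>2 \<le> (m + t\<^sup>2) * N\<^sup>2" for t
  proof -
    define I where "I = op_scaleC (\<i> * complex_of_real t) (id_blinfun :: 'h \<Rightarrow>\<^sub>L 'h)"
    have IB: "I \<in> \<B>" unfolding I_def by (intro cstar_algebraD(3)[OF B] unitB)
    have nX: "norm (X + I) \<le> sqrt (m + t\<^sup>2)"
    proof (rule norm_blinfun_bound)
      fix y
      have Iy: "I y = (\<i> * complex_of_real t) *\<^sub>C y" by (simp add: I_def op_scaleC.rep_eq)
      have "cinner (X y) y = complex_of_real (Re (cinner (X y) y))"
        using selfadjoint_cinner[OF X, of y y] cinner_commute[of "X y" y] by (simp add: complex_eq_iff)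
      then have "cinner (X y) (I y) = cnj (\<i> * complex_of_real t) * complex_of_real (Re (cinner (X y) y))"
        unfolding Iy cinner_scaleC_right by metis
      then have "inner (X y) (I y) = 0" by (simp add: Re_cinner[symmetric])
      then have "(norm ((X + I) y))\<^sup>2 = (norm (X y))\<^sup>2 + (norm (I y))\<^sup>2"
        by (simp add: power2_norm_eq_inner blinfun.add_left inner_simps inner_commute)
      also have "\<dots> \<le> (norm X * norm y)\<^sup>2 + (\<bar>t\<bar> * norm y)\<^sup>2"
        by (intro add_mono power_mono norm_blinfun) (auto simp: Iy norm_scaleC norm_mult)
      also have "\<dots> = (m + t\<^sup>2) * (norm y)\<^sup>2" by (simp add: m_def power_mult_distrib distrib_right)
      also have "\<dots> = (sqrt (m + t\<^sup>2) * norm y)\<^sup>2" by (simp add: power_mult_distrib m_def)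
      finally show "norm ((X + I) y) \<le> sqrt (m + t\<^sup>2) * norm y"
        by (rule power2_le_imp_le) (simp add: m_def)
    qed (simp add: m_def)
    have "\<Phi> (X + I) = \<Phi> X + I" using \<Phi>_add[OF XA, of I] \<Phi>_fix[OF IB] IB BA by auto
    then have n\<Phi>: "norm (\<Phi> X + I) \<le> sqrt (m + t\<^sup>2)"
      using norm_\<Phi>[of "X + I"] nX cstar_algebraD(2)[OF A XA, of I] IB BA by auto
    have "Im (cinner ((\<Phi> X + I) x) x) = \<beta> + t * N"
      by (simp add: blinfun.add_left cinner_add_left I_def op_scaleC.rep_eq cinner_scaleC_left cinner_self
          \<beta>_def N_def)
    then have "\<bar>\<beta> + t * N\<bar> = \<bar>inner (\<i> *\<^sub>C (\<Phi> X + I) x) x\<bar>" unfolding Im_cinner by simp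
    also have "\<dots> \<le> norm (\<i> *\<^sub>C (\<Phi> X + I) x) * norm x" by (rule Cauchy_Schwarz_ineq2)
    also have "\<dots> = norm ((\<Phi> X + I) x) * norm x" by (simp add: norm_scaleC)
    also have "\<dots> \<le> sqrt (m + t\<^sup>2) * norm x * norm x"
      using norm_blinfun[of "\<Phi> X + I" x] mult_right_mono[OF n\<Phi>, of "norm x"]
      by (intro mult_right_mono) auto
    also have "\<dots> = sqrt (m + t\<^sup>2) * N" by (simp add: N_def power2_eq_square mult.assoc)
    finally have "\<bar>\<beta> + t * N\<bar>\<^sup>2 \<le> (sqrt (m + t\<^sup>2) * N)\<^sup>2" by (intro power_mono) auto
    then show ?thesis by (simp add: power_mult_distrib m_def)
  qed
  show "\<beta> = 0"
  proof (rule ccontr)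
    assume b: "\<beta> \<noteq> 0"
    then have "x \<noteq> 0" by (auto simp: \<beta>_def blinfun.zero_right Im_cinner)
    then have N: "N > 0" by (simp add: N_def)
    \<comment> \<open>The cross term \<open>2 \<beta> t N\<close> of the square outweighs \<open>m N\<^sup>2\<close> for this \<open>t\<close>.\<close>
    define t where "t = (m * N\<^sup>2 + 1) / (2 * \<beta> * N)"
    have "2 * \<beta> * (t * N) = m * N\<^sup>2 + 1" using b N by (simp add: t_def)
    then have "\<beta>\<^sup>2 + 1 \<le> 0" using key[of t] by (simp add: power2_sum power_mult_distrib distrib_right)
    then show False using zero_le_power2[of \<beta>] by linarith
  qed
qed

text \<open>For a positive \<open>X\<close> and \<open>c = \<parallel>X\<parallel>\<close>, positivity amounts to \<open>\<parallel>c - X\<parallel> \<le> c\<close>, and a unital contraction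
  preserves this bound.\<close>

lemma \<Phi>_nonneg:
  assumes XA: "X \<in> \<A>" and X: "selfadjoint X" "\<And>x. 0 \<le> inner (X x) x"
  shows "0 \<le> inner (\<Phi> X x) x"
proof -
  define c where "c = norm X"
  have cA: "c *\<^sub>R id_blinfun \<in> \<A>" by (intro cstar_scaleR[OF A] unitA)
  have "norm (c *\<^sub>R id_blinfun - X) \<le> c"
  proof (rule norm_le_of_form_le)
    show "selfadjoint (c *\<^sub>R id_blinfun - X)" by (intro selfadjoint_diff selfadjoint_scaleR selfadjoint_id X)
    show "\<bar>inner ((c *\<^sub>R id_blinfun - X) x) x\<bar> \<le> c * (norm x)\<^sup>2" for x
      using X(2)[of x] form_le_norm[of X x]
      by (simp add: blinfun.bilinear_simps inner_simps power2_norm_eq_inner c_def)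
  qed (simp add: c_def)
  then have "norm (\<Phi> (c *\<^sub>R id_blinfun - X)) \<le> c"
    using norm_\<Phi>[OF cstar_diff[OF A cA XA]] by simp
  moreover have "\<Phi> (c *\<^sub>R id_blinfun - X) = c *\<^sub>R id_blinfun - \<Phi> X"
    using \<Phi>_diff[OF cA XA] \<Phi>_scaleR[OF unitA] \<Phi>_fix[OF unitB] by simp
  ultimately have "\<bar>inner ((c *\<^sub>R id_blinfun - \<Phi> X) x) x\<bar> \<le> c * (norm x)\<^sup>2"
    using form_le_norm[of "c *\<^sub>R id_blinfun - \<Phi> X" x] mult_right_mono[of _ c "(norm x)\<^sup>2"] by fastforce
  then show ?thesis by (simp add: blinfun.bilinear_simps inner_simps power2_norm_eq_inner)
qed

text \<open>Tomiyama's norm estimate. Put \<open>w = G \<Phi>(K X)\<close>, an element of the range of \<open>\<Phi>\<close>.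
  The operators \<open>K X\<close> and \<open>w\<close> have orthogonal ranges, so \<open>\<parallel>K X + s w\<parallel>\<^sup>2 \<le> \<parallel>K X\<parallel>\<^sup>2 + s\<^sup>2 \<parallel>w\<parallel>\<^sup>2\<close>, whereas
  the norm of \<open>\<Phi>(K X + s w) = (1 + s G) \<Phi>(K X)\<close> is at least \<open>(1 + s) \<parallel>w\<parallel>\<close>. Letting \<open>s\<close> grow
  yields \<open>w = 0\<close>.\<close>

lemma \<Phi>_zero_product:
  assumes GB: "G \<in> \<B>" and G: "form_between 0 1 G" and KB: "K \<in> \<B>" and K: "selfadjoint K"
    and KG: "K o\<^sub>L G = 0" and XA: "X \<in> \<A>"
  shows "G o\<^sub>L \<Phi> (K o\<^sub>L X) = 0"
proof -
  define Y where "Y = \<Phi> (K o\<^sub>L X)"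
  define W where "W = G o\<^sub>L Y"
  have KX: "K o\<^sub>L X \<in> \<A>" using cstar_algebraD(4)[OF A] KB BA XA by blast
  have YB: "Y \<in> \<B>" unfolding Y_def by (rule \<Phi>_in[OF KX])
  have WB: "W \<in> \<B>" unfolding W_def by (intro cstar_algebraD(4)[OF B] GB YB)
  have G_sa: "selfadjoint G" by (rule form_between_selfadjoint[OF G])
  have G_nonneg: "0 \<le> inner (G x) x" and G_le: "inner (G x) x \<le> (norm x)\<^sup>2" for x
    using G by (auto simp: form_between_def)
  obtain R where R: "selfadjoint R" "R o\<^sub>L R = G"
    using positive_factorization[OF G_sa G_nonneg] by blast
  have RR: "G x = R (R x)" for x using R(2) by (metis blinfun_apply_blinfun_compose)
  have Gsq: "(norm (G x))\<^sup>2 \<le> inner (G x) x" for x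
  proof -
    have "(norm (G x))\<^sup>2 = inner (G (R x)) (R x)"
      unfolding power2_norm_eq_inner RR using selfadjointD[OF R(1)] by simp
    also have "\<dots> \<le> inner (R x) (R x)" using G_le[of "R x"] by (simp add: power2_norm_eq_inner)
    also have "\<dots> = inner (G x) x" unfolding RR using selfadjointD[OF R(1)] by simp
    finally show ?thesis .
  qed
  \<comment> \<open>\<open>(1 + s G)\<^sup>2 - (1 + s)\<^sup>2 G\<^sup>2 = (1 - G\<^sup>2) + 2 s (G - G\<^sup>2) \<ge> 0\<close>, since \<open>G\<^sup>2 \<le> G \<le> 1\<close>.\<close>
  have low: "((1 + s) * norm (G u))\<^sup>2 \<le> (norm (u + s *\<^sub>R G u))\<^sup>2" if "0 \<le> s" for s u
  proof -
    have "(norm (G u))\<^sup>2 \<le> (norm u)\<^sup>2" using Gsq[of u] G_le[of u] by linarith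
    moreover have "2 * s * (norm (G u))\<^sup>2 \<le> 2 * s * inner (G u) u"
      using that Gsq[of u] by (intro mult_left_mono) auto
    moreover have "(norm (u + s *\<^sub>R G u))\<^sup>2 = (norm u)\<^sup>2 + 2 * s * inner (G u) u + s\<^sup>2 * (norm (G u))\<^sup>2"
      unfolding power2_norm_eq_inner
      by (simp add: inner_simps inner_commute[of u "G u"] power2_eq_square algebra_simps)
    moreover have "((1 + s) * norm (G u))\<^sup>2 = (norm (G u))\<^sup>2 + 2 * s * (norm (G u))\<^sup>2 + s\<^sup>2 * (norm (G u))\<^sup>2"
      by (simp add: power2_eq_square algebra_simps)
    ultimately show ?thesis by linarith
  qed
  have KXW: "norm ((K o\<^sub>L X) + s *\<^sub>R W) \<le> sqrt ((norm (K o\<^sub>L X))\<^sup>2 + s\<^sup>2 * (norm W)\<^sup>2)" for s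
  proof (rule norm_blinfun_bound)
    fix x
    have "K (G y) = 0" for y using KG by (metis blinfun_apply_blinfun_compose blinfun.zero_left)
    then have "inner (K (X x)) (W x) = 0" using selfadjointD[OF K] by (simp add: W_def)
    then have "(norm (((K o\<^sub>L X) + s *\<^sub>R W) x))\<^sup>2 = (norm ((K o\<^sub>L X) x))\<^sup>2 + s\<^sup>2 * (norm (W x))\<^sup>2"
      unfolding power2_norm_eq_inner
      by (simp add: blinfun.bilinear_simps inner_simps power2_eq_square inner_commute[of "W x" "K (X x)"])
    also have "\<dots> \<le> (norm (K o\<^sub>L X) * norm x)\<^sup>2 + s\<^sup>2 * (norm W * norm x)\<^sup>2"
      by (intro add_mono mult_left_mono power_mono norm_blinfun) auto
    also have "\<dots> = (sqrt ((norm (K o\<^sub>L X))\<^sup>2 + s\<^sup>2 * (norm W)\<^sup>2) * norm x)\<^sup>2"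
      by (simp add: power_mult_distrib distrib_right)
    finally show "norm (((K o\<^sub>L X) + s *\<^sub>R W) x) \<le> sqrt ((norm (K o\<^sub>L X))\<^sup>2 + s\<^sup>2 * (norm W)\<^sup>2) * norm x"
      by (rule power2_le_imp_le) simp
  qed simp
  have est: "((1 + s) * norm W)\<^sup>2 \<le> (norm (K o\<^sub>L X))\<^sup>2 + s\<^sup>2 * (norm W)\<^sup>2" if s: "0 \<le> s" for s
  proof -
    have "\<Phi> ((K o\<^sub>L X) + s *\<^sub>R W) = Y + s *\<^sub>R W"
      using \<Phi>_add[OF KX, of "s *\<^sub>R W"] \<Phi>_fix[OF cstar_scaleR[OF B WB]] cstar_scaleR[OF B WB, of s] BA
      by (auto simp: Y_def)
    then have n: "norm (Y + s *\<^sub>R W) \<le> norm ((K o\<^sub>L X) + s *\<^sub>R W)"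
      using norm_\<Phi>[of "(K o\<^sub>L X) + s *\<^sub>R W"] cstar_algebraD(2)[OF A KX, of "s *\<^sub>R W"]
        cstar_scaleR[OF B WB, of s] BA by auto
    have "norm ((1 + s) *\<^sub>R W) \<le> norm (Y + s *\<^sub>R W)"
    proof (rule norm_blinfun_bound)
      fix x
      have "norm (((1 + s) *\<^sub>R W) x) = (1 + s) * norm (G (Y x))"
        using s by (simp add: blinfun.scaleR_left W_def)
      also have "\<dots> \<le> norm (Y x + s *\<^sub>R G (Y x))"
        by (rule power2_le_imp_le[OF low[OF s]]) simp
      also have "\<dots> = norm ((Y + s *\<^sub>R W) x)" by (simp add: blinfun.bilinear_simps W_def)
      also have "\<dots> \<le> norm (Y + s *\<^sub>R W) * norm x" by (rule norm_blinfun)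
      finally show "norm (((1 + s) *\<^sub>R W) x) \<le> norm (Y + s *\<^sub>R W) * norm x" .
    qed simp
    then have "(1 + s) * norm W \<le> sqrt ((norm (K o\<^sub>L X))\<^sup>2 + s\<^sup>2 * (norm W)\<^sup>2)"
      using n KXW[of s] s by simp
    then have "((1 + s) * norm W)\<^sup>2 \<le> (sqrt ((norm (K o\<^sub>L X))\<^sup>2 + s\<^sup>2 * (norm W)\<^sup>2))\<^sup>2"
      using s by (intro power_mono) auto
    then show ?thesis by simp
  qed
  have "W = 0"
  proof (rule ccontr)
    assume "W \<noteq> 0"
    then have w: "(norm W)\<^sup>2 > 0" by simp
    define s where "s = (norm (K o\<^sub>L X))\<^sup>2 / (norm W)\<^sup>2"
    have s: "0 \<le> s" "s * (norm W)\<^sup>2 = (norm (K o\<^sub>L X))\<^sup>2" using w by (auto simp: s_def)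
    have "((1 + s) * norm W)\<^sup>2 = (norm W)\<^sup>2 + 2 * (s * (norm W)\<^sup>2) + s\<^sup>2 * (norm W)\<^sup>2"
      by (simp add: power2_eq_square algebra_simps)
    then show False using est[OF s(1)] w s(2) zero_le_power2[of "norm (K o\<^sub>L X)"] by linarith
  qed
  then show ?thesis by (simp add: W_def Y_def)
qed

end

text \<open>A weighted Cauchy-Schwarz inequality: the row operator formed from positive weights that sum
  to the identity is a contraction.\<close>

lemma norm_weighted_sum_le:
  fixes G :: "'i \<Rightarrow> 'a::chilbert_space \<Rightarrow>\<^sub>L 'a"
  assumes G: "\<And>i. i \<in> I \<Longrightarrow> form_between 0 1 (G i)" and one: "(\<Sum>i\<in>I. G i) = id_blinfun"
  shows "(norm (\<Sum>i\<in>I. G i (h i)))\<^sup>2 \<le> (\<Sum>i\<in>I. (norm (h i))\<^sup>2)"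
proof -
  define u where "u = (\<Sum>i\<in>I. G i (h i))"
  have Gu: "(\<Sum>i\<in>I. G i u) = u" using one by (metis blinfun.sum_left blinfun_apply_id_blinfun id_apply)
  have "0 \<le> (\<Sum>i\<in>I. inner (G i (h i - u)) (h i - u))"
    using G by (intro sum_nonneg) (auto simp: form_between_def)
  also have "\<dots> = (\<Sum>i\<in>I. inner (G i (h i)) (h i)) - inner u u"
  proof -
    have "inner (G i (h i - u)) (h i - u)
        = inner (G i (h i)) (h i) - 2 * inner (G i (h i)) u + inner (G i u) u" if "i \<in> I" for i
      using selfadjointD[OF form_between_selfadjoint[OF G[OF that]], of u "h i"]
      by (simp add: blinfun.diff_right inner_simps inner_commute[of u])
    then have "(\<Sum>i\<in>I. inner (G i (h i - u)) (h i - u)) = (\<Sum>i\<in>I. inner (G i (h i)) (h i))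
        - 2 * inner (\<Sum>i\<in>I. G i (h i)) u + inner (\<Sum>i\<in>I. G i u) u"
      by (simp add: sum.distrib sum_subtractf sum_distrib_left inner_sum_left)
    then show ?thesis unfolding Gu u_def[symmetric] by simp
  qed
  also have "(\<Sum>i\<in>I. inner (G i (h i)) (h i)) \<le> (\<Sum>i\<in>I. (norm (h i))\<^sup>2)"
    using G by (intro sum_mono) (auto simp: form_between_def)
  finally show ?thesis by (simp add: u_def power2_norm_eq_inner)
qed

context expectation
begin

text \<open>The error \<open>b \<Phi>(X) - \<Phi>(b X)\<close> is written with a partition of unity \<open>G\<^sub>0, \<dots>, G\<^sub>n\<close> of \<open>b\<close> into hat
  functions. Only pairs of neighbours contribute, each of them with a factor \<open>O(1/n)\<close>, and by
  \<open>norm_weighted_sum_le\<close> the \<open>n + 1\<close> rows add up to \<open>O(1/\<surd>n)\<close>.\<close>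

lemma \<Phi>_left_module_selfadjoint:
  assumes bB: "b \<in> \<B>" and b: "selfadjoint b" and XA: "X \<in> \<A>"
  shows "\<Phi> (b o\<^sub>L X) = b o\<^sub>L \<Phi> X"
proof -
  define L where "L = norm b + 1"
  have L: "- L < L" using norm_ge_zero[of b] by (simp add: L_def del: norm_ge_zero)
  have fb: "form_between (- L) L b"
    by (rule form_between_mono[OF form_between_norm[OF b]]) (simp_all add: L_def)
  define D where "D = (b o\<^sub>L \<Phi> X) - \<Phi> (b o\<^sub>L X)"
  have bX: "b o\<^sub>L X \<in> \<A>" using cstar_algebraD(4)[OF A] bB BA XA by blast
  have bound: "(norm (D v))\<^sup>2 \<le> 72 * L\<^sup>2 * (norm X)\<^sup>2 * (norm v)\<^sup>2 * (1 / real n)" if n: "0 < n" for n v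
  proof -
    define G where "G i = cfc (hat (-L) L n i) b" for i
    define \<tau> where "\<tau> = grid (-L) L n"
    note ch = continuous_on_hat[of "{-L..L}" "-L" L n]
    have GB: "G i \<in> \<B>" for i unfolding G_def by (rule cstar_cfc[OF B unitB bB fb ch])
    have GA: "G i \<in> \<A>" for i using GB BA by blast
    have G_sa: "selfadjoint (G i)" for i unfolding G_def by (rule selfadjoint_cfc[OF fb ch])
    have nG: "norm (G i) \<le> 1" for i
      unfolding G_def by (rule norm_cfc_le[OF fb ch]) (auto simp: hat_bounds abs_of_nonneg)
    have G01: "form_between 0 1 (G i)" for i
      unfolding form_between_def
    proof (intro conjI allI G_sa)
      fix x
      show "0 * (norm x)\<^sup>2 \<le> inner (G i x) x"
        unfolding G_def using cfc_nonneg[OF fb ch] by (simp add: hat_bounds)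
      show "inner (G i x) x \<le> 1 * (norm x)\<^sup>2"
        using form_le_norm[of "G i" x] mult_right_mono[OF nG, of "(norm x)\<^sup>2" i] by simp
    qed
    have "(\<Sum>i\<le>n. G i) = cfc (\<lambda>t. \<Sum>i\<le>n. hat (-L) L n i t) b"
      unfolding G_def by (rule cfc_sum[OF fb, symmetric]) (rule ch)
    also have "\<dots> = cfc (\<lambda>_. 1) b" by (rule cfc_cong[OF fb]) (auto simp: hat_sums(1)[OF L n])
    finally have one: "(\<Sum>i\<le>n. G i) = id_blinfun" using cfc_const[OF fb, of 1] by simp
    have "(\<Sum>i\<le>n. \<tau> i *\<^sub>R G i) = (\<Sum>i\<le>n. cfc (\<lambda>t. \<tau> i * hat (-L) L n i t) b)"
      unfolding G_def using cfc_scale[OF fb ch] by simp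
    also have "\<dots> = cfc (\<lambda>t. \<Sum>i\<le>n. \<tau> i * hat (-L) L n i t) b"
      by (rule cfc_sum[OF fb, symmetric]) (intro continuous_intros ch)
    also have "\<dots> = cfc (\<lambda>t. t) b"
      by (rule cfc_cong[OF fb]) (auto simp: hat_sums(2)[OF L n] \<tau>_def intro: continuous_intros)
    finally have sum\<tau>: "(\<Sum>i\<le>n. \<tau> i *\<^sub>R G i) = b" using cfc_ident[OF fb] by simp
    have far: "G i o\<^sub>L \<Phi> (G j o\<^sub>L X) = 0" if "2 \<le> \<bar>real i - real j\<bar>" for i j
    proof (rule \<Phi>_zero_product[OF GB G01 GB G_sa _ XA])
      have "cfc (\<lambda>t. hat (-L) L n j t * hat (-L) L n i t) b = cfc (\<lambda>_. 0) b"
        using that by (intro cfc_cong[OF fb]) (auto simp: hat_mult_zero abs_minus_commute)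
      then show "G j o\<^sub>L G i = 0" unfolding G_def using cfc_mult[OF fb ch ch] cfc_const[OF fb, of 0] by simp
    qed
    \<comment> \<open>The \<open>i\<close>-th row of the error, restricted to the neighbours of \<open>i\<close>.\<close>
    define H where "H i = (\<Sum>j | j \<le> n \<and> \<bar>real i - real j\<bar> < 2. (\<tau> i - \<tau> j) *\<^sub>R \<Phi> (G j o\<^sub>L X))" for i
    have GX: "G j o\<^sub>L X \<in> \<A>" for j by (intro cstar_algebraD(4)[OF A] GA XA)
    have \<Phi>X: "\<Phi> X = (\<Sum>j\<le>n. \<Phi> (G j o\<^sub>L X))"
    proof -
      have "X = (\<Sum>j\<le>n. G j o\<^sub>L X)" unfolding compose_sum_left[symmetric] one by simp
      then show ?thesis using \<Phi>_sum[of "{..n}" "\<lambda>j. G j o\<^sub>L X"] GX by simp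
    qed
    have \<Phi>bX: "\<Phi> (b o\<^sub>L X) = (\<Sum>j\<le>n. \<tau> j *\<^sub>R \<Phi> (G j o\<^sub>L X))"
    proof -
      have "b o\<^sub>L X = (\<Sum>j\<le>n. \<tau> j *\<^sub>R (G j o\<^sub>L X))"
        unfolding sum\<tau>[symmetric] compose_sum_left by (simp add: compose_bilinear)
      then show ?thesis
        using \<Phi>_sum[of "{..n}" "\<lambda>j. \<tau> j *\<^sub>R (G j o\<^sub>L X)"] cstar_scaleR[OF A GX] \<Phi>_scaleR[OF GX] by simp
    qed
    have row: "G i o\<^sub>L (\<tau> i *\<^sub>R \<Phi> X - \<Phi> (b o\<^sub>L X)) = G i o\<^sub>L H i" for i
    proof -
      have "\<tau> i *\<^sub>R \<Phi> X - \<Phi> (b o\<^sub>L X) = (\<Sum>j\<le>n. (\<tau> i - \<tau> j) *\<^sub>R \<Phi> (G j o\<^sub>L X))"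
        unfolding \<Phi>bX by (subst \<Phi>X) (simp add: scaleR_sum_right scaleR_left_diff_distrib sum_subtractf)
      then have "G i o\<^sub>L (\<tau> i *\<^sub>R \<Phi> X - \<Phi> (b o\<^sub>L X))
          = (\<Sum>j\<le>n. (\<tau> i - \<tau> j) *\<^sub>R (G i o\<^sub>L \<Phi> (G j o\<^sub>L X)))"
        by (simp add: compose_sum_right compose_bilinear)
      also have "\<dots> = (\<Sum>j | j \<le> n \<and> \<bar>real i - real j\<bar> < 2. (\<tau> i - \<tau> j) *\<^sub>R (G i o\<^sub>L \<Phi> (G j o\<^sub>L X)))"
      proof (rule sum.mono_neutral_right)
        show "\<forall>j\<in>{..n} - {j. j \<le> n \<and> \<bar>real i - real j\<bar> < 2}. (\<tau> i - \<tau> j) *\<^sub>R (G i o\<^sub>L \<Phi> (G j o\<^sub>L X)) = 0"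
        proof
          fix j assume "j \<in> {..n} - {j. j \<le> n \<and> \<bar>real i - real j\<bar> < 2}"
          then have "2 \<le> \<bar>real i - real j\<bar>" by auto
          then show "(\<tau> i - \<tau> j) *\<^sub>R (G i o\<^sub>L \<Phi> (G j o\<^sub>L X)) = 0" by (simp add: far)
        qed
      qed auto
      also have "\<dots> = G i o\<^sub>L H i" by (simp add: H_def compose_sum_right compose_bilinear)
      finally show ?thesis .
    qed
    define \<delta> where "\<delta> = 2 * L / real n"
    have \<delta>: "\<delta> > 0" using L n by (simp add: \<delta>_def)
    \<comment> \<open>A grid point has at most three neighbours, counting itself, at distance at most \<open>\<delta>\<close>.\<close>
    have nH: "norm (H i) \<le> 3 * (\<delta> * norm X)" for i
    proof -
      let ?S = "{j. j \<le> n \<and> \<bar>real i - real j\<bar> < 2}"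
      have "norm (H i) \<le> (\<Sum>j\<in>?S. norm ((\<tau> i - \<tau> j) *\<^sub>R \<Phi> (G j o\<^sub>L X)))" unfolding H_def by (rule norm_sum)
      also have "\<dots> \<le> (\<Sum>j\<in>?S. \<delta> * norm X)"
      proof (rule sum_mono)
        fix j assume j: "j \<in> ?S"
        have "\<bar>real i - real j\<bar> \<le> 1"
        proof -
          have "real_of_int \<bar>int i - int j\<bar> < 2" using j by simp
          then have "\<bar>int i - int j\<bar> \<le> 1" by linarith
          then have "real_of_int \<bar>int i - int j\<bar> \<le> 1" by linarith
          then show ?thesis by simp
        qed
        moreover have "\<tau> i - \<tau> j = (real i - real j) * \<delta>"
          by (simp add: \<tau>_def grid_def \<delta>_def left_diff_distrib diff_divide_distrib)
        ultimately have "\<bar>\<tau> i - \<tau> j\<bar> \<le> \<delta>"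
          using \<delta> by (simp add: abs_mult mult_left_le_one_le)
        moreover have "norm (\<Phi> (G j o\<^sub>L X)) \<le> norm X"
        proof -
          have "norm (\<Phi> (G j o\<^sub>L X)) \<le> norm (G j) * norm X"
            using norm_\<Phi>[OF GX] norm_blinfun_compose order_trans by blast
          also have "\<dots> \<le> 1 * norm X" by (intro mult_right_mono nG) simp
          finally show ?thesis by simp
        qed
        ultimately show "norm ((\<tau> i - \<tau> j) *\<^sub>R \<Phi> (G j o\<^sub>L X)) \<le> \<delta> * norm X"
          using \<delta> by (simp add: mult_mono)
      qed
      also have "\<dots> = real (card ?S) * (\<delta> * norm X)" by simp
      also have "\<dots> \<le> 3 * (\<delta> * norm X)"
      proof (intro mult_right_mono)
        have "?S \<subseteq> {i - 1..i + 1}" by auto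
        then have "card ?S \<le> card {i - 1..i + 1}" by (intro card_mono) auto
        also have "\<dots> \<le> 3" by simp
        finally show "real (card ?S) \<le> 3" by simp
      qed (use \<delta> in simp)
      finally show ?thesis .
    qed
    have "D = (\<Sum>i\<le>n. G i o\<^sub>L H i)"
    proof -
      have "D = ((\<Sum>i\<le>n. \<tau> i *\<^sub>R G i) o\<^sub>L \<Phi> X) - ((\<Sum>i\<le>n. G i) o\<^sub>L \<Phi> (b o\<^sub>L X))"
        unfolding D_def sum\<tau> one by simp
      also have "\<dots> = (\<Sum>i\<le>n. G i o\<^sub>L (\<tau> i *\<^sub>R \<Phi> X - \<Phi> (b o\<^sub>L X)))"
        by (simp add: compose_sum_left compose_bilinear sum_subtractf)
      finally show ?thesis unfolding row .
    qed
    then have "D v = (\<Sum>i\<le>n. G i (H i v))" by (simp add: blinfun.sum_left)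
    then have "(norm (D v))\<^sup>2 \<le> (\<Sum>i\<le>n. (norm (H i v))\<^sup>2)"
      using norm_weighted_sum_le[of "{..n}" G "\<lambda>i. H i v"] G01 one by simp
    also have "\<dots> \<le> (\<Sum>i\<le>n. (3 * (\<delta> * norm X) * norm v)\<^sup>2)"
    proof (intro sum_mono power_mono)
      show "norm (H i v) \<le> 3 * (\<delta> * norm X) * norm v" for i
        using norm_blinfun[of "H i" v] mult_right_mono[OF nH, of "norm v" i] by simp
    qed simp
    also have "\<dots> = (real n + 1) * (9 * \<delta>\<^sup>2 * ((norm X)\<^sup>2 * (norm v)\<^sup>2))"
      by (simp add: power_mult_distrib)
    also have "\<dots> \<le> (2 * real n) * (9 * \<delta>\<^sup>2 * ((norm X)\<^sup>2 * (norm v)\<^sup>2))"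
      using n by (intro mult_right_mono) auto
    also have "\<dots> = 72 * L\<^sup>2 * (norm X)\<^sup>2 * (norm v)\<^sup>2 * (1 / real n)"
      using n by (simp add: \<delta>_def power2_eq_square field_simps)
    finally show ?thesis .
  qed
  have "D v = 0" for v
  proof -
    have "(\<lambda>n. 72 * L\<^sup>2 * (norm X)\<^sup>2 * (norm v)\<^sup>2 * (1 / real n)) \<longlonglongrightarrow> 72 * L\<^sup>2 * (norm X)\<^sup>2 * (norm v)\<^sup>2 * 0"
      by (intro tendsto_intros lim_1_over_n)
    moreover have "\<forall>\<^sub>F n in sequentially. (norm (D v))\<^sup>2 \<le> 72 * L\<^sup>2 * (norm X)\<^sup>2 * (norm v)\<^sup>2 * (1 / real n)"
      using eventually_gt_at_top[of 0] by eventually_elim (rule bound)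
    ultimately have "(norm (D v))\<^sup>2 \<le> 72 * L\<^sup>2 * (norm X)\<^sup>2 * (norm v)\<^sup>2 * 0"
      by (rule tendsto_lowerbound) simp
    then show ?thesis by simp
  qed
  then have "D = 0" by (intro blinfun_eqI) simp
  then show ?thesis by (simp add: D_def)
qed

lemma \<Phi>_left_module:
  assumes bB: "b \<in> \<B>" and XA: "X \<in> \<A>"
  shows "\<Phi> (b o\<^sub>L X) = b o\<^sub>L \<Phi> X"
proof -
  obtain r s where rs: "r \<in> \<B>" "selfadjoint r" "s \<in> \<B>" "selfadjoint s" and b: "b = r + op_scaleC \<i> s"
    using cstar_real_imaginary[OF B bB] .
  have rX: "r o\<^sub>L X \<in> \<A>" "s o\<^sub>L X \<in> \<A>" using cstar_algebraD(4)[OF A] rs BA XA by blast+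
  have "b o\<^sub>L X = (r o\<^sub>L X) + op_scaleC \<i> (s o\<^sub>L X)"
    by (simp add: b compose_bilinear op_scaleC_compose_left)
  then have "\<Phi> (b o\<^sub>L X) = (r o\<^sub>L \<Phi> X) + op_scaleC \<i> (s o\<^sub>L \<Phi> X)"
    using \<Phi>_add[OF rX(1) cstar_algebraD(3)[OF A rX(2)]] \<Phi>_scaleC[OF rX(2)]
      \<Phi>_left_module_selfadjoint[OF rs(1,2) XA] \<Phi>_left_module_selfadjoint[OF rs(3,4) XA] by simp
  also have "\<dots> = b o\<^sub>L \<Phi> X"
    by (simp add: b compose_bilinear op_scaleC_compose_left)
  finally show ?thesis .
qed

lemma \<Phi>_adj:
  assumes ZA: "Z \<in> \<A>"
  shows "\<Phi> (adj Z) = adj (\<Phi> Z)"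
proof -
  obtain R S where RS: "R \<in> \<A>" "selfadjoint R" "S \<in> \<A>" "selfadjoint S" and Z: "Z = R + op_scaleC \<i> S"
    using cstar_real_imaginary[OF A ZA] .
  have adj: "adj (X + op_scaleC \<i> Y) = X - op_scaleC \<i> Y" if X: "selfadjoint X" and Y: "selfadjoint Y"
    for X Y :: "'h \<Rightarrow>\<^sub>L 'h"
  proof (rule adj_eqI)
    show "clinear_op (X + op_scaleC \<i> Y)" by (intro clinear_intros selfadjoint_clinear X Y)
    fix x y
    have "inner (\<i> *\<^sub>C u) v = - inner u (\<i> *\<^sub>C v)" for u v :: 'h
      by (simp add: Re_cinner[symmetric] cinner_scaleC_left cinner_scaleC_right)
    moreover have "\<i> *\<^sub>C Y x = Y (\<i> *\<^sub>C x)" for x using selfadjoint_clinear[OF Y] by (simp add: clinear_op_def)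
    ultimately show "inner ((X + op_scaleC \<i> Y) x) y = inner x ((X - op_scaleC \<i> Y) y)"
      using selfadjointD[OF X, of x y] selfadjointD[OF Y, of "\<i> *\<^sub>C x" y]
      by (simp add: blinfun.bilinear_simps inner_simps op_scaleC.rep_eq)
  qed
  have iS: "op_scaleC \<i> S \<in> \<A>" by (rule cstar_algebraD(3)[OF A RS(3)])
  show ?thesis
    unfolding Z adj[OF RS(2,4)] \<Phi>_add[OF RS(1) iS] \<Phi>_diff[OF RS(1) iS] \<Phi>_scaleC[OF RS(3)]
    using adj[OF selfadjoint_\<Phi>[OF RS(1,2)] selfadjoint_\<Phi>[OF RS(3,4)]] by simp
qed

text \<open>The right-hand factor is moved to the left by taking adjoints.\<close>

lemma \<Phi>_congruence:
  assumes cB: "c \<in> \<B>" and XA: "X \<in> \<A>"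
  shows "\<Phi> (adj c o\<^sub>L X o\<^sub>L c) = adj c o\<^sub>L \<Phi> X o\<^sub>L c"
proof -
  have ac: "adj c \<in> \<B>" using cstar_algebraD(5)[OF B cB] .
  have aX: "adj X \<in> \<A>" using cstar_algebraD(5)[OF A XA] .
  have XcA: "X o\<^sub>L c \<in> \<A>" and acX: "adj c o\<^sub>L adj X \<in> \<A>"
    using cstar_algebraD(4)[OF A] XA aX cB ac BA by blast+
  note cl = cstar_algebraD(1)[OF B cB] cstar_algebraD(1)[OF A XA] cstar_algebraD(1)[OF B \<Phi>_in[OF XA]]
  have "\<Phi> (X o\<^sub>L c) = \<Phi> (adj (adj c o\<^sub>L adj X))"
    by (simp add: adj_compose clinear_adj adj_adj cl)
  also have "\<dots> = adj (adj c o\<^sub>L adj (\<Phi> X))"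
    by (simp add: \<Phi>_adj[OF acX] \<Phi>_left_module[OF ac aX] \<Phi>_adj[OF XA])
  also have "\<dots> = \<Phi> X o\<^sub>L c"
    by (simp add: adj_compose clinear_adj adj_adj cl)
  finally show ?thesis using \<Phi>_left_module[OF ac XcA] by (simp add: compose_assoc)
qed

end


section \<open>Finite orthonormal families\<close>

lemma cinner_add_right: "cinner z (x + y) = cinner z x + cinner z y" for x y z :: "'a::chilbert_space"
  by (metis cinner_commute cinner_add_left complex_cnj_add)
lemma cinner_zero [simp]: "cinner 0 x = 0" "cinner x 0 = 0" for x :: "'a::chilbert_space"
  using cinner_add_left[of 0 0 x] cinner_add_right[of x 0 0] by simp_all
lemma cinner_sum_left: "cinner (\<Sum>i\<in>I. f i) z = (\<Sum>i\<in>I. cinner (f i) z)" for z :: "'a::chilbert_space"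
  by (induction I rule: infinite_finite_induct) (simp_all add: cinner_add_left)
lemma cinner_sum_right: "cinner z (\<Sum>i\<in>I. f i) = (\<Sum>i\<in>I. cinner z (f i))" for z :: "'a::chilbert_space"
  by (induction I rule: infinite_finite_induct) (simp_all add: cinner_add_right)
lemma cinner_diff_left: "cinner (x - y) z = cinner x z - cinner y z" for x y z :: "'a::chilbert_space"
  using cinner_add_left[of "x - y" y z] by simp
lemma cinner_scaleR_left: "cinner (r *\<^sub>R x) y = complex_of_real r * cinner x y" for x y :: "'a::chilbert_space"
  by (simp add: scaleC_of_real[symmetric] cinner_scaleC_left)
lemma cinner_scaleR_right: "cinner x (r *\<^sub>R y) = complex_of_real r * cinner x y" for x y :: "'a::chilbert_space"
  by (simp add: scaleC_of_real[symmetric] cinner_scaleC_right)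
lemma scaleC_zero [simp]: "c *\<^sub>C 0 = 0" "0 *\<^sub>C x = 0" for x :: "'a::chilbert_space"
  using scaleC_add_right[of c 0 0] scaleC_add_left[of 0 0 x] by simp_all
definition orthonormal_family :: "'k set \<Rightarrow> ('k \<Rightarrow> 'a::chilbert_space) \<Rightarrow> bool" where
  "orthonormal_family K e \<longleftrightarrow> (\<forall>k\<in>K. \<forall>l\<in>K. cinner (e k) (e l) = (if k = l then 1 else 0))"

text \<open>The last property says that the orthonormal vectors lie in the span of \<open>V\<close>, in the form in which
  it is used to project onto that span.\<close>

lemma gram_schmidt:
  fixes V :: "'a::chilbert_space set"
  assumes "finite V"
  shows "\<exists>E. finite E \<and> orthonormal_family E (\<lambda>e. e) \<and> (\<forall>v\<in>V. v = (\<Sum>e\<in>E. cinner v e *\<^sub>C e)) \<and>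
    (\<forall>w. (\<forall>v\<in>V. cinner w v = 0) \<longrightarrow> (\<forall>e\<in>E. cinner w e = 0))"
  using assms
proof (induction V)
  case empty
  show ?case by (intro exI[of _ "{}"]) (simp add: orthonormal_family_def)
next
  case (insert v V)
  then obtain E where E: "finite E" "orthonormal_family E (\<lambda>e. e)"
    "\<And>v. v \<in> V \<Longrightarrow> v = (\<Sum>e\<in>E. cinner v e *\<^sub>C e)"
    "\<And>w e. (\<forall>v\<in>V. cinner w v = 0) \<Longrightarrow> e \<in> E \<Longrightarrow> cinner w e = 0" by blast
  define P where "P = (\<Sum>e\<in>E. cinner v e *\<^sub>C e)"
  define u where "u = v - P"
  have orth: "cinner e e' = (if e = e' then 1 else 0)" if "e \<in> E" "e' \<in> E" for e e'
    using E(2) that by (simp add: orthonormal_family_def)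
  have Pe: "cinner P e = cinner v e" if "e \<in> E" for e
  proof -
    have "cinner P e = (\<Sum>e'\<in>E. cinner v e' * (if e' = e then 1 else 0))"
      unfolding P_def cinner_sum_left using that by (intro sum.cong refl) (simp add: cinner_scaleC_left orth)
    then show ?thesis using that E(1) by (simp add: if_distrib[of "\<lambda>x. _ * x"] cong: if_cong)
  qed
  have ue: "cinner u e = 0" "cinner e u = 0" if "e \<in> E" for e
  proof -
    show "cinner u e = 0" using Pe[OF that] by (simp add: u_def cinner_diff_left)
    then show "cinner e u = 0" using cinner_commute[of e u] by simp
  qed
  show ?case
  proof (cases "u = 0")
    case True
    then show ?thesis using E by (intro exI[of _ E]) (auto simp: u_def P_def)
  next
    case False
    define e' where "e' = (1 / norm u) *\<^sub>R u"
    have e': "cinner e' e' = 1" using False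
      by (simp add: e'_def cinner_scaleR_left cinner_scaleR_right cinner_self power2_eq_square)
    have e'E: "cinner e' e = 0" "cinner e e' = 0" if "e \<in> E" for e
      using ue[OF that] by (simp_all add: e'_def cinner_scaleR_left cinner_scaleR_right)
    have nE: "e' \<notin> E" using e'E e' by auto
    show ?thesis
    proof (intro exI[of _ "insert e' E"] conjI ballI allI impI)
      show "finite (insert e' E)" using E by simp
      show "orthonormal_family (insert e' E) (\<lambda>e. e)"
        unfolding orthonormal_family_def using orth e' e'E nE by auto
    next
      fix x assume x: "x \<in> insert v V"
      show "x = (\<Sum>e\<in>insert e' E. cinner x e *\<^sub>C e)"
      proof (cases "x \<in> V")
        case True
        have "cinner x e' = (\<Sum>e\<in>E. cinner x e * cinner e e')"
          by (subst E(3)[OF True]) (simp add: cinner_sum_left cinner_scaleC_left)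
        then have "cinner x e' = 0" by (simp add: e'E)
        then show ?thesis using E(1) nE E(3)[OF True] by simp
      next
        case False
        then have xv: "x = v" using x by simp
        have "cinner P e' = 0" by (simp add: P_def cinner_sum_left cinner_scaleC_left e'E)
        moreover have "cinner v e' = cinner P e' + cinner u e'" by (simp add: u_def flip: cinner_add_left)
        moreover have "cinner u e' = complex_of_real (norm u)" using \<open>u \<noteq> 0\<close>
          by (simp add: e'_def cinner_scaleR_right cinner_self power2_eq_square)
        ultimately have "cinner v e' = complex_of_real (norm u)" by simp
        then have "cinner v e' *\<^sub>C e' = u" using \<open>u \<noteq> 0\<close> by (simp add: scaleC_of_real e'_def)
        then have "(\<Sum>e\<in>insert e' E. cinner v e *\<^sub>C e) = u + P" using E(1) nE by (simp add: P_def)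
        then show ?thesis unfolding xv by (simp add: u_def)
      qed
    next
      fix w e assume w: "\<forall>x\<in>insert v V. cinner w x = 0" and e: "e \<in> insert e' E"
      have wE: "cinner w e = 0" if "e \<in> E" for e using E(4)[of w e] w that by blast
      have "cinner w P = 0" by (simp add: P_def cinner_sum_right cinner_scaleC_right wE)
      moreover have "cinner w v = cinner w P + cinner w u" by (simp add: u_def flip: cinner_add_right)
      ultimately have "cinner w u = 0" using w by simp
      then show "cinner w e = 0" using e wE by (auto simp: e'_def cinner_scaleR_right)
    qed
  qed
qed

definition rank_one :: "'a::chilbert_space \<Rightarrow> ('a \<Rightarrow>\<^sub>L 'a)" where
  "rank_one e = Blinfun (\<lambda>x. cinner x e *\<^sub>C e)"

lemma rank_one_apply [simp]: "rank_one e x = cinner x e *\<^sub>C e"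
proof -
  have "bounded_linear (\<lambda>x. cinner x e *\<^sub>C e)"
  proof (rule bounded_linear_intro)
    show "cinner (x + y) e *\<^sub>C e = cinner x e *\<^sub>C e + cinner y e *\<^sub>C e" for x y
      by (simp add: cinner_add_left scaleC_add_left)
    show "cinner (r *\<^sub>R x) e *\<^sub>C e = r *\<^sub>R cinner x e *\<^sub>C e" for r x
      by (simp add: cinner_scaleR_left scaleC_scaleC[symmetric] scaleC_of_real)
    show "norm (cinner x e *\<^sub>C e) \<le> norm x * (2 * norm e * norm e)" for x
    proof -
      have "cmod (cinner x e) \<le> \<bar>Re (cinner x e)\<bar> + \<bar>Im (cinner x e)\<bar>" by (rule cmod_le)
      also have "\<dots> \<le> norm x * norm e + norm (\<i> *\<^sub>C x) * norm e"
        unfolding Re_cinner Im_cinner abs_minus_cancel by (intro add_mono Cauchy_Schwarz_ineq2)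
      finally have "cmod (cinner x e) \<le> 2 * norm x * norm e" by (simp add: norm_scaleC mult.commute)
      then have "cmod (cinner x e) * norm e \<le> 2 * norm x * norm e * norm e" by (intro mult_right_mono) auto
      then show ?thesis by (simp add: norm_scaleC mult_ac)
    qed
  qed
  then show ?thesis unfolding rank_one_def by (simp add: bounded_linear_Blinfun_apply)
qed

lemma selfadjoint_rank_one: "selfadjoint (rank_one e)"
proof (rule selfadjointI_real_form)
  show "clinear_op (rank_one e)" by (simp add: clinear_op_def cinner_scaleC_left scaleC_scaleC)
  fix x
  have "cinner (rank_one e x) x = cinner x e * cnj (cinner x e)"
    using cinner_commute[of e x] by (simp add: cinner_scaleC_left)
  then show "Im (cinner (rank_one e x) x) = 0" by simp
qed

lemma rank_one_nonneg: "0 \<le> inner (rank_one e x) x"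
proof -
  have "inner (rank_one e x) x = Re (cinner x e * cnj (cinner x e))"
    using cinner_commute[of e x] by (simp add: Re_cinner[symmetric] cinner_scaleC_left)
  then show ?thesis by simp
qed

lemma rank_one_sum_basis:
  assumes "finite K" "orthonormal_family K e" "k \<in> K"
  shows "(\<Sum>l\<in>K. c l *\<^sub>R rank_one (e l) (e k)) = c k *\<^sub>R e k"
proof -
  have "(\<Sum>l\<in>K. c l *\<^sub>R rank_one (e l) (e k)) = (\<Sum>l\<in>K. if l = k then c k *\<^sub>R e k else 0)"
    using assms(2,3) scaleC_of_real[of 1 "e k"]
    by (intro sum.cong refl) (auto simp: orthonormal_family_def)
  then show ?thesis using assms by simp
qed

lemma orthonormal_projection:
  assumes K: "finite K" "orthonormal_family K e" and Q: "Q = (\<Sum>k\<in>K. rank_one (e k))"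
  shows "selfadjoint Q" "Q o\<^sub>L Q = Q" "inner (Q x) x \<le> (norm x)\<^sup>2"
proof -
  show sa: "selfadjoint Q" unfolding Q by (intro selfadjoint_sum selfadjoint_rank_one)
  have Qe: "Q (e k) = e k" if "k \<in> K" for k
    unfolding Q using rank_one_sum_basis[OF K that, of "\<lambda>_. 1"] by (simp add: blinfun.sum_left)
  have cl: "clinear_op Q" using sa by (rule selfadjoint_clinear)
  show QQ: "Q o\<^sub>L Q = Q"
  proof (rule blinfun_eqI)
    fix x
    have "Q (Q x) = Q (\<Sum>k\<in>K. cinner x (e k) *\<^sub>C e k)" by (subst (2) Q) (simp add: blinfun.sum_left)
    also have "\<dots> = (\<Sum>k\<in>K. cinner x (e k) *\<^sub>C Q (e k))"
      using cl by (simp add: blinfun.sum_right clinear_op_def)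
    also have "\<dots> = Q x" unfolding Q using Qe by (simp add: blinfun.sum_left Q)
    finally show "(Q o\<^sub>L Q) x = Q x" by simp
  qed
  have "0 \<le> (norm (x - Q x))\<^sup>2" by simp
  also have "\<dots> = (norm x)\<^sup>2 - inner (Q x) x"
    using selfadjointD[OF sa, of "Q x" x] blinfun_apply_blinfun_compose[of Q Q x] QQ
    by (simp add: power2_norm_eq_inner inner_simps inner_commute[of x "Q x"])
  finally show "inner (Q x) x \<le> (norm x)\<^sup>2" by simp
qed

lemma projection_onto_finite_span:
  fixes V :: "'a::chilbert_space set"
  assumes "finite V"
  shows "\<exists>Q. selfadjoint Q \<and> Q o\<^sub>L Q = Q \<and> (\<forall>v\<in>V. Q v = v) \<and>
    (\<forall>w. (\<forall>v\<in>V. cinner w v = 0) \<longrightarrow> Q w = 0)"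
proof -
  obtain E where E: "finite E" "orthonormal_family E (\<lambda>e. e)"
    "\<And>v. v \<in> V \<Longrightarrow> v = (\<Sum>e\<in>E. cinner v e *\<^sub>C e)"
    "\<And>w e. (\<forall>v\<in>V. cinner w v = 0) \<Longrightarrow> e \<in> E \<Longrightarrow> cinner w e = 0"
    using gram_schmidt[OF assms] by blast
  define Q where "Q = (\<Sum>e\<in>E. rank_one e)"
  have Qx: "Q x = (\<Sum>e\<in>E. cinner x e *\<^sub>C e)" for x by (simp add: Q_def blinfun.sum_left)
  show ?thesis
  proof (intro exI[of _ Q] conjI ballI allI impI)
    show "selfadjoint Q" "Q o\<^sub>L Q = Q" using orthonormal_projection(1,2)[OF E(1,2) Q_def] by auto
    show "Q v = v" if "v \<in> V" for v unfolding Qx using E(3)[OF that] by simp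
    show "Q w = 0" if "\<forall>v\<in>V. cinner w v = 0" for w unfolding Qx using E(4)[OF that] by simp
  qed
qed

section \<open>A diagonal model in the space of square-summable families\<close>

lemma ell2_orthonormal_family:
  fixes K :: "'k set"
  assumes "finite K"
  shows "\<exists>e :: 'k \<Rightarrow> 'i::infinite ell2. orthonormal_family K e"
proof -
  obtain \<phi> :: "'k \<Rightarrow> 'i" where \<phi>: "inj_on \<phi> K"
  proof -
    obtain A :: "'i set" where "finite A" "card A = card K"
      using infinite_arbitrarily_large[OF infinite_UNIV] by blast
    then obtain g where "bij_betw g K A" using assms finite_same_card_bij[of K A] by auto
    then show ?thesis using that by (auto simp: bij_betw_def)
  qed
  define \<delta> :: "'i \<Rightarrow> 'i ell2" where "\<delta> i = Abs_ell2 (\<lambda>j. if j = i then 1 else 0)" for i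
  have nth: "ell2_nth (\<delta> i) = (\<lambda>j. if j = i then 1 else 0)" for i
  proof -
    have "(\<lambda>j. (cmod (if j = i then 1 else 0))\<^sup>2) summable_on UNIV"
      by (rule finite_nonzero_values_imp_summable_on) simp
    then show ?thesis unfolding \<delta>_def by (simp add: Abs_ell2_inverse)
  qed
  have "cinner (\<delta> i) (\<delta> j) = (if i = j then 1 else 0)" for i j
  proof -
    have "cinner (\<delta> i) (\<delta> j) = (\<Sum>\<^sub>\<infinity>k. if k = i \<and> k = j then 1 else 0)"
      unfolding cinner_ell2_def nth by (intro infsum_cong) auto
    also have "\<dots> = (\<Sum>\<^sub>\<infinity>k\<in>{i}. if k = i \<and> k = j then 1 else 0)"
      by (rule infsum_cong_neutral) auto
    finally show ?thesis by simp
  qed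
  then have "orthonormal_family K (\<lambda>k. \<delta> (\<phi> k))"
    unfolding orthonormal_family_def using \<phi> by (auto simp: inj_on_eq_iff)
  then show ?thesis by blast
qed

text \<open>The operator is taken to be \<open>a\<close> off the span of the family: with the value 0 there, its form would
  leave the range between \<open>a\<close> and \<open>b\<close>.\<close>

lemma diagonal_operator:
  fixes e :: "'k \<Rightarrow> 'a::chilbert_space"
  assumes K: "finite K" "orthonormal_family K e" and t: "\<And>k. k \<in> K \<Longrightarrow> t k \<in> {a..b}" and ab: "a \<le> b"
  shows "\<exists>T. form_between a b T \<and> (\<forall>p. \<forall>k\<in>K. poly_op p T (e k) = poly p (t k) *\<^sub>R e k)"
proof -
  define T where "T = a *\<^sub>R id_blinfun + (\<Sum>k\<in>K. (t k - a) *\<^sub>R rank_one (e k))"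
  have Te: "T (e k) = t k *\<^sub>R e k" if "k \<in> K" for k
    using rank_one_sum_basis[OF K that, of "\<lambda>k. t k - a"]
    by (simp add: T_def blinfun.bilinear_simps blinfun.sum_left scaleR_left_diff_distrib)
  have form: "inner (T x) x = a * (norm x)\<^sup>2 + (\<Sum>k\<in>K. (t k - a) * inner (rank_one (e k) x) x)" for x
    by (simp add: T_def blinfun.bilinear_simps blinfun.sum_left inner_simps inner_sum_left power2_norm_eq_inner)
  have "form_between a b T"
    unfolding form_between_def
  proof (intro conjI allI)
    show "selfadjoint T" unfolding T_def
      by (intro selfadjoint_add selfadjoint_scaleR selfadjoint_id selfadjoint_sum selfadjoint_rank_one)
    fix x
    have "0 \<le> (\<Sum>k\<in>K. (t k - a) * inner (rank_one (e k) x) x)"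
      using t by (intro sum_nonneg mult_nonneg_nonneg rank_one_nonneg) auto
    then show "a * (norm x)\<^sup>2 \<le> inner (T x) x" by (simp add: form)
    have "(\<Sum>k\<in>K. (t k - a) * inner (rank_one (e k) x) x) \<le> (\<Sum>k\<in>K. (b - a) * inner (rank_one (e k) x) x)"
      using t by (intro sum_mono mult_right_mono rank_one_nonneg) auto
    also have "\<dots> = (b - a) * inner ((\<Sum>k\<in>K. rank_one (e k)) x) x"
      by (simp add: blinfun.sum_left inner_sum_left sum_distrib_left)
    also have "\<dots> \<le> (b - a) * (norm x)\<^sup>2"
      using ab by (intro mult_left_mono orthonormal_projection(3)[OF K refl]) auto
    finally show "inner (T x) x \<le> b * (norm x)\<^sup>2" by (simp add: form left_diff_distrib)
  qed
  moreover have "poly_op p T (e k) = poly p (t k) *\<^sub>R e k" if "k \<in> K" for p k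
    by (induction p) (simp_all add: poly_op_pCons blinfun.bilinear_simps Te[OF that] scaleR_add_left mult.commute)
  ultimately show ?thesis by blast
qed

text \<open>Finitely many Gram matrices are realized simultaneously by vectors in \<open>\<ell>\<^sup>2\<close>, one orthogonal
  block of coordinates for each \<open>i\<close>, so that the weights \<open>t i\<close> become the eigenvalues of a diagonal
  operator.\<close>

lemma diagonal_gram_model:
  fixes w :: "'k \<Rightarrow> nat \<Rightarrow> 'h::chilbert_space"
  assumes I: "finite I" and t: "\<And>i. i \<in> I \<Longrightarrow> t i \<in> {a..b}" and ab: "a \<le> b"
  shows "\<exists>(T :: 'i::infinite ell2 \<Rightarrow>\<^sub>L 'i ell2) \<xi>. form_between a b T \<and>
    (\<forall>p. \<forall>k\<le>N. \<forall>l. cinner (poly_op p T (\<xi> k)) (\<xi> l)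
       = (\<Sum>i\<in>I. complex_of_real (poly p (t i)) * cinner (w i k) (w i l)))"
proof -
  define V where "V = (\<lambda>(i, k). w i k) ` (I \<times> {..N})"
  have "finite V" using I by (simp add: V_def)
  then obtain E where E: "finite E" "\<And>v. v \<in> V \<Longrightarrow> v = (\<Sum>e\<in>E. cinner v e *\<^sub>C e)"
    using gram_schmidt[of V] by metis
  have K: "finite (I \<times> E)" using I E by simp
  obtain b' :: "'k \<times> 'h \<Rightarrow> 'i ell2" where b': "orthonormal_family (I \<times> E) b'"
    using ell2_orthonormal_family[OF K] by blast
  obtain T where T: "form_between a b T" "\<And>p k. k \<in> I \<times> E \<Longrightarrow> poly_op p T (b' k) = poly p (t (fst k)) *\<^sub>R b' k"
    using diagonal_operator[OF K b', of "\<lambda>k. t (fst k)" a b] t ab by auto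
  define \<xi> where "\<xi> k = (\<Sum>q\<in>I \<times> E. cinner (w (fst q) k) (snd q) *\<^sub>C b' q)" for k
  have "cinner (poly_op p T (\<xi> k)) (\<xi> l)
      = (\<Sum>i\<in>I. complex_of_real (poly p (t i)) * cinner (w i k) (w i l))" if k: "k \<le> N" for p k l
  proof -
    have cl: "clinear_op (poly_op p T)"
      by (intro selfadjoint_clinear selfadjoint_poly_op form_between_selfadjoint[OF T(1)])
    have "poly_op p T (\<xi> k) = (\<Sum>q\<in>I \<times> E. (complex_of_real (poly p (t (fst q))) * cinner (w (fst q) k) (snd q)) *\<^sub>C b' q)"
      unfolding \<xi>_def blinfun.sum_right using cl
      by (intro sum.cong refl)
        (simp add: clinear_op_def T(2) scaleC_of_real[symmetric] scaleC_scaleC mult.commute)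
    then have "cinner (poly_op p T (\<xi> k)) (\<xi> l) = (\<Sum>r\<in>I \<times> E. \<Sum>q\<in>I \<times> E.
        complex_of_real (poly p (t (fst q))) * cinner (w (fst q) k) (snd q) * cnj (cinner (w (fst r) l) (snd r)) * cinner (b' q) (b' r))"
      by (simp add: \<xi>_def cinner_sum_left cinner_sum_right cinner_scaleC_left cinner_scaleC_right sum_distrib_left mult_ac)
    also have "\<dots> = (\<Sum>q\<in>I \<times> E. \<Sum>r\<in>I \<times> E.
        complex_of_real (poly p (t (fst q))) * cinner (w (fst q) k) (snd q) * cnj (cinner (w (fst r) l) (snd r)) * cinner (b' q) (b' r))"
      by (rule sum.swap)
    also have "\<dots> = (\<Sum>q\<in>I \<times> E. \<Sum>r\<in>I \<times> E. if q = r then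
        complex_of_real (poly p (t (fst q))) * cinner (w (fst q) k) (snd q) * cnj (cinner (w (fst q) l) (snd q)) else 0)"
    proof (intro sum.cong refl)
      fix q r assume "q \<in> I \<times> E" "r \<in> I \<times> E"
      then have "cinner (b' q) (b' r) = (if q = r then 1 else 0)"
        using b' unfolding orthonormal_family_def by blast
      then show "complex_of_real (poly p (t (fst q))) * cinner (w (fst q) k) (snd q)
            * cnj (cinner (w (fst r) l) (snd r)) * cinner (b' q) (b' r)
          = (if q = r then complex_of_real (poly p (t (fst q))) * cinner (w (fst q) k) (snd q)
            * cnj (cinner (w (fst q) l) (snd q)) else 0)"
        by (cases "q = r") simp_all
    qed
    also have "\<dots> = (\<Sum>q\<in>I \<times> E.
        complex_of_real (poly p (t (fst q))) * cinner (w (fst q) k) (snd q) * cnj (cinner (w (fst q) l) (snd q)))"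
      using K by (intro sum.cong refl) simp
    also have "\<dots> = (\<Sum>i\<in>I. \<Sum>e\<in>E. complex_of_real (poly p (t i)) * (cinner (w i k) e * cinner e (w i l)))"
      unfolding sum.cartesian_product
    proof (intro sum.cong refl)
      fix q assume "q \<in> I \<times> E"
      have "cnj (cinner (w (fst q) l) (snd q)) = cinner (snd q) (w (fst q) l)"
        by (rule cinner_commute[symmetric])
      then show "complex_of_real (poly p (t (fst q))) * cinner (w (fst q) k) (snd q) * cnj (cinner (w (fst q) l) (snd q))
        = (case q of (i, e) \<Rightarrow> complex_of_real (poly p (t i)) * (cinner (w i k) e * cinner e (w i l)))"
        by (simp add: case_prod_beta mult.assoc)
    qed
    also have "\<dots> = (\<Sum>i\<in>I. complex_of_real (poly p (t i)) * cinner (w i k) (w i l))"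
    proof (intro sum.cong refl)
      fix i assume "i \<in> I"
      then have "w i k = (\<Sum>e\<in>E. cinner (w i k) e *\<^sub>C e)" using k by (intro E(2)) (auto simp: V_def)
      then have "cinner (w i k) (w i l) = cinner (\<Sum>e\<in>E. cinner (w i k) e *\<^sub>C e) (w i l)" by simp
      also have "\<dots> = (\<Sum>e\<in>E. cinner (w i k) e * cinner e (w i l))"
        by (simp only: cinner_sum_left cinner_scaleC_left)
      finally show "(\<Sum>e\<in>E. complex_of_real (poly p (t i)) * (cinner (w i k) e * cinner e (w i l)))
          = complex_of_real (poly p (t i)) * cinner (w i k) (w i l)" by (simp add: sum_distrib_left)
    qed
    finally show ?thesis .
  qed
  then show ?thesis using T(1) by blast
qed


section \<open>Jensen's operator inequality\<close>

lemma poly_op_sum_powers: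
  fixes Z :: "'a::chilbert_space \<Rightarrow>\<^sub>L 'a"
  assumes "\<And>k. k < degree p \<Longrightarrow> Z (\<xi> k) = \<xi> (Suc k)"
  shows "poly_op p Z (\<xi> 0) = (\<Sum>k\<le>degree p. coeff p k *\<^sub>R \<xi> k)"
proof -
  have pow: "((\<lambda>S. Z o\<^sub>L S) ^^ k) id_blinfun (\<xi> 0) = \<xi> k" if "k \<le> degree p" for k
    using that by (induction k) (simp_all add: assms)
  show ?thesis unfolding poly_on_def by (simp add: blinfun.sum_left blinfun.scaleR_left pow)
qed

lemma operator_convexD:
  fixes X Y :: "'i ell2 \<Rightarrow>\<^sub>L 'i ell2"
  assumes f: "operator_convex TYPE('i) J f" and ab: "{a..b} \<subseteq> J"
    and X: "form_between a b X" and Y: "form_between a b Y"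
  shows "inner (cfc f ((1/2) *\<^sub>R (X + Y)) x) x \<le> (inner (cfc f X x) x + inner (cfc f Y x) x) / 2"
proof -
  have P: "projection (id_blinfun :: 'i ell2 \<Rightarrow>\<^sub>L 'i ell2)" by (simp add: projection_def)
  have ops: "X \<in> ops_on id_blinfun" "Y \<in> ops_on id_blinfun"
    using selfadjoint_clinear form_between_selfadjoint X Y by (auto simp: ops_on_def)
  have "spectrum X \<subseteq> complex_of_real ` J" "spectrum Y \<subseteq> complex_of_real ` J"
    using form_between_spectrum[OF X] form_between_spectrum[OF Y] ab by blast+
  then have "cfc f ((1/2) *\<^sub>R (X + Y)) \<sqsubseteq> (1/2) *\<^sub>R (cfc f X + cfc f Y)"
    using f P ops form_between_selfadjoint[OF X] form_between_selfadjoint[OF Y]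
    unfolding operator_convex_def by blast
  then have "0 \<le> inner (((1/2) *\<^sub>R (cfc f X + cfc f Y) - cfc f ((1/2) *\<^sub>R (X + Y))) x) x"
    by (simp add: op_le_def positive_op_iff)
  then show ?thesis by (simp add: blinfun.bilinear_simps inner_simps)
qed

lemma poly_op_conjugate:
  fixes U T :: "'a::chilbert_space \<Rightarrow>\<^sub>L 'a"
  assumes U: "U o\<^sub>L U = id_blinfun"
  shows "poly_op p (U o\<^sub>L T o\<^sub>L U) = U o\<^sub>L poly_op p T o\<^sub>L U"
proof (induction p)
  case (pCons c p)
  have "U (U x) = x" for x using U by (metis blinfun_apply_blinfun_compose blinfun_apply_id_blinfun id_apply)
  then show ?case unfolding poly_op_pCons pCons.IH
    by (intro blinfun_eqI) (simp add: blinfun.bilinear_simps)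
qed simp

text \<open>Compression to the range of a projection \<open>Q\<close>, seen through the reflection \<open>U = 2 Q - 1\<close>:
  the midpoint of \<open>T\<close> and \<open>U T U\<close> is the block diagonal part of \<open>T\<close>, and on the range of \<open>Q\<close> the
  forms of \<open>f(T)\<close> and of \<open>f(U T U) = U f(T) U\<close> agree. Polynomials replace \<open>f\<close> wherever it is
  evaluated.\<close>

lemma jensen_compression:
  fixes T :: "'i ell2 \<Rightarrow>\<^sub>L 'i ell2"
  assumes f: "operator_convex TYPE('i) J f" and ab: "{a..b} \<subseteq> J" and T: "form_between a b T"
    and Q: "selfadjoint Q" "Q o\<^sub>L Q = Q" and \<xi>: "\<And>k. k \<le> degree p \<Longrightarrow> Q (\<xi> k) = \<xi> k"
    and step: "\<And>k. k < degree p \<Longrightarrow> Q (T (\<xi> k)) = \<xi> (Suc k)"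
    and e: "0 \<le> e" "\<And>t. t \<in> {a..b} \<Longrightarrow> \<bar>f t - poly p t\<bar> \<le> e"
  shows "(\<Sum>k\<le>degree p. coeff p k * inner (\<xi> k) (\<xi> 0))
    \<le> inner (poly_op p T (\<xi> 0)) (\<xi> 0) + 2 * e * (norm (\<xi> 0))\<^sup>2"
proof -
  define U where "U = 2 *\<^sub>R Q - id_blinfun"
  have Usa: "selfadjoint U" unfolding U_def by (intro selfadjoint_diff selfadjoint_scaleR Q selfadjoint_id)
  have QQ: "Q (Q x) = Q x" for x using Q(2) by (metis blinfun_apply_blinfun_compose)
  have UU: "U o\<^sub>L U = id_blinfun"
    by (rule blinfun_eqI) (simp add: U_def blinfun.bilinear_simps QQ scaleR_2)
  have UUx: "U (U x) = x" for x using UU by (metis blinfun_apply_blinfun_compose blinfun_apply_id_blinfun id_apply)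
  have U\<xi>: "U (\<xi> k) = \<xi> k" if "k \<le> degree p" for k
    using \<xi>[OF that] by (simp add: U_def blinfun.bilinear_simps scaleR_2)
  define T' where "T' = U o\<^sub>L T o\<^sub>L U"
  have normU: "norm (U x) = norm x" for x
    using selfadjointD[OF Usa, of x "U x"] UUx by (simp add: norm_eq_sqrt_inner)
  have T': "form_between a b T'"
    unfolding form_between_def
  proof (intro conjI allI)
    show "selfadjoint T'"
      using selfadjoint_congruence[OF form_between_selfadjoint[OF T] selfadjoint_clinear[OF Usa]] Usa
      by (simp add: T'_def selfadjoint_def)
    fix x
    have "inner (T' x) x = inner (T (U x)) (U x)" unfolding T'_def using selfadjointD[OF Usa] by simp
    then show "a * (norm x)\<^sup>2 \<le> inner (T' x) x" "inner (T' x) x \<le> b * (norm x)\<^sup>2"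
      using T normU[of x] unfolding form_between_def by metis+
  qed
  define Z where "Z = (1/2) *\<^sub>R (T + T')"
  have Z: "form_between a b Z"
    unfolding form_between_def
  proof (intro conjI allI)
    show "selfadjoint Z" unfolding Z_def
      by (intro selfadjoint_scaleR selfadjoint_add form_between_selfadjoint[OF T] form_between_selfadjoint[OF T'])
    fix x
    have "inner (Z x) x = (inner (T x) x + inner (T' x) x) / 2"
      by (simp add: Z_def blinfun.bilinear_simps inner_simps)
    moreover have "a * (norm x)\<^sup>2 \<le> inner (T x) x" "inner (T x) x \<le> b * (norm x)\<^sup>2"
      "a * (norm x)\<^sup>2 \<le> inner (T' x) x" "inner (T' x) x \<le> b * (norm x)\<^sup>2"
      using T T' by (auto simp: form_between_def)
    ultimately show "a * (norm x)\<^sup>2 \<le> inner (Z x) x" and "inner (Z x) x \<le> b * (norm x)\<^sup>2"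
      by (simp_all add: field_simps)
  qed
  have "Z (\<xi> k) = \<xi> (Suc k)" if k: "k < degree p" for k
  proof -
    have "Z (\<xi> k) = Q (T (\<xi> k))"
      using U\<xi>[of k] k by (simp add: Z_def T'_def blinfun.bilinear_simps) (simp add: U_def blinfun.bilinear_simps)
    then show ?thesis using step[OF k] by simp
  qed
  then have pZ: "inner (poly_op p Z (\<xi> 0)) (\<xi> 0) = (\<Sum>k\<le>degree p. coeff p k * inner (\<xi> k) (\<xi> 0))"
    by (simp add: poly_op_sum_powers inner_sum_left)
  have cont: "continuous_on {a..b} f"
    using f ab unfolding operator_convex_def by (blast intro: continuous_on_subset)
  define c where "c = e * (norm (\<xi> 0))\<^sup>2"
  have near: "\<bar>inner (cfc f X (\<xi> 0)) (\<xi> 0) - inner (poly_op p X (\<xi> 0)) (\<xi> 0)\<bar> \<le> c"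
    if X: "form_between a b X" for X
  proof -
    have "\<bar>inner ((cfc f X - poly_op p X) (\<xi> 0)) (\<xi> 0)\<bar> \<le> norm (cfc f X - poly_op p X) * (norm (\<xi> 0))\<^sup>2"
      by (rule form_le_norm)
    also have "\<dots> \<le> c" unfolding c_def
      by (intro mult_right_mono norm_cfc_diff_poly_le[OF X cont e]) auto
    finally show ?thesis by (simp add: blinfun.diff_left inner_diff_left)
  qed
  have "inner (poly_op p T' (\<xi> 0)) (\<xi> 0) = inner (poly_op p T (\<xi> 0)) (\<xi> 0)"
    unfolding T'_def poly_op_conjugate[OF UU] using U\<xi>[of 0] selfadjointD[OF Usa] by simp
  then have "inner (poly_op p Z (\<xi> 0)) (\<xi> 0) \<le> inner (poly_op p T (\<xi> 0)) (\<xi> 0) + 2 * c"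
    using operator_convexD[OF f ab T T', folded Z_def, of "\<xi> 0"] near[OF Z] near[OF T] near[OF T']
    by (simp add: field_simps)
  then show ?thesis unfolding pZ c_def by simp
qed

lemma le_of_le_add_epsilon:
  fixes x y c :: real
  assumes "\<And>e. 0 < e \<Longrightarrow> x \<le> y + e * c" "0 \<le> c"
  shows "x \<le> y"
proof (rule field_le_epsilon)
  fix d :: real assume d: "0 < d"
  have "x \<le> y + d / (c + 1) * c" using assms(2) d by (intro assms(1)) simp
  also have "d / (c + 1) * c \<le> d" using d assms(2) by (simp add: divide_simps)
  finally show "x \<le> y + d" by simp
qed

text \<open>Jensen's inequality for \<open>D = \<Sum> R\<^sub>i\<^sup>* R\<^sub>i\<close> and points \<open>t\<^sub>i\<close> with \<open>\<Sum> t\<^sub>i R\<^sub>i\<^sup>* R\<^sub>i = D S\<close>. For \<open>D = 1\<close> this is the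
  dilation argument of Naimark: \<open>V = (R\<^sub>i)\<^sub>i\<close> is an isometry and \<open>S\<close> is the compression \<open>V\<^sup>* T V\<close> of the
  diagonal operator \<open>T\<close> with entries \<open>t\<^sub>i\<close>. In general \<open>V\<close> is an isometry for the inner product
  \<open>\<langle>D x, y\<rangle>\<close>, in which \<open>S\<close> is still the compression of \<open>T\<close>; this avoids the square root of \<open>D\<close>.

  At a single vector \<open>y\<close>, a polynomial \<open>p(S)\<close> sees only the vectors \<open>S\<^sup>k y\<close> with \<open>k \<le> deg p\<close>. The dilation
  is thus needed on a finite-dimensional space only, and it fits into \<open>\<ell>\<^sup>2\<close> over any infinite index
  type, no matter how large the given Hilbert space is.\<close>

lemma weighted_jensen:
  fixes R :: "'k \<Rightarrow> 'h::chilbert_space \<Rightarrow>\<^sub>L 'h" and D S :: "'h \<Rightarrow>\<^sub>L 'h"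
  assumes f: "operator_convex TYPE('i::infinite) J f" and ab: "{a..b} \<subseteq> J" "a \<le> b"
    and I: "finite I" and t: "\<And>i. i \<in> I \<Longrightarrow> t i \<in> {a..b}"
    and S: "form_between a b S"
    and D: "\<And>x z. (\<Sum>i\<in>I. cinner (R i x) (R i z)) = cinner (D x) z"
    and DS: "\<And>x z. (\<Sum>i\<in>I. complex_of_real (t i) * cinner (R i x) (R i z)) = cinner (D (S x)) z"
  shows "inner (D (cfc f S y)) y \<le> (\<Sum>i\<in>I. f (t i) * (norm (R i y))\<^sup>2)"
proof (rule le_of_le_add_epsilon)
  fix e :: real assume e: "0 < e"
  have cont: "continuous_on {a..b} f"
    using f ab unfolding operator_convex_def by (blast intro: continuous_on_subset)
  obtain p where p: "\<And>s. s \<in> {a..b} \<Longrightarrow> \<bar>f s - poly p s\<bar> \<le> e"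
    using polynomials_dense[OF cont e] less_imp_le by metis
  define x where "x k = ((\<lambda>v. S v) ^^ k) y" for k
  \<comment> \<open>\<open>\<xi> k\<close> plays the role of \<open>V S\<^sup>k y\<close>.\<close>
  obtain T :: "'i ell2 \<Rightarrow>\<^sub>L 'i ell2" and \<xi> where T: "form_between a b T"
    and gram: "\<And>q k l. k \<le> degree p \<Longrightarrow> cinner (poly_op q T (\<xi> k)) (\<xi> l)
       = (\<Sum>i\<in>I. complex_of_real (poly q (t i)) * cinner (R i (x k)) (R i (x l)))"
    using diagonal_gram_model[where t = t and w = "\<lambda>i k. R i (x k)" and N = "degree p" and ?'i = 'i, OF I t ab(2)]
    by blast
  have \<xi>\<xi>: "cinner (\<xi> k) (\<xi> l) = cinner (D (x k)) (x l)" if "k \<le> degree p" for k l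
    using gram[OF that, of "[:1:]" l] by (simp add: poly_op_const D)
  have T\<xi>: "cinner (T (\<xi> k)) (\<xi> l) = cinner (D (S (x k))) (x l)" if "k \<le> degree p" for k l
    using gram[OF that, of "[:0, 1:]" l] by (simp add: poly_op_X DS)
  obtain Q where Q: "selfadjoint Q" "Q o\<^sub>L Q = Q" "\<And>k. k \<le> degree p \<Longrightarrow> Q (\<xi> k) = \<xi> k"
    "\<And>w. (\<And>k. k \<le> degree p \<Longrightarrow> cinner w (\<xi> k) = 0) \<Longrightarrow> Q w = 0"
    using projection_onto_finite_span[of "\<xi> ` {..degree p}"] by auto
  have step: "Q (T (\<xi> k)) = \<xi> (Suc k)" if k: "k < degree p" for k
  proof -
    have "Q (T (\<xi> k) - \<xi> (Suc k)) = 0"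
      using k by (intro Q(4)) (simp add: cinner_diff_left T\<xi> \<xi>\<xi> x_def)
    then show ?thesis using Q(3)[of "Suc k"] k by (simp add: blinfun.diff_right)
  qed
  have x0: "x 0 = y" by (simp add: x_def)
  have n0: "(norm (\<xi> 0))\<^sup>2 = inner (D y) y"
    using \<xi>\<xi>[of 0 0] by (metis Re_cinner power2_norm_eq_inner x0 le0)
  have sq: "Re (cinner (R i y) (R i y)) = (norm (R i y))\<^sup>2" for i
    by (simp add: Re_cinner power2_norm_eq_inner)
  have nD: "(\<Sum>i\<in>I. (norm (R i y))\<^sup>2) = inner (D y) y"
    unfolding Re_cinner[symmetric] D[symmetric] Re_sum sq ..
  have pS: "poly_op p S y = (\<Sum>k\<le>degree p. coeff p k *\<^sub>R x k)"
    using poly_op_sum_powers[of p S x] by (simp add: x_def)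
  have "inner (D (poly_op p S y)) y = (\<Sum>k\<le>degree p. coeff p k * inner (D (x k)) (x 0))"
    unfolding pS by (simp add: blinfun.bilinear_simps blinfun.sum_right inner_sum_left x0)
  also have "\<dots> = (\<Sum>k\<le>degree p. coeff p k * inner (\<xi> k) (\<xi> 0))"
    by (intro sum.cong refl) (simp add: Re_cinner[symmetric] \<xi>\<xi>)
  also have "\<dots> \<le> inner (poly_op p T (\<xi> 0)) (\<xi> 0) + 2 * e * (norm (\<xi> 0))\<^sup>2"
    using e by (intro jensen_compression[where \<xi> = \<xi> and p = p, OF f ab(1) T Q(1,2,3) step _ p]) auto
  also have "inner (poly_op p T (\<xi> 0)) (\<xi> 0) = (\<Sum>i\<in>I. poly p (t i) * (norm (R i y))\<^sup>2)"
    unfolding Re_cinner[symmetric] gram[OF le0] x0 by (simp add: sq)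
  also have "\<dots> \<le> (\<Sum>i\<in>I. f (t i) * (norm (R i y))\<^sup>2 + e * (norm (R i y))\<^sup>2)"
  proof (intro sum_mono)
    fix i assume "i \<in> I"
    then have "poly p (t i) \<le> f (t i) + e" using p[OF t] by (fastforce simp: abs_le_iff)
    then show "poly p (t i) * (norm (R i y))\<^sup>2 \<le> f (t i) * (norm (R i y))\<^sup>2 + e * (norm (R i y))\<^sup>2"
      unfolding distrib_right[symmetric] by (intro mult_right_mono) auto
  qed
  also have "\<dots> = (\<Sum>i\<in>I. f (t i) * (norm (R i y))\<^sup>2) + e * inner (D y) y"
    by (simp add: sum.distrib sum_distrib_left[symmetric] nD)
  finally have main: "inner (D (poly_op p S y)) y \<le> (\<Sum>i\<in>I. f (t i) * (norm (R i y))\<^sup>2) + 3 * e * inner (D y) y"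
    unfolding n0 by simp
  have "inner (D ((cfc f S - poly_op p S) y)) y \<le> norm (D ((cfc f S - poly_op p S) y)) * norm y"
    by (rule norm_cauchy_schwarz)
  also have "\<dots> \<le> norm D * (e * norm y) * norm y"
  proof (intro mult_right_mono)
    have "norm ((cfc f S - poly_op p S) y) \<le> norm (cfc f S - poly_op p S) * norm y" by (rule norm_blinfun)
    also have "\<dots> \<le> e * norm y"
      using e by (intro mult_right_mono norm_cfc_diff_poly_le[OF S cont _ p]) auto
    finally show "norm (D ((cfc f S - poly_op p S) y)) \<le> norm D * (e * norm y)"
      using norm_blinfun[of D "(cfc f S - poly_op p S) y"] mult_left_mono[OF _ norm_ge_zero[of D]] order_trans by blast
  qed simp
  finally have "inner (D (cfc f S y)) y \<le> inner (D (poly_op p S y)) y + e * (norm D * (norm y)\<^sup>2)"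
    by (simp add: blinfun.bilinear_simps inner_simps power2_eq_square mult_ac)
  then show "inner (D (cfc f S y)) y
      \<le> (\<Sum>i\<in>I. f (t i) * (norm (R i y))\<^sup>2) + e * (3 * inner (D y) y + norm D * (norm y)\<^sup>2)"
    using main by (simp add: algebra_simps)
next
  have "inner (D y) y = (\<Sum>i\<in>I. (norm (R i y))\<^sup>2)"
    unfolding Re_cinner[symmetric] D[symmetric] Re_sum by (simp add: cinner_self)
  then have "0 \<le> inner (D y) y" by (simp add: sum_nonneg)
  then show "0 \<le> 3 * inner (D y) y + norm D * (norm y)\<^sup>2" by simp
qed

section \<open>The inequality for conditional expectations\<close>

theorem theorem3p2:
  fixes f :: "real \<Rightarrow> real" and J :: "real set"
    and \<A> \<B> :: "('h::chilbert_space \<Rightarrow>\<^sub>L 'h) set"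
    and \<Phi> :: "('h \<Rightarrow>\<^sub>L 'h) \<Rightarrow> ('h \<Rightarrow>\<^sub>L 'h)"
    and B C :: "'h \<Rightarrow>\<^sub>L 'h"
  assumes "is_interval J"
    and "operator_convex TYPE('i::infinite) J f"
    and "unital_cstar_algebra \<A>"
    and "cstar_algebra \<B>" and "\<B> \<subseteq> \<A>" and "id_blinfun \<in> \<B>"
    and "conditional_expectation \<Phi> \<A> \<B>"
    and "C \<in> \<B>" and "op_invertible C"
    and "B \<in> \<A>" and "selfadjoint B"
    and "spectrum (id_blinfun - \<Phi> B)
           \<union> spectrum (op_inv (id_blinfun + (adj C o\<^sub>L C)))
           \<union> spectrum (op_inv (adj C) o\<^sub>L B o\<^sub>L op_inv C) \<subseteq> complex_of_real ` J"
  shows "cfc f (op_inv (id_blinfun + (adj C o\<^sub>L C))) o\<^sub>L (id_blinfun + (adj C o\<^sub>L C))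
       \<sqsubseteq> cfc f (id_blinfun - \<Phi> B)
          + (adj C o\<^sub>L \<Phi> (cfc f (op_inv (adj C) o\<^sub>L B o\<^sub>L op_inv C)) o\<^sub>L C)"
proof (cases "\<exists>x::'h. x \<noteq> 0")
  case False
  \<comment> \<open>On the zero space all spectra are empty, so there is no point of \<open>J\<close> to work with.\<close>
  then have "X = 0" for X :: "'h \<Rightarrow>\<^sub>L 'h" by (intro blinfun_eqI) simp
  then show ?thesis unfolding op_le_def positive_op_iff by (metis selfadjoint_zero blinfun.zero_left inner_zero_left order_refl)
next
  case nontriv: True
  interpret expectation \<Phi> \<A> \<B>
    using assms by unfold_locales
  note J = assms(1) and f = assms(2) and C = assms(8,9) and BA' = assms(10) and Bsa = assms(11)
  have clC: "clinear_op C" using C(2) by (rule op_invertible_clinear)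
  define Y where "Y = op_inv (adj C) o\<^sub>L B o\<^sub>L op_inv C"
  define A1 where "A1 = id_blinfun - \<Phi> B"
  define D where "D = id_blinfun + (adj C o\<^sub>L C)"
  define S where "S = op_inv D"
  have CiB: "op_inv C \<in> \<B>" by (rule cstar_op_inv[OF B unitB C])
  have Y_eq: "Y = adj (op_inv C) o\<^sub>L B o\<^sub>L op_inv C" unfolding Y_def op_inv_adj(2)[OF C(2)] ..
  have Ysa: "selfadjoint Y" unfolding Y_eq by (rule selfadjoint_congruence[OF Bsa op_inv(1)[OF C(2)]])
  have YA: "Y \<in> \<A>" unfolding Y_eq
    using cstar_algebraD(4)[OF A] cstar_algebraD(5)[OF B CiB] CiB BA BA' by blast
  have CYC: "adj C o\<^sub>L Y o\<^sub>L C = B"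
  proof (rule blinfun_eqI)
    fix x
    have "adj C (op_inv (adj C) z) = z" "op_inv C (C z) = z" for z
      using op_inv(3)[OF op_inv_adj(1)[OF C(2)]] op_inv(2)[OF C(2)]
      by (metis blinfun_apply_blinfun_compose blinfun_apply_id_blinfun id_apply)+
    then show "(adj C o\<^sub>L Y o\<^sub>L C) x = B x" by (simp add: Y_def)
  qed
  have \<Phi>B: "\<Phi> B = adj C o\<^sub>L \<Phi> Y o\<^sub>L C" using \<Phi>_congruence[OF C(1) YA] CYC by simp
  have A1sa: "selfadjoint A1" unfolding A1_def by (intro selfadjoint_diff selfadjoint_id selfadjoint_\<Phi> BA' Bsa)
  have CCB: "adj C o\<^sub>L C \<in> \<B>" by (intro cstar_algebraD(4,5)[OF B] C)
  have DB: "D \<in> \<B>" unfolding D_def by (intro cstar_algebraD(2)[OF B] unitB CCB)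
  have D1: "form_between 1 (1 + norm (adj C o\<^sub>L C)) D"
    unfolding form_between_def
  proof (intro conjI allI)
    show "selfadjoint D" unfolding D_def by (intro selfadjoint_add selfadjoint_id selfadjoint_adj_compose clC)
    fix x
    have eq: "inner (D x) x = (norm x)\<^sup>2 + inner ((adj C o\<^sub>L C) x) x"
      by (simp add: D_def blinfun.add_left inner_add_left power2_norm_eq_inner)
    have "0 \<le> inner ((adj C o\<^sub>L C) x) x" by (simp add: inner_adj_left[OF clC])
    then show "1 * (norm x)\<^sup>2 \<le> inner (D x) x" unfolding eq by simp
    show "inner (D x) x \<le> (1 + norm (adj C o\<^sub>L C)) * (norm x)\<^sup>2"
      unfolding eq using form_le_norm[of "adj C o\<^sub>L C" x] by (simp add: distrib_right)
  qed
  have Dsa: "selfadjoint D" by (rule form_between_selfadjoint[OF D1])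
  note inv = cstar_op_inv_selfadjoint[OF B unitB DB D1 zero_less_one, folded S_def]
  have spec: "spectrum A1 \<subseteq> complex_of_real ` J" "spectrum S \<subseteq> complex_of_real ` J" "spectrum Y \<subseteq> complex_of_real ` J"
    using assms(12) by (auto simp: A1_def S_def D_def Y_def)
  obtain a1 b1 where 1: "a1 \<in> J" "b1 \<in> J" "form_between a1 b1 A1"
    using form_bounds_in_spectrum[OF A1sa nontriv spec(1)] by blast
  obtain a2 b2 where 2: "a2 \<in> J" "b2 \<in> J" "form_between a2 b2 S"
    using form_bounds_in_spectrum[OF inv(4) nontriv spec(2)] by blast
  obtain a3 b3 where 3: "a3 \<in> J" "b3 \<in> J" "form_between a3 b3 Y"
    using form_bounds_in_spectrum[OF Ysa nontriv spec(3)] by blast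
  define a where "a = min a1 (min a2 a3)"
  define b where "b = max b1 (max b2 b3)"
  have abJ: "a \<in> J" "b \<in> J" using 1 2 3 by (auto simp: a_def b_def min_def max_def)
  have ab: "{a..b} \<subseteq> J"
    using J abJ unfolding is_interval_1 by (meson atLeastAtMost_iff subsetI)
  have A1: "form_between a b A1" and S: "form_between a b S" and Y: "form_between a b Y"
    by (rule form_between_mono[OF 1(3)] form_between_mono[OF 2(3)] form_between_mono[OF 3(3)];
        simp add: a_def b_def)+
  have aleb: "a \<le> b"
  proof -
    obtain x :: 'h where "x \<noteq> 0" using nontriv by blast
    moreover have "a * (norm x)\<^sup>2 \<le> b * (norm x)\<^sup>2" using A1 order_trans unfolding form_between_def by blast
    ultimately show ?thesis by simp
  qed
  have cont: "continuous_on {a..b} f"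
    using f ab unfolding operator_convex_def by (blast intro: continuous_on_subset)
  have fYA: "cfc f Y \<in> \<A>" by (rule cstar_cfc[OF A unitA YA Y cont])
  have le: "inner (D (cfc f S y)) y \<le> inner (cfc f A1 y) y + inner (\<Phi> (cfc f Y) (C y)) (C y)" for y
  proof (rule le_of_le_add_epsilon)
    fix e :: real assume e: "0 < e"
    obtain n :: nat and \<tau> g where \<tau>: "\<forall>i\<le>n. \<tau> i \<in> {a..b}"
      and g_cont: "\<forall>i. continuous_on {a..b} (g i)" and g_nonneg: "\<forall>i t. 0 \<le> g i t"
      and one: "\<forall>t\<in>{a..b}. (\<Sum>i\<le>n. g i t) = 1"
      and ident: "\<forall>t\<in>{a..b}. (\<Sum>i\<le>n. \<tau> i * g i t) = t"
      and approx: "\<forall>t\<in>{a..b}. \<bar>f t - (\<Sum>i\<le>n. f (\<tau> i) * g i t)\<bar> \<le> e"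
      using partition_of_unity[OF aleb cont e] .
    note g = g_cont[rule_format] g_nonneg[rule_format]
    have comb: "(\<Sum>i\<le>n. c i *\<^sub>R cfc (g i) X) = cfc (\<lambda>t. \<Sum>i\<le>n. c i * g i t) X"
      if X: "form_between a b X" for c and X :: "'h \<Rightarrow>\<^sub>L 'h"
    proof -
      have "(\<Sum>i\<le>n. c i *\<^sub>R cfc (g i) X) = (\<Sum>i\<le>n. cfc (\<lambda>t. c i * g i t) X)"
        using cfc_scale[OF X g(1)] by simp
      also have "\<dots> = cfc (\<lambda>t. \<Sum>i\<le>n. c i * g i t) X"
        by (rule cfc_sum[OF X, symmetric]) (intro continuous_intros g)
      finally show ?thesis .
    qed
    have comb1: "(\<Sum>i\<le>n. 1 *\<^sub>R cfc (g i) X) = id_blinfun" and comb\<tau>: "(\<Sum>i\<le>n. \<tau> i *\<^sub>R cfc (g i) X) = X"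
      and combf: "norm ((\<Sum>i\<le>n. f (\<tau> i) *\<^sub>R cfc (g i) X) - cfc f X) \<le> e"
      if X: "form_between a b X" for X :: "'h \<Rightarrow>\<^sub>L 'h"
    proof -
      have "cfc (\<lambda>t. \<Sum>i\<le>n. 1 * g i t) X = cfc (\<lambda>_. 1) X" by (rule cfc_cong[OF X]) (auto simp: one)
      then show "(\<Sum>i\<le>n. 1 *\<^sub>R cfc (g i) X) = id_blinfun"
        using comb[OF X, of "\<lambda>_. 1"] cfc_const[OF X, of 1] by simp
      have "cfc (\<lambda>t. \<Sum>i\<le>n. \<tau> i * g i t) X = cfc (\<lambda>t. t) X"
        by (rule cfc_cong[OF X]) (auto simp: ident)
      then show "(\<Sum>i\<le>n. \<tau> i *\<^sub>R cfc (g i) X) = X" using comb[OF X, of \<tau>] cfc_ident[OF X] by simp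
      let ?h = "\<lambda>t. \<Sum>i\<le>n. f (\<tau> i) * g i t"
      have h: "continuous_on {a..b} ?h" by (intro continuous_intros g)
      have d: "continuous_on {a..b} (\<lambda>t. ?h t + (-1) * f t)" by (intro continuous_intros h cont)
      have "cfc (\<lambda>t. ?h t + (-1) * f t) X = cfc ?h X - cfc f X"
        using cfc_add[OF X h, of "\<lambda>t. (-1) * f t"] cfc_scale[OF X cont, of "-1"] cont
        by (simp add: continuous_on_minus)
      moreover have "norm (cfc (\<lambda>t. ?h t + (-1) * f t) X) \<le> e"
        using approx e by (intro norm_cfc_le[OF X d]) (auto simp: abs_minus_commute)
      ultimately show "norm ((\<Sum>i\<le>n. f (\<tau> i) *\<^sub>R cfc (g i) X) - cfc f X) \<le> e"
        using comb[OF X, of "\<lambda>i. f (\<tau> i)"] by simp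
    qed
    have gY: "cfc (g i) Y \<in> \<A>" for i by (rule cstar_cfc[OF A unitA YA Y g(1)])
    define M where "M i = \<Phi> (cfc (g i) Y)" for i
    have \<Phi>comb: "(\<Sum>i\<le>n. c i *\<^sub>R M i) = \<Phi> (\<Sum>i\<le>n. c i *\<^sub>R cfc (g i) Y)" for c
      unfolding M_def using \<Phi>_sum[of "{..n}" "\<lambda>i. c i *\<^sub>R cfc (g i) Y"] cstar_scaleR[OF A gY] \<Phi>_scaleR[OF gY] by simp
    have "\<exists>R. selfadjoint R \<and> R o\<^sub>L R = cfc (g i) A1" for i
      using positive_factorization[OF selfadjoint_cfc[OF A1 g(1)] cfc_nonneg[OF A1 g(1)]] g(2) by blast
    then obtain RA where RA: "\<And>i. selfadjoint (RA i)" "\<And>i. RA i o\<^sub>L RA i = cfc (g i) A1" by metis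
    have "\<exists>R. selfadjoint R \<and> R o\<^sub>L R = M i" for i unfolding M_def
      using positive_factorization[OF selfadjoint_\<Phi>[OF gY selfadjoint_cfc[OF Y g(1)]]]
        \<Phi>_nonneg[OF gY selfadjoint_cfc[OF Y g(1)] cfc_nonneg[OF Y g(1)]] g(2) by blast
    then obtain RY where RY: "\<And>i. selfadjoint (RY i)" "\<And>i. RY i o\<^sub>L RY i = M i" by metis
    \<comment> \<open>The two families \<open>g\<^sub>i(A1)\<close> and \<open>C\<^sup>* \<Phi>(g\<^sub>i(Y)) C\<close> are factorized as \<open>R\<^sub>k\<^sup>* R\<^sub>k\<close>, with \<open>True\<close> marking the first.\<close>
    define R where "R k = (if fst k then RA (snd k) else RY (snd k) o\<^sub>L C)" for k :: "bool \<times> nat"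
    define K where "K = (UNIV :: bool set) \<times> {..n}"
    have weighted: "(\<Sum>k\<in>K. complex_of_real (c (snd k)) * cinner (R k x) (R k z))
        = cinner ((\<Sum>i\<le>n. c i *\<^sub>R cfc (g i) A1) x) z + cinner ((\<Sum>i\<le>n. c i *\<^sub>R M i) (C x)) (C z)" for c x z
    proof -
      have RAx: "cinner (RA i x) (RA i z) = cinner (cfc (g i) A1 x) z" for i
        unfolding RA(2)[symmetric] using selfadjoint_cinner[OF RA(1)] by simp
      have RYx: "cinner (RY i x) (RY i z) = cinner (M i x) z" for i x z
        unfolding RY(2)[symmetric] using selfadjoint_cinner[OF RY(1)] by simp
      have "(\<Sum>k\<in>K. complex_of_real (c (snd k)) * cinner (R k x) (R k z))
          = (\<Sum>r\<in>UNIV. \<Sum>i\<le>n. complex_of_real (c i) * cinner (R (r, i) x) (R (r, i) z))"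
        unfolding K_def sum.cartesian_product by (simp add: case_prod_beta)
      also have "\<dots> = (\<Sum>i\<le>n. complex_of_real (c i) * cinner (cfc (g i) A1 x) z)
          + (\<Sum>i\<le>n. complex_of_real (c i) * cinner (M i (C x)) (C z))"
        by (simp add: UNIV_bool R_def RAx RYx)
      finally show ?thesis
        by (simp add: blinfun.sum_left blinfun.scaleR_left cinner_sum_left cinner_scaleR_left)
    qed
    have "inner (D (cfc f S y)) y \<le> (\<Sum>k\<in>K. f (\<tau> (snd k)) * (norm (R k y))\<^sup>2)"
    proof (rule weighted_jensen[OF f ab aleb _ _ S, where t = "\<lambda>k. \<tau> (snd k)"])
      show "finite K" by (simp add: K_def)
      show "\<tau> (snd k) \<in> {a..b}" if "k \<in> K" for k using that \<tau> by (auto simp: K_def)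
      show "(\<Sum>k\<in>K. cinner (R k x) (R k z)) = cinner (D x) z" for x z
      proof -
        have "(\<Sum>i\<le>n. 1 *\<^sub>R M i) = id_blinfun"
          unfolding \<Phi>comb comb1[OF Y] by (rule \<Phi>_fix[OF unitB])
        then show ?thesis using weighted[of "\<lambda>_. 1" x z] comb1[OF A1] cinner_adj[OF clC, of z]
          by (simp add: D_def blinfun.add_left cinner_add_left cinner_adj[OF clinear_adj[OF clC]] adj_adj[OF clC])
      qed
      show "(\<Sum>k\<in>K. complex_of_real (\<tau> (snd k)) * cinner (R k x) (R k z)) = cinner (D (S x)) z" for x z
      proof -
        have "D (S x) = x" using inv(3) by (metis blinfun_apply_blinfun_compose blinfun_apply_id_blinfun id_apply)
        \<comment> \<open>By the module property the two copies of \<open>\<Phi> B\<close> cancel, and \<open>1 = D S\<close> is left.\<close>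
        moreover have "A1 x + adj C (\<Phi> Y (C x)) = x"
          by (simp add: A1_def \<Phi>B blinfun.diff_left)
        ultimately have "cinner (D (S x)) z = cinner (A1 x + adj C (\<Phi> Y (C x))) z" by simp
        then show ?thesis unfolding weighted comb\<tau>[OF A1] \<Phi>comb comb\<tau>[OF Y]
          by (simp add: cinner_add_left cinner_adj[OF clinear_adj[OF clC]] adj_adj[OF clC])
      qed
    qed
    also have "\<dots> = Re (\<Sum>k\<in>K. complex_of_real (f (\<tau> (snd k))) * cinner (R k y) (R k y))"
      by (simp add: Re_cinner power2_norm_eq_inner)
    also have "\<dots> = inner ((\<Sum>i\<le>n. f (\<tau> i) *\<^sub>R cfc (g i) A1) y) y + inner ((\<Sum>i\<le>n. f (\<tau> i) *\<^sub>R M i) (C y)) (C y)"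
      unfolding weighted[of "\<lambda>i. f (\<tau> i)"] by (simp add: Re_cinner)
    also have "\<dots> \<le> (inner (cfc f A1 y) y + e * (norm y)\<^sup>2) + (inner (\<Phi> (cfc f Y) (C y)) (C y) + e * (norm (C y))\<^sup>2)"
    proof (rule add_mono)
      have near: "inner (X x) x \<le> inner (X' x) x + e * (norm x)\<^sup>2" if "norm (X - X') \<le> e"
        for X X' :: "'h \<Rightarrow>\<^sub>L 'h" and x
        using form_le_norm[of "X - X'" x] mult_right_mono[OF that, of "(norm x)\<^sup>2"]
        by (simp add: blinfun.diff_left inner_diff_left)
      show "inner ((\<Sum>i\<le>n. f (\<tau> i) *\<^sub>R cfc (g i) A1) y) y \<le> inner (cfc f A1 y) y + e * (norm y)\<^sup>2"
        by (rule near[OF combf[OF A1]])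
      have FA: "(\<Sum>i\<le>n. f (\<tau> i) *\<^sub>R cfc (g i) Y) \<in> \<A>" by (intro cstar_sum[OF A] cstar_scaleR[OF A] gY)
      have "norm ((\<Sum>i\<le>n. f (\<tau> i) *\<^sub>R M i) - \<Phi> (cfc f Y)) \<le> e"
        unfolding \<Phi>comb \<Phi>_diff[OF FA fYA, symmetric]
        using norm_\<Phi>[OF cstar_diff[OF A FA fYA]] combf[OF Y] by simp
      then show "inner ((\<Sum>i\<le>n. f (\<tau> i) *\<^sub>R M i) (C y)) (C y)
          \<le> inner (\<Phi> (cfc f Y) (C y)) (C y) + e * (norm (C y))\<^sup>2"
        by (rule near)
    qed
    finally show "inner (D (cfc f S y)) y \<le> (inner (cfc f A1 y) y + inner (\<Phi> (cfc f Y) (C y)) (C y))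
        + e * ((norm y)\<^sup>2 + (norm (C y))\<^sup>2)"
      by (simp add: distrib_left)
  qed simp
  have comm: "D o\<^sub>L cfc f S = cfc f S o\<^sub>L D"
    by (rule cfc_commute[OF S cont]) (use inv(2,3)[OF] in simp)
  have "positive_op (cfc f A1 + (adj C o\<^sub>L \<Phi> (cfc f Y) o\<^sub>L C) - (cfc f S o\<^sub>L D))"
    unfolding positive_op_iff
  proof (intro conjI allI)
    show "selfadjoint (cfc f A1 + (adj C o\<^sub>L \<Phi> (cfc f Y) o\<^sub>L C) - (cfc f S o\<^sub>L D))"
      by (intro selfadjoint_diff selfadjoint_add selfadjoint_congruence selfadjoint_compose_commute
          selfadjoint_\<Phi> selfadjoint_cfc[OF A1 cont] selfadjoint_cfc[OF S cont] selfadjoint_cfc[OF Y cont]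
          fYA clC Dsa comm[symmetric])
    show "0 \<le> inner ((cfc f A1 + (adj C o\<^sub>L \<Phi> (cfc f Y) o\<^sub>L C) - (cfc f S o\<^sub>L D)) y) y" for y
      unfolding comm[symmetric] using le[of y] inner_adj_left[OF clC]
      by (simp add: blinfun.bilinear_simps inner_simps)
  qed
  then show ?thesis unfolding op_le_def A1_def S_def D_def Y_def .
qed

end
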